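(* Let $d\in\mathbb{N}$, $\beta\ge 1$, $\ell$ the largest integer strictly smaller than $\beta$, $L_0,\dots,L_\ell,L_\beta>0$, $C_{\mathsf{noise}},C_{\mathsf{cvr}}>0$. There is a constant $C>0$ large enough, depending only on $d,n_{\mathsf{max}},\beta,L_0,\dots,L_\ell,L_\beta,C_{\mathsf{noise}},C_{\mathsf{cvr}}$, with the following property. Consider the ODE observation model described in the context, satisfying (Noise), (Cover) and (EquidistantTime) with time step $\Delta t>0$. Assume $$\Delta t\le C^{-1}\qquad\text{and}\qquad n\,\Delta t^2\ge C.$$ Then $$\forall x_0\in[0,1]^d:\ C\inf_{\hat f}\sup_{f^\star\in\mathcal{F}_{d,\beta}}\mathbf{E}_{f^\star}\big[\|\hat f(x_0)-f^\star(x_0)\|_2^2\big]\ge (n\Delta t^2)^{-\frac{2\beta}{2\beta+d}}+\Delta t^{2\beta},$$ $$C\inf_{\hat f}\sup_{f^\star\in\mathcal{F}_{d,\beta}}\mathbf{E}_{f^\star}\Big[\sup_{x\in[0,1]^d}\|\hat f(x)-f^\star(x)\|_2^2\Big]\ge \Big(\frac{n\Delta t^2}{\log(n\Delta t^2)}\Big)^{-\frac{2\beta}{2\beta+d}}+\Delta t^{2\beta},$$ $$C\inf_{\hat f}\sup_{f^\star\in\mathcal{F}_{d,\beta}}\mathbf{E}_{f^\star}\Big[\big\|\,\|\hat f-f^\star\|_2\,\big\|_{L^2([0,1]^d)}^2\Big]\ge (n\Delta t^2)^{-\frac{2\beta}{2\beta+d}}+\Delta t^{2\beta},$$ where the infima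 range over all estimators $\hat f$ of $f^\star$ based on the observations $(Y_{j,i})$.
   Context: Smoothness class: $\mathcal{F}_{d,\beta}$ is the set of functions $f=(f_1,\dots,f_d):\mathbb{R}^d\to\mathbb{R}^d$ such that each component $f_j$ is $\ell$ times differentiable, $\sup_x\|D^kf_j(x)\|_{\mathsf{op}}\le L_k$ for $k=0,\dots,\ell$, and $\|D^\ell f_j(x)-D^\ell f_j(\tilde x)\|_{\mathsf{op}}\le L_\beta\|x-\tilde x\|_2^{\beta-\ell}$ for all $x,\tilde x\in\mathbb{R}^d$. Here $D^k f_j(x)$ is the $k$-th derivative as a symmetric $k$-linear form and $\|A\|_{\mathsf{op}}=\sup\{|A(v_1,\dots,v_k)|:\|v_i\|_2=1\}$; $\|\cdot\|_2$ is the Euclidean norm. Flow: for Lipschitz $f:\mathbb{R}^d\to\mathbb{R}^d$ and $x\in\mathbb{R}^d$, $t\mapsto U(f,x,t)$, $t\in\mathbb{R}$, is the solution of $\dot u(t)=f(u(t))$, $u(0)=x$. Observation model: $m\in\mathbb{N}$ trajectories; $n_1,\dots,n_m\in\mathbb{N}$ observations per trajectory, $n_{\mathsf{max}}=\max_j n_j$, total number of observations $n=\sum_jn_j$; durations $T_1,\dots,T_m>0$; known observation times $0=t_{j,0}\le t_{j,1}\le\dots\le t_{j,n_j}=T_j$; known initial conditions $x_1,\dots,x_m\in\mathbb{R}^d$. One observes $$Y_{j,i}=U(f^\star,x_j,t_{j,i})+\varepsilon_{j,i},\qquad j\in\{1,\dots,m\},\ i\in\{1,\dots,n_j\},$$ with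 $f^\star\in\mathcal{F}_{d,\beta}$ unknown and $\varepsilon_{j,i}$ i.i.d. centered $\mathbb{R}^d$-valued with distribution $P^\varepsilon$. $\mathbf{E}_{f^\star}$ is the corresponding expectation. (Noise): for all $v_1,v_2\in\mathbb{R}^d$, $\mathrm{KL}(v_1+P^\varepsilon,v_2+P^\varepsilon)\le C_{\mathsf{noise}}\|v_1-v_2\|_2^2$, where $\mathrm{KL}$ is the Kullback–Leibler divergence and $v+P$ is the distribution $P$ shifted by $v$. (Cover): for all $z\in[0,1]^d$ and $r>0$, $\frac1m\#\{j\in\{1,\dots,m\}:\|x_j-z\|_2<r\}\le\max(\frac1m,C_{\mathsf{cvr}}r^d)$. (EquidistantTime): $t_{j,i+1}-t_{j,i}=\Delta t$ for all $j\in\{1,\dots,m\}$ and $i\in\{0,\dots,n_j-1\}$, i.e. $t_{j,i}=i\Delta t$. *)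

theory Defs
  imports "HOL-Probability.Probability"
begin

text \<open>
  \<open>iter_deriv g [v\<^sub>1, \<dots>, v\<^sub>k] x\<close> is the value \<open>D\<^sup>k g(x)(v\<^sub>1, \<dots>, v\<^sub>k)\<close> of the \<open>k\<close>-th derivative,
  regarded as a \<open>k\<close>-linear form on lists of length \<open>k\<close>.
\<close>

primrec iter_deriv :: "('a::real_normed_vector \<Rightarrow> real) \<Rightarrow> 'a list \<Rightarrow> 'a \<Rightarrow> real" where
  "iter_deriv g [] = g"
| "iter_deriv g (v # vs) = (\<lambda>x. frechet_derivative (iter_deriv g vs) (at x) v)"

text \<open>
  Frechet differentiability of the form-valued map \<open>x \<mapsto> D\<^sup>k g(x)\<close> is expressed through its
  evaluations at fixed directions; the two agree because the space of \<open>k\<close>-linear forms on a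
  Euclidean space is finite-dimensional.
\<close>

definition times_differentiable :: "nat \<Rightarrow> ('a::euclidean_space \<Rightarrow> real) \<Rightarrow> bool" where
  "times_differentiable k g \<longleftrightarrow>
     (\<forall>vs x. length vs < k \<longrightarrow> iter_deriv g vs differentiable (at x))"

definition form_norm :: "nat \<Rightarrow> ('a::real_normed_vector list \<Rightarrow> real) \<Rightarrow> real" where
  "form_norm k A = (SUP vs\<in>{vs. length vs = k \<and> (\<forall>v\<in>set vs. norm v = 1)}. \<bar>A vs\<bar>)"

text \<open>The class \<open>\<F>\<close> on \<open>\<real>\<^sup>d\<close>; only \<open>L 0, \<dots>, L l\<close> are used.\<close>

definition hoelder_class ::
  "nat \<Rightarrow> real \<Rightarrow> (nat \<Rightarrow> real) \<Rightarrow> real \<Rightarrow> (real^'d \<Rightarrow> real^'d) set" where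
  "hoelder_class l \<beta> L L\<beta> = {f. \<forall>j. let g = (\<lambda>x. f x $ j) in
       times_differentiable l g \<and>
       (\<forall>k\<le>l. \<forall>x. form_norm k (\<lambda>vs. iter_deriv g vs x) \<le> L k) \<and>
       (\<forall>x x'. form_norm l (\<lambda>vs. iter_deriv g vs x - iter_deriv g vs x')
                 \<le> L\<beta> * norm (x - x') powr (\<beta> - real l))}"

text \<open>Meaningful for Lipschitz \<open>f\<close>, where the global solution exists and is unique.\<close>

definition ode_flow :: "('a::real_normed_vector \<Rightarrow> 'a) \<Rightarrow> 'a \<Rightarrow> real \<Rightarrow> 'a" where
  "ode_flow f x = (THE u. u 0 = x \<and> (\<forall>t. (u has_vector_derivative f (u t)) (at t)))"

definition obs_index :: "nat \<Rightarrow> (nat \<Rightarrow> nat) \<Rightarrow> (nat \<times> nat) set" where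
  "obs_index m n = (SIGMA j:{1..m}. {1..n j})"

definition observations ::
  "(nat \<times> nat) set \<Rightarrow> (nat \<Rightarrow> real^'d) \<Rightarrow> (nat \<Rightarrow> nat \<Rightarrow> real) \<Rightarrow> (real^'d \<Rightarrow> real^'d) \<Rightarrow>
   (nat \<times> nat \<Rightarrow> real^'d) \<Rightarrow> nat \<times> nat \<Rightarrow> real^'d" where
  "observations I x t f \<epsilon> = (\<lambda>(j, i)\<in>I. ode_flow f (x j) (t j i) + \<epsilon> (j, i))"

text \<open>
  Expectation of a nonnegative statistic \<open>h\<close> of the observations when \<open>f\<close> is the true
  function. The i.i.d. noise is realised on its canonical space, the product of copies of \<open>P\<close>.
\<close>

definition obs_expectation ::
  "(real^'d) measure \<Rightarrow> (nat \<times> nat) set \<Rightarrow> (nat \<Rightarrow> real^'d) \<Rightarrow> (nat \<Rightarrow> nat \<Rightarrow> real) \<Rightarrow>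
   (real^'d \<Rightarrow> real^'d) \<Rightarrow> ((nat \<times> nat \<Rightarrow> real^'d) \<Rightarrow> ennreal) \<Rightarrow> ennreal" where
  "obs_expectation P I x t f h = (\<integral>\<^sup>+\<epsilon>. h (observations I x t f \<epsilon>) \<partial>PiM I (\<lambda>_. P))"

text \<open>
  An estimator maps data to a function. Joint measurability in the data and the argument makes
  the pointwise and the integrated loss measurable in the data; the supremum loss is then
  universally measurable, so that its \<open>nn_integral\<close> is the integral against the completion.
\<close>

definition estimators ::
  "(nat \<times> nat) set \<Rightarrow> ((nat \<times> nat \<Rightarrow> real^'d) \<Rightarrow> real^'d \<Rightarrow> real^'d) set" where
  "estimators I = {fh. (\<lambda>(y, z). fh y z) \<in> PiM I (\<lambda>_. borel) \<Otimes>\<^sub>M borel \<rightarrow>\<^sub>M borel}"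

text \<open>
  \<open>KL P Q\<close> is the divergence of \<open>P\<close> from \<open>Q\<close>. \<open>KL_divergence\<close> has its arguments in the
  opposite order and is real-valued; the value \<open>\<infinity>\<close> is restored here. The negative part of the
  log-density is always \<open>P\<close>-integrable, so a non-integrable one means an infinite divergence.
\<close>

definition KL :: "'a measure \<Rightarrow> 'a measure \<Rightarrow> ereal" where
  "KL P Q = (if absolutely_continuous Q P \<and> integrable P (entropy_density (exp 1) Q P)
             then ereal (KL_divergence (exp 1) Q P) else \<infinity>)"

definition shifted :: "'a::{plus,topological_space} \<Rightarrow> 'a measure \<Rightarrow> 'a measure" where
  "shifted v P = distr P borel (\<lambda>z. v + z)"

definition centered_law :: "(real^'d) measure \<Rightarrow> bool" where
  "centered_law P \<longleftrightarrow> prob_space P \<and> sets P = sets borel \<and>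
     integrable P (\<lambda>z. z) \<and> (\<integral>z. z \<partial>P) = 0"

definition noise_condition :: "real \<Rightarrow> (real^'d) measure \<Rightarrow> bool" where
  "noise_condition Cn P \<longleftrightarrow>
     (\<forall>v1 v2. KL (shifted v1 P) (shifted v2 P) \<le> ereal (Cn * (norm (v1 - v2))\<^sup>2))"

definition cover_condition :: "real \<Rightarrow> nat \<Rightarrow> (nat \<Rightarrow> real^'d) \<Rightarrow> bool" where
  "cover_condition Cc m x \<longleftrightarrow> (\<forall>z\<in>cbox 0 1. \<forall>r>0.
     real (card {j \<in> {1..m}. norm (x j - z) < r}) / real m
       \<le> max (1 / real m) (Cc * r ^ CARD('d)))"

definition observation_times ::
  "nat \<Rightarrow> (nat \<Rightarrow> nat) \<Rightarrow> (nat \<Rightarrow> real) \<Rightarrow> (nat \<Rightarrow> nat \<Rightarrow> real) \<Rightarrow> bool" where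
  "observation_times m n T t \<longleftrightarrow> (\<forall>j\<in>{1..m}. n j \<ge> 1 \<and> T j > 0 \<and>
     t j 0 = 0 \<and> t j (n j) = T j \<and> (\<forall>i<n j. t j i \<le> t j (i + 1)))"

definition equidistant_times ::
  "real \<Rightarrow> nat \<Rightarrow> (nat \<Rightarrow> nat) \<Rightarrow> (nat \<Rightarrow> nat \<Rightarrow> real) \<Rightarrow> bool" where
  "equidistant_times \<Delta> m n t \<longleftrightarrow> (\<forall>j\<in>{1..m}. \<forall>i<n j. t j (i + 1) - t j i = \<Delta>)"

end

theory Submission
  imports Defs
begin

text \<open>
  The two terms of the rate come from unrelated obstructions.

  The term \<open>\<Delta> powr (2 * \<beta>)\<close> is a discretisation effect. A field
  \<open>(v + a cos (H x\<^sub>i - \<phi>)) e\<^sub>i\<close> with \<open>H\<close> of order \<open>1 / \<Delta>\<close> and \<open>a\<close> of order \<open>\<Delta> powr \<beta>\<close>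
  moves every point by exactly one spatial period during the time \<open>\<Delta>\<close>, if \<open>H\<close> is chosen well,
  whatever the phase \<open>\<phi>\<close>. Four phases in quadrature give the same observations, although
  their squared errors add up to at least \<open>2 a\<^sup>2\<close> at every point.

  The other term is statistical. Around the zero field, a bump of width \<open>1 / H\<close> and height of order
  \<open>H powr (- \<beta>)\<close> moves only the trajectories that start inside it, and these by \<open>O(\<Delta> H powr (- \<beta>))\<close>.
  By (Cover) and (Noise), the divergence between the models with and without a bump is
  \<open>O(\<Delta>\<^sup>2 + N \<Delta>\<^sup>2 H powr (- 2 \<beta> - d))\<close>. Two hypotheses give the pointwise bound, one bump per grid
  cell the uniform bound, and independent choices in all grid cells the integrated bound.
\<close>

section \<open>Global flows of bounded Lipschitz fields\<close>

text \<open>Comparing the flows of two nearby fields would normally cost a Gronwall factor, and a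
  trajectory could carry a perturbation far from where it was placed. Adding a bump where the old
  field vanishes avoids both: its support consists of equilibria of the old field, so a trajectory
  starting outside is exactly unchanged, and one starting inside is compared with a point at rest.
  Only starting positions matter, and these are what (Cover) counts.

  The summand \<open>\<Delta>\<^sup>2\<close> of the divergence reflects the \<open>1 / m\<close> in
  (Cover): one start inside the bump is always allowed. It is only bounded by a constant, and a
  small amplitude factor \<open>c0\<close> makes it harmless. Balancing the other summand against a
  constant gives \<open>H\<close> of order \<open>N * \<Delta>\<^sup>2\<close> to the power
  \<open>1 / (2 * \<beta> + d)\<close>. With one hypothesis per cell the divergence may be as large
  as a multiple of the logarithm of the number of cells, whence the logarithm in the uniform rate.

  In the oscillating field the drift \<open>v\<close> keeps the speed away from 0, so no phase traps
  a trajectory; changing the phase only changes the time at which one and the same scalar solution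
  is entered.\<close>

definition solves_ode :: "('a::real_normed_vector \<Rightarrow> 'a) \<Rightarrow> 'a \<Rightarrow> (real \<Rightarrow> 'a) \<Rightarrow> bool" where
  "solves_ode f x u \<longleftrightarrow> u 0 = x \<and> (\<forall>t. (u has_vector_derivative f (u t)) (at t))"

lemma solves_ode_reverse:
  assumes "solves_ode f x u"
  shows "solves_ode (\<lambda>y. - f y) x (\<lambda>t. u (- t))"
proof -
  have "((\<lambda>t. u (- t)) has_vector_derivative - f (u (- t))) (at t)" for t
  proof -
    have "((u \<circ> uminus) has_vector_derivative (-1) *\<^sub>R f (u (- t))) (at t)"
      by (rule vector_diff_chain_at)
         (use assms in \<open>auto simp: solves_ode_def intro!: derivative_eq_intros\<close>)
    then show ?thesis by (simp add: o_def)
  qed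
  then show ?thesis using assms by (auto simp: solves_ode_def)
qed

text \<open>Gronwall in differential form: the squared distance damped by
  \<open>exp (- (2 * K) * s)\<close> starts at 0, and its derivative is nonpositive by
  Cauchy-Schwarz and the Lipschitz bound. The inner product makes the squared distance
  differentiable.\<close>

lemma solves_ode_unique_forward:
  fixes f :: "'a::real_inner \<Rightarrow> 'a"
  assumes lip: "\<And>x y. norm (f x - f y) \<le> K * norm (x - y)"
    and u: "solves_ode f x u" and w: "solves_ode f x w" and "t \<ge> 0"
  shows "u t = w t"
proof -
  define g where "g = (\<lambda>s. (u s - w s) \<bullet> (u s - w s) * exp (- (2 * K) * s))"
  have du: "(u has_derivative (\<lambda>h. h *\<^sub>R f (u s))) (at s)" for s
    using u by (simp add: solves_ode_def has_vector_derivative_def)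
  have dw: "(w has_derivative (\<lambda>h. h *\<^sub>R f (w s))) (at s)" for s
    using w by (simp add: solves_ode_def has_vector_derivative_def)
  have dg: "(g has_real_derivative (2 * ((u s - w s) \<bullet> (f (u s) - f (w s)))
      - 2 * K * ((u s - w s) \<bullet> (u s - w s))) * exp (- (2 * K) * s)) (at s)" for s
    unfolding g_def has_field_derivative_def
    by (rule derivative_eq_intros du dw refl)+
       (auto simp: fun_eq_iff algebra_simps inner_diff_left inner_diff_right inner_commute)
  have "g t \<le> g 0"
  proof (rule DERIV_nonpos_imp_nonincreasing[OF \<open>0 \<le> t\<close>])
    fix s
    have "(u s - w s) \<bullet> (f (u s) - f (w s)) \<le> norm (u s - w s) * norm (f (u s) - f (w s))"
      by (rule norm_cauchy_schwarz)
    also have "\<dots> \<le> norm (u s - w s) * (K * norm (u s - w s))"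
      by (rule mult_left_mono[OF lip]) simp
    also have "\<dots> = K * ((u s - w s) \<bullet> (u s - w s))"
      by (simp add: power2_norm_eq_inner[symmetric] power2_eq_square)
    finally have "(2 * ((u s - w s) \<bullet> (f (u s) - f (w s)))
      - 2 * K * ((u s - w s) \<bullet> (u s - w s))) * exp (- (2 * K) * s) \<le> 0"
      by (intro mult_nonpos_nonneg) auto
    with dg show "\<exists>y. (g has_real_derivative y) (at s) \<and> y \<le> 0" by blast
  qed
  moreover have "g 0 = 0" using u w by (simp add: g_def solves_ode_def)
  ultimately have "(u t - w t) \<bullet> (u t - w t) * exp (- (2 * K) * t) \<le> 0" by (simp add: g_def)
  then have "(u t - w t) \<bullet> (u t - w t) \<le> 0"
    by (simp add: mult_le_0_iff)
  then show ?thesis by (metis eq_iff_diff_eq_0 inner_eq_zero_iff inner_ge_zero order_antisym)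
qed

lemma solves_ode_unique:
  fixes f :: "'a::real_inner \<Rightarrow> 'a"
  assumes lip: "\<And>x y. norm (f x - f y) \<le> K * norm (x - y)"
    and u: "solves_ode f x u" and w: "solves_ode f x w"
  shows "u = w"
proof
  fix t show "u t = w t"
  proof (cases "t \<ge> 0")
    case True
    then show ?thesis using solves_ode_unique_forward[OF lip u w] by blast
  next
    case False
    have "norm (- f x - - f y) \<le> K * norm (x - y)" for x y
      using lip[of x y] by (simp add: norm_minus_commute)
    from solves_ode_unique_forward[OF this solves_ode_reverse[OF u] solves_ode_reverse[OF w], of "- t"]
    show ?thesis using False by simp
  qed
qed

text \<open>The source of the contraction: integrating \<open>exp (M * \<bar>s\<bar>)\<close> gains
  a factor \<open>1 / M\<close>, which beats a Lipschitz constant below \<open>M\<close>.\<close>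

lemma exp_primitive_bound:
  fixes F :: "real \<Rightarrow> 'a::euclidean_space"
  assumes F: "\<And>s. (F has_vector_derivative g s) (at s)" and "F 0 = 0"
    and g: "\<And>s. norm (g s) \<le> C * exp (M * \<bar>s\<bar>)" and "M > 0"
  shows "norm (F t) \<le> C / M * exp (M * \<bar>t\<bar>)"
proof -
  have C: "C \<ge> 0" using order_trans[OF norm_ge_zero g[of 0]] by simp
  \<comment> \<open>Stated for arbitrary \<open>F\<close> and \<open>g\<close>, since negative times
    are reduced to it by reflecting the primitive.\<close>
  have fw: "norm (F t) \<le> C / M * exp (M * t)"
    if F: "\<And>s. (F has_vector_derivative g s) (at s)" and "F 0 = 0"
      and g: "\<And>s. norm (g s) \<le> C * exp (M * \<bar>s\<bar>)" and "t \<ge> 0"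
    for F :: "real \<Rightarrow> 'a" and g t
  proof (cases "t = 0")
    case True then show ?thesis using C \<open>M > 0\<close> that by simp
  next
    case False
    have "norm (F t - F 0) \<le> C / M * exp (M * t) - C / M * exp (M * 0)"
    proof (rule differentiable_bound_general[where f' = "\<lambda>s. g s" and \<phi>' = "\<lambda>s. C * exp (M * s)"])
      show "0 < t" using False that by simp
      show "continuous_on {0..t} F"
        using F by (intro continuous_at_imp_continuous_on ballI has_vector_derivative_continuous)
      show "continuous_on {0..t} (\<lambda>s. C / M * exp (M * s))" by (intro continuous_intros)
      show "(F has_vector_derivative g s) (at s)" for s by (rule F)
      show "((\<lambda>s. C / M * exp (M * s)) has_vector_derivative C * exp (M * s)) (at s)" for s
        unfolding has_real_derivative_iff_has_vector_derivative[symmetric]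
        using \<open>M > 0\<close> by (auto intro!: derivative_eq_intros)
      show "norm (g s) \<le> C * exp (M * s)" if "0 < s" for s using g[of s] that by simp
    qed
    also have "\<dots> \<le> C / M * exp (M * t)" using C \<open>M > 0\<close> by simp
    finally show ?thesis using \<open>F 0 = 0\<close> by simp
  qed
  show ?thesis
  proof (cases "t \<ge> 0")
    case True then show ?thesis using fw[OF F \<open>F 0 = 0\<close> g] by simp
  next
    case False
    have "((\<lambda>s. F (- s)) has_vector_derivative - g (- s)) (at s)" for s
    proof -
      have "((F \<circ> uminus) has_vector_derivative (-1) *\<^sub>R g (- s)) (at s)"
        by (rule vector_diff_chain_at) (use F in \<open>auto intro!: derivative_eq_intros\<close>)
      then show ?thesis by (simp add: o_def)
    qed
    from fw[OF this, of "- t"] show ?thesis using False \<open>F 0 = 0\<close> g[of "- s" for s] by simp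
  qed
qed

lemma antiderivative_UNIV:
  fixes g :: "real \<Rightarrow> 'a::euclidean_space"
  assumes "continuous_on UNIV g"
  obtains F where "F 0 = 0" "\<And>t. (F has_vector_derivative g t) (at t)"
proof -
  have "\<exists>F. \<forall>x::real. - \<infinity> < ereal x \<longrightarrow> ereal x < \<infinity> \<longrightarrow> (F has_vector_derivative g x) (at x)"
    by (rule einterval_antiderivative)
       (use assms in \<open>auto simp: continuous_on_eq_continuous_at\<close>)
  then obtain F where F: "\<And>x. (F has_vector_derivative g x) (at x)" by auto
  show ?thesis
  proof (rule that[of "\<lambda>t. F t - F 0"])
    show "((\<lambda>t. F t - F 0) has_vector_derivative g t) (at t)" for t
      using has_vector_derivative_diff[OF F has_vector_derivative_const] by simp
  qed simp
qed

text \<open>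
  The Picard operator is a contraction for the weighted norm
  \<open>sup\<^sub>t exp (- 2 K \<bar>t\<bar>) \<parallel>u t - x\<parallel>\<close>, which gives a global solution in a single step.
\<close>

lemma solves_ode_exists:
  fixes f :: "'a::euclidean_space \<Rightarrow> 'a" and x :: 'a
  assumes lip: "\<And>x y. norm (f x - f y) \<le> K * norm (x - y)"
    and bdd: "\<And>x. norm (f x) \<le> B"
  shows "\<exists>u. solves_ode f x u"
proof -
  \<comment> \<open>The factor 2 gives the contraction constant 1/2; the maximum with 1 keeps
    \<open>M\<close> positive for every \<open>K\<close>.\<close>
  define M where "M = 2 * max K 1"
  have M: "M > 0" "K \<le> M / 2" by (auto simp: M_def)
  have B: "B \<ge> 0" using bdd norm_ge_zero order_trans by blast
  have lip': "norm (f x - f y) \<le> M / 2 * norm (x - y)" for x y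
    using lip[of x y] mult_right_mono[OF M(2) norm_ge_zero[of "x - y"]] by linarith
  have contf: "continuous_on UNIV f"
  proof -
    have "(M / 2)-lipschitz_on UNIV f"
      using lip' M by (intro lipschitz_onI) (auto simp: dist_norm)
    then show ?thesis by (rule lipschitz_on_continuous_on)
  qed
  \<comment> \<open>A candidate solution is written as
    \<open>x + exp (M * \<bar>t\<bar>) *\<^sub>R b t\<close> with \<open>b\<close> bounded and
    continuous. Its weighted distance from \<open>x\<close> is then the plain supremum norm of
    \<open>b\<close>, so the fixed point theorem applies in the complete space of bounded continuous
    functions.\<close>
  have "\<exists>F. \<forall>b::real \<Rightarrow>\<^sub>C 'a. F b 0 = 0 \<and>
      (\<forall>t. (F b has_vector_derivative f (x + exp (M * \<bar>t\<bar>) *\<^sub>R apply_bcontfun b t)) (at t))"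
  proof (intro choice allI)
    fix b :: "real \<Rightarrow>\<^sub>C 'a"
    have "continuous_on UNIV (\<lambda>t. f (x + exp (M * \<bar>t\<bar>) *\<^sub>R apply_bcontfun b t))"
      by (rule continuous_on_compose2[OF contf]) (auto intro!: continuous_intros)
    from antiderivative_UNIV[OF this]
    show "\<exists>F. F 0 = 0 \<and>
      (\<forall>t. (F has_vector_derivative f (x + exp (M * \<bar>t\<bar>) *\<^sub>R apply_bcontfun b t)) (at t))"
      by metis
  qed
  then obtain F :: "(real \<Rightarrow>\<^sub>C 'a) \<Rightarrow> real \<Rightarrow> 'a" where F0: "\<And>b. F b 0 = 0"
    and F: "\<And>b t. (F b has_vector_derivative f (x + exp (M * \<bar>t\<bar>) *\<^sub>R apply_bcontfun b t)) (at t)"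
    by auto
  define Q where "Q b t = exp (- (M * \<bar>t\<bar>)) *\<^sub>R F b t" for b t
  have Q: "Q b \<in> bcontfun" for b
  proof (rule bcontfun_normI)
    have "continuous_on UNIV (F b)"
      using F by (intro continuous_at_imp_continuous_on ballI has_vector_derivative_continuous)
    then show "continuous_on UNIV (Q b)" unfolding Q_def by (intro continuous_intros)
    fix t
    have "norm (F b t) \<le> B / M * exp (M * \<bar>t\<bar>)"
    proof (rule exp_primitive_bound[OF F F0 _ M(1)])
      fix s
      have "norm (f (x + exp (M * \<bar>s\<bar>) *\<^sub>R apply_bcontfun b s)) \<le> B * 1" using bdd by simp
      also have "\<dots> \<le> B * exp (M * \<bar>s\<bar>)" using B M by (intro mult_left_mono) auto
      finally show "norm (f (x + exp (M * \<bar>s\<bar>) *\<^sub>R apply_bcontfun b s)) \<le> B * exp (M * \<bar>s\<bar>)" .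
    qed
    then show "norm (Q b t) \<le> B / M" by (simp add: Q_def exp_minus field_simps)
  qed
  define T where "T b = Bcontfun (Q b)" for b
  have T: "apply_bcontfun (T b) = Q b" for b by (simp add: T_def Bcontfun_inverse Q)
  have contr: "dist (T b) (T b') \<le> 1 / 2 * dist b b'" for b b'
  proof (rule dist_bound)
    fix t
    have "norm (F b t - F b' t) \<le> (M / 2 * dist b b') / M * exp (M * \<bar>t\<bar>)"
    proof (rule exp_primitive_bound[OF has_vector_derivative_diff[OF F F] _ _ M(1)])
      fix s
      have "norm (f (x + exp (M * \<bar>s\<bar>) *\<^sub>R apply_bcontfun b s)
          - f (x + exp (M * \<bar>s\<bar>) *\<^sub>R apply_bcontfun b' s))
        \<le> M / 2 * (exp (M * \<bar>s\<bar>) * norm (apply_bcontfun b s - apply_bcontfun b' s))"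
        using lip'[of "x + exp (M * \<bar>s\<bar>) *\<^sub>R apply_bcontfun b s" "x + exp (M * \<bar>s\<bar>) *\<^sub>R apply_bcontfun b' s"]
        by (simp add: scaleR_diff_right[symmetric])
      also have "\<dots> \<le> M / 2 * (exp (M * \<bar>s\<bar>) * dist b b')"
        using M dist_bounded[of b s b'] by (intro mult_left_mono) (auto simp: dist_norm)
      finally show "norm (f (x + exp (M * \<bar>s\<bar>) *\<^sub>R apply_bcontfun b s)
          - f (x + exp (M * \<bar>s\<bar>) *\<^sub>R apply_bcontfun b' s)) \<le> M / 2 * dist b b' * exp (M * \<bar>s\<bar>)"
        by (simp add: mult_ac)
    qed (simp add: F0)
    then have *: "norm (F b t - F b' t) \<le> 1 / 2 * dist b b' * exp (M * \<bar>t\<bar>)" using M by simp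
    have "dist (Q b t) (Q b' t) = exp (- (M * \<bar>t\<bar>)) * norm (F b t - F b' t)"
      by (simp add: Q_def dist_norm scaleR_diff_right[symmetric])
    also have "\<dots> \<le> exp (- (M * \<bar>t\<bar>)) * (1 / 2 * dist b b' * exp (M * \<bar>t\<bar>))"
      using * by (intro mult_left_mono) auto
    also have "\<dots> = 1 / 2 * dist b b'" by (simp add: exp_minus)
    finally show "dist (apply_bcontfun (T b) t) (apply_bcontfun (T b') t) \<le> 1 / 2 * dist b b'"
      by (simp add: T)
  qed
  have "\<exists>!b. T b = b" by (rule banach_fix_type[of "1/2"]) (use contr in auto)
  then obtain b where b: "T b = b" by blast
  have eq: "x + exp (M * \<bar>t\<bar>) *\<^sub>R apply_bcontfun b t = x + F b t" for t
    using T[of b] b by (simp add: Q_def exp_minus)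
  have "((\<lambda>t. x + F b t) has_vector_derivative f (x + F b t)) (at t)" for t
    using has_vector_derivative_add[OF has_vector_derivative_const F[of b t], of x] eq by simp
  then have "solves_ode f x (\<lambda>t. x + F b t)" by (simp add: solves_ode_def F0)
  then show ?thesis by blast
qed

lemma ode_flow_eqI:
  fixes f :: "'a::real_inner \<Rightarrow> 'a"
  assumes "\<And>x y. norm (f x - f y) \<le> K * norm (x - y)" and "solves_ode f x u"
  shows "ode_flow f x = u"
  unfolding ode_flow_def solves_ode_def[symmetric]
  using assms solves_ode_unique by blast

lemma solves_ode_ode_flow:
  fixes f :: "'a::euclidean_space \<Rightarrow> 'a"
  assumes "\<And>x y. norm (f x - f y) \<le> K * norm (x - y)" "\<And>x. norm (f x) \<le> B"
  shows "solves_ode f x (ode_flow f x)"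
  using ode_flow_eqI solves_ode_exists assms by metis

lemma solves_ode_dist_le:
  fixes f :: "'a::euclidean_space \<Rightarrow> 'a"
  assumes u: "solves_ode f x u" and bdd: "\<And>x. norm (f x) \<le> B" and "t \<ge> 0"
  shows "norm (u t - x) \<le> B * t"
proof (cases "t = 0")
  case True then show ?thesis using u by (simp add: solves_ode_def)
next
  case False
  have "norm (u t - u 0) \<le> B * t - B * 0"
  proof (rule differentiable_bound_general[where f' = "\<lambda>s. f (u s)" and \<phi>' = "\<lambda>_. B"])
    show "0 < t" using False \<open>t \<ge> 0\<close> by simp
    show "continuous_on {0..t} u"
      using u unfolding solves_ode_def
      by (blast intro: continuous_at_imp_continuous_on has_vector_derivative_continuous)
    show "continuous_on {0..t} (\<lambda>s. B * s)" by (intro continuous_intros)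
    show "(u has_vector_derivative f (u s)) (at s)" for s using u by (simp add: solves_ode_def)
    show "((\<lambda>s. B * s) has_vector_derivative B) (at s)" for s
      unfolding has_real_derivative_iff_has_vector_derivative[symmetric]
      by (auto intro!: derivative_eq_intros)
  qed (rule bdd)
  then show ?thesis using u by (simp add: solves_ode_def)
qed

lemma ode_flow_equilibrium:
  fixes f :: "'a::real_inner \<Rightarrow> 'a"
  assumes "\<And>x y. norm (f x - f y) \<le> K * norm (x - y)" "f x = 0"
  shows "ode_flow f x = (\<lambda>_. x)"
  by (rule ode_flow_eqI[OF assms(1)]) (use assms in \<open>auto simp: solves_ode_def intro!: derivative_eq_intros\<close>)

lemma solves_ode_time_shift:
  assumes "solves_ode f x u"
  shows "solves_ode f (u s) (\<lambda>t. u (s + t))"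
proof -
  have "((u \<circ> (\<lambda>t. s + t)) has_vector_derivative 1 *\<^sub>R f (u (s + t))) (at t)" for t
    by (rule vector_diff_chain_at) (use assms in \<open>auto simp: solves_ode_def intro!: derivative_eq_intros\<close>)
  then show ?thesis by (auto simp: solves_ode_def o_def)
qed

text \<open>
  A trajectory of \<open>f\<close> that entered \<open>A\<close> would hit an equilibrium, hence be constant; so outside
  \<open>A\<close> the flow does not see how \<open>f\<close> is modified inside \<open>A\<close>.
\<close>

lemma ode_flow_eq_outside:
  fixes f g :: "'a::euclidean_space \<Rightarrow> 'a"
  assumes f: "\<And>x y. norm (f x - f y) \<le> K * norm (x - y)" "\<And>x. norm (f x) \<le> B"
    and g: "\<And>x y. norm (g x - g y) \<le> K' * norm (x - y)"
    and zero: "\<And>y. y \<in> A \<Longrightarrow> f y = 0" and eq: "\<And>y. y \<notin> A \<Longrightarrow> g y = f y" and "x \<notin> A"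
  shows "ode_flow g x = ode_flow f x"
proof -
  let ?u = "ode_flow f x"
  have u: "solves_ode f x ?u" by (rule solves_ode_ode_flow[OF f])
  have "?u t \<notin> A" for t
  proof
    assume "?u t \<in> A"
    then have 0: "f (?u t) = 0" by (rule zero)
    have "(\<lambda>s. ?u (t + s)) = ode_flow f (?u t)"
      by (rule ode_flow_eqI[OF f(1), symmetric]) (rule solves_ode_time_shift[OF u])
    also have "\<dots> = (\<lambda>_. ?u t)" by (rule ode_flow_equilibrium[OF f(1) 0])
    finally have "?u (t + - t) = ?u t" by meson
    then have "?u t = x" using u by (simp add: solves_ode_def)
    with \<open>?u t \<in> A\<close> \<open>x \<notin> A\<close> show False by simp
  qed
  then have "solves_ode g x ?u" using u eq by (simp add: solves_ode_def)
  then show ?thesis by (rule ode_flow_eqI[OF g])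
qed

section \<open>Functions with bounded derivatives\<close>

text \<open>Bounds for all derivatives up to order \<open>k\<close> by one constant: the factor
  \<open>norm v\<close> at each level makes the derivative in directions v1, ..., vj at most
  \<open>C\<close> times the product of their norms. \<open>U\<close> is any set outside which the
  function and these derivatives vanish; it need not be closed, so open cubes that touch still count
  as disjoint.\<close>

primrec smooth_bound :: "nat \<Rightarrow> real \<Rightarrow> 'a set \<Rightarrow> ('a::real_normed_vector \<Rightarrow> real) \<Rightarrow> bool" where
  "smooth_bound 0 C U g \<longleftrightarrow> (\<forall>x. \<bar>g x\<bar> \<le> C) \<and> (\<forall>x. x \<notin> U \<longrightarrow> g x = 0)"
| "smooth_bound (Suc k) C U g \<longleftrightarrow> (\<forall>x. \<bar>g x\<bar> \<le> C) \<and> (\<forall>x. x \<notin> U \<longrightarrow> g x = 0) \<and>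
     (\<forall>x. g differentiable (at x)) \<and>
     (\<forall>v. smooth_bound k (C * norm v) U (\<lambda>x. frechet_derivative g (at x) v))"

lemma smooth_bound_abs_le: "smooth_bound k C U g \<Longrightarrow> \<bar>g x\<bar> \<le> C"
  by (cases k) auto

lemma smooth_bound_support: "smooth_bound k C U g \<Longrightarrow> x \<notin> U \<Longrightarrow> g x = 0"
  by (cases k) auto

lemma smooth_bound_nonneg: "smooth_bound k C U g \<Longrightarrow> C \<ge> 0"
  using smooth_bound_abs_le[of k C U g] abs_ge_zero order_trans by blast

lemma smooth_bound_SucI:
  assumes "\<And>x. \<bar>g x\<bar> \<le> C" "\<And>x. x \<notin> U \<Longrightarrow> g x = 0"
    and g': "\<And>x. (g has_derivative g' x) (at x)"
    and "\<And>v. smooth_bound k (C * norm v) U (\<lambda>x. g' x v)"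
  shows "smooth_bound (Suc k) C U g"
proof -
  have "frechet_derivative g (at x) = g' x" for x
    using frechet_derivative_at[OF g'] by simp
  moreover have "g differentiable at x" for x using g' by (rule differentiableI)
  ultimately show ?thesis using assms by auto
qed

lemma smooth_bound_has_derivative:
  "smooth_bound (Suc k) C U g \<Longrightarrow> (g has_derivative frechet_derivative g (at x)) (at x)"
  by (simp add: frechet_derivative_works)

lemma smooth_bound_mono:
  "smooth_bound k C U g \<Longrightarrow> C \<le> C' \<Longrightarrow> U \<subseteq> U' \<Longrightarrow> smooth_bound k C' U' g"
proof (induction k arbitrary: C C' g)
  case 0 then show ?case by (auto intro: order_trans)
next
  case (Suc k)
  have "smooth_bound k (C' * norm v) U' (\<lambda>x. frechet_derivative g (at x) v)" for v
    by (rule Suc.IH[of "C * norm v"]) (use Suc.prems in \<open>auto intro: mult_right_mono\<close>)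
  then show ?case using Suc.prems by (auto intro: order_trans)
qed

lemma smooth_bound_Suc_imp: "smooth_bound (Suc k) C U g \<Longrightarrow> smooth_bound k C U g"
proof (induction k arbitrary: C g)
  case (Suc k)
  then show ?case by (subst smooth_bound.simps(2)) (metis smooth_bound.simps(2))
qed simp

lemma smooth_bound_le: "smooth_bound k C U g \<Longrightarrow> j \<le> k \<Longrightarrow> smooth_bound j C U g"
  by (induction k arbitrary: j) (auto simp: le_Suc_eq simp del: smooth_bound.simps dest: smooth_bound_Suc_imp)

lemma smooth_bound_zero: "C \<ge> 0 \<Longrightarrow> smooth_bound k C U (\<lambda>_. 0)"
proof (induction k arbitrary: C)
  case (Suc k) then show ?case by (intro smooth_bound_SucI[where g' = "\<lambda>_ _. 0"]) auto
qed simp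

lemma smooth_bound_one: "smooth_bound k 1 UNIV (\<lambda>_. 1)"
  by (cases k) (simp, auto intro!: smooth_bound_SucI[where g' = "\<lambda>_ _. 0"] smooth_bound_zero simp del: smooth_bound.simps(2))

lemma smooth_bound_cmult:
  "smooth_bound k C U g \<Longrightarrow> smooth_bound k (\<bar>c\<bar> * C) U (\<lambda>x. c * g x)"
proof (induction k arbitrary: C g)
  case 0 then show ?case by (auto simp: abs_mult intro: mult_left_mono)
next
  case (Suc k)
  show ?case
  proof (rule smooth_bound_SucI)
    show "((\<lambda>x. c * g x) has_derivative (\<lambda>v. c * frechet_derivative g (at x) v)) (at x)" for x
      by (intro derivative_intros smooth_bound_has_derivative[OF Suc.prems])
    show "\<bar>c * g x\<bar> \<le> \<bar>c\<bar> * C" for x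
      using Suc.prems by (auto simp: abs_mult intro: mult_left_mono)
    show "x \<notin> U \<Longrightarrow> c * g x = 0" for x using Suc.prems by auto
    show "smooth_bound k (\<bar>c\<bar> * C * norm v) U (\<lambda>x. c * frechet_derivative g (at x) v)" for v
      using Suc.IH[of "C * norm v"] Suc.prems by (auto simp: mult.assoc)
  qed
qed

lemma smooth_bound_add:
  "smooth_bound k A U g \<Longrightarrow> smooth_bound k B U h \<Longrightarrow> smooth_bound k (A + B) U (\<lambda>x. g x + h x)"
proof (induction k arbitrary: A B g h)
  case 0 then show ?case by (auto intro: order_trans[OF abs_triangle_ineq add_mono])
next
  case (Suc k)
  show ?case
  proof (rule smooth_bound_SucI)
    show "((\<lambda>x. g x + h x) has_derivative
        (\<lambda>v. frechet_derivative g (at x) v + frechet_derivative h (at x) v)) (at x)" for x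
      by (intro derivative_intros smooth_bound_has_derivative[OF Suc.prems(1)]
          smooth_bound_has_derivative[OF Suc.prems(2)])
    show "\<bar>g x + h x\<bar> \<le> A + B" for x
      using Suc.prems by (auto intro: order_trans[OF abs_triangle_ineq add_mono])
    show "x \<notin> U \<Longrightarrow> g x + h x = 0" for x using Suc.prems by auto
    show "smooth_bound k ((A + B) * norm v) U
        (\<lambda>x. frechet_derivative g (at x) v + frechet_derivative h (at x) v)" for v
      using Suc.IH[of "A * norm v" _ "B * norm v"] Suc.prems by (auto simp: distrib_right)
  qed
qed

text \<open>By the Leibniz rule every order of differentiation doubles the number of products, hence
  the factor \<open>2 ^ k\<close>.\<close>

lemma smooth_bound_mult:
  "smooth_bound k A U g \<Longrightarrow> smooth_bound k B V h \<Longrightarrow>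
    smooth_bound k (2 ^ k * A * B) (U \<inter> V) (\<lambda>x. g x * h x)"
proof (induction k arbitrary: A B g h)
  case 0
  have "A \<ge> 0" using smooth_bound_nonneg[OF 0(1)] .
  with 0 show ?case by (auto simp: abs_mult intro: mult_mono)
next
  case (Suc k)
  note AB = smooth_bound_nonneg[OF Suc.prems(1)] smooth_bound_nonneg[OF Suc.prems(2)]
  show ?case
  proof (rule smooth_bound_SucI)
    show "((\<lambda>x. g x * h x) has_derivative
        (\<lambda>v. g x * frechet_derivative h (at x) v + frechet_derivative g (at x) v * h x)) (at x)" for x
      by (intro derivative_intros smooth_bound_has_derivative[OF Suc.prems(1)]
          smooth_bound_has_derivative[OF Suc.prems(2)])
    have le: "A * B \<le> 2 ^ Suc k * A * B"
      using mult_right_mono[OF one_le_power[of 2 "Suc k"], of "A * B"] AB by (simp add: mult_ac)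
    show "\<bar>g x * h x\<bar> \<le> 2 ^ Suc k * A * B" for x
      using Suc.prems AB by (intro order_trans[OF _ le]) (auto simp: abs_mult intro!: mult_mono)
    show "x \<notin> U \<inter> V \<Longrightarrow> g x * h x = 0" for x using Suc.prems by auto
    fix v
    have "smooth_bound k (2 ^ k * A * (B * norm v)) (U \<inter> V) (\<lambda>x. g x * frechet_derivative h (at x) v)"
      by (rule Suc.IH) (use Suc.prems in \<open>auto simp del: smooth_bound.simps dest: smooth_bound_Suc_imp\<close>, use Suc.prems in auto)
    moreover have "smooth_bound k (2 ^ k * (A * norm v) * B) (U \<inter> V) (\<lambda>x. frechet_derivative g (at x) v * h x)"
      by (rule Suc.IH) (use Suc.prems in auto, use Suc.prems in \<open>auto simp del: smooth_bound.simps dest: smooth_bound_Suc_imp\<close>)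
    ultimately show "smooth_bound k (2 ^ Suc k * A * B * norm v) (U \<inter> V)
        (\<lambda>x. g x * frechet_derivative h (at x) v + frechet_derivative g (at x) v * h x)"
      using smooth_bound_add by (fastforce simp: mult_ac)
  qed
qed

lemma smooth_bound_prod:
  assumes "finite I" "\<And>i. i \<in> I \<Longrightarrow> \<exists>C. smooth_bound k C (U i) (g i)"
  shows "\<exists>C. smooth_bound k C (\<Inter>i\<in>I. U i) (\<lambda>x. \<Prod>i\<in>I. g i x)"
  using assms
proof (induction I rule: finite_induct)
  case empty then show ?case using smooth_bound_one by auto
next
  case (insert j I)
  then obtain A B where "smooth_bound k A (U j) (g j)"
    "smooth_bound k B (\<Inter>i\<in>I. U i) (\<lambda>x. \<Prod>i\<in>I. g i x)" by blast
  from smooth_bound_mult[OF this] show ?case using insert.hyps by auto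
qed

text \<open>The constant does not grow with the number of summands, because the supports are disjoint.\<close>

lemma smooth_bound_disjoint_sum:
  fixes g :: "'b \<Rightarrow> 'a::real_normed_vector \<Rightarrow> real"
  assumes "finite S" "disjoint_family_on U S" "C \<ge> 0" "\<And>s. s \<in> S \<Longrightarrow> smooth_bound k C (U s) (g s)"
  shows "smooth_bound k C (\<Union>s\<in>S. U s) (\<lambda>x. \<Sum>s\<in>S. g s x)"
  using assms(3,4)
proof (induction k arbitrary: C g)
  have abs: "\<bar>\<Sum>s\<in>S. g s x\<bar> \<le> C"
    if "C \<ge> 0" and gs: "\<And>s. s \<in> S \<Longrightarrow> smooth_bound k C (U s) (g s)" for k C x and g :: "'b \<Rightarrow> 'a \<Rightarrow> real"
  proof (cases "\<exists>s\<in>S. x \<in> U s")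
    case True
    then obtain s where s: "s \<in> S" "x \<in> U s" by blast
    have "g r x = 0" if "r \<in> S - {s}" for r
      using that s \<open>disjoint_family_on U S\<close> smooth_bound_support[OF gs, of r]
      by (auto simp: disjoint_family_on_def)
    then have "(\<Sum>s\<in>S. g s x) = g s x"
      using \<open>finite S\<close> s by (simp add: sum.remove)
    then show ?thesis using smooth_bound_abs_le gs s by metis
  next
    case False
    then have "(\<Sum>s\<in>S. g s x) = 0" by (intro sum.neutral ballI smooth_bound_support[OF gs]) auto
    then show ?thesis using \<open>C \<ge> 0\<close> by simp
  qed
  have supp: "(\<Sum>s\<in>S. g s x) = 0"
    if "x \<notin> (\<Union>s\<in>S. U s)" "\<And>s. s \<in> S \<Longrightarrow> smooth_bound k C (U s) (g s)"
    for k C x and g :: "'b \<Rightarrow> 'a \<Rightarrow> real"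
    by (intro sum.neutral ballI smooth_bound_support[OF that(2)]) (use that(1) in auto)
  {
    case 0
    then show ?case using abs[of C 0 g] supp[of _ 0 C g] by simp
  next
    case (Suc k)
    show ?case
    proof (rule smooth_bound_SucI[OF abs[OF Suc.prems] supp[OF _ Suc.prems(2)]])
      show "((\<lambda>x. \<Sum>s\<in>S. g s x) has_derivative (\<lambda>v. \<Sum>s\<in>S. frechet_derivative (g s) (at x) v)) (at x)" for x
        by (intro derivative_intros smooth_bound_has_derivative[OF Suc.prems(2)])
      show "smooth_bound k (C * norm v) (\<Union>s\<in>S. U s) (\<lambda>x. \<Sum>s\<in>S. frechet_derivative (g s) (at x) v)" for v
        using Suc.prems by (intro Suc.IH) auto
    qed
  }
qed

lemma smooth_bound_translate:
  "smooth_bound k C U g \<Longrightarrow> smooth_bound k C {x. x - z \<in> U} (\<lambda>x. g (x - z))"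
proof (induction k arbitrary: C g)
  case (Suc k)
  show ?case
  proof (rule smooth_bound_SucI)
    show "((\<lambda>x. g (x - z)) has_derivative frechet_derivative g (at (x - z))) (at x)" for x
    proof -
      have "(g \<circ> (\<lambda>x. x - z) has_derivative frechet_derivative g (at (x - z)) \<circ> (\<lambda>v. v)) (at x)"
        by (rule diff_chain_at)
           (auto intro!: derivative_eq_intros smooth_bound_has_derivative[OF Suc.prems])
      then show ?thesis by (simp add: o_def)
    qed
    show "smooth_bound k (C * norm v) {x. x - z \<in> U} (\<lambda>x. frechet_derivative g (at (x - z)) v)" for v
      by (rule Suc.IH) (use Suc.prems in auto)
  qed (use Suc.prems in auto)
qed simp

lemma smooth_bound_iter_deriv:
  "smooth_bound (length vs + k) C U g \<Longrightarrow>
    smooth_bound k (C * prod_list (map norm vs)) U (iter_deriv g vs)"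
proof (induction vs arbitrary: k)
  case (Cons v vs)
  have "smooth_bound (Suc k) (C * prod_list (map norm vs)) U (iter_deriv g vs)"
    using Cons.IH[of "Suc k"] Cons.prems by simp
  then show ?case by (simp add: mult_ac)
qed simp

lemma smooth_bound_lipschitz:
  fixes g :: "'a::real_normed_vector \<Rightarrow> real"
  assumes "smooth_bound (Suc k) C U g"
  shows "\<bar>g x - g y\<bar> \<le> C * norm (x - y)"
proof -
  have "norm (g x - g y) \<le> C * norm (x - y)"
  proof (rule differentiable_bound[of UNIV g "\<lambda>x. frechet_derivative g (at x)"])
    show "(g has_derivative frechet_derivative g (at x)) (at x within UNIV)" for x
      using smooth_bound_has_derivative[OF assms] by simp
    show "onorm (frechet_derivative g (at x)) \<le> C" for x
    proof (rule onorm_bound[OF smooth_bound_nonneg[OF assms]])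
      show "norm (frechet_derivative g (at x) v) \<le> C * norm v" for v
        using assms smooth_bound_abs_le[of k "C * norm v" U "\<lambda>x. frechet_derivative g (at x) v"] by auto
    qed
  qed auto
  then show ?thesis by simp
qed

lemma iter_deriv_affine:
  assumes "smooth_bound (length vs) C U g"
  shows "iter_deriv (\<lambda>x. b + a * g (H *\<^sub>R x)) vs =
    (\<lambda>x. (if vs = [] then b else 0) + a * H ^ length vs * iter_deriv g vs (H *\<^sub>R x))"
  using assms
proof (induction vs)
  case (Cons v vs)
  have sb: "smooth_bound (Suc 0) (C * prod_list (map norm vs)) U (iter_deriv g vs)"
    using smooth_bound_iter_deriv[of vs "Suc 0" C U g] Cons.prems by simp
  have "((\<lambda>x. (if vs = [] then b else 0) + a * H ^ length vs * iter_deriv g vs (H *\<^sub>R x)) has_derivative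
    (\<lambda>v. a * H ^ length vs * frechet_derivative (iter_deriv g vs) (at (H *\<^sub>R x)) (H *\<^sub>R v))) (at x)"
    (is "(?f has_derivative ?f' x) (at x)") for x
  proof -
    have "(iter_deriv g vs \<circ> (\<lambda>x. H *\<^sub>R x) has_derivative
        frechet_derivative (iter_deriv g vs) (at (H *\<^sub>R x)) \<circ> (\<lambda>v. H *\<^sub>R v)) (at x)"
      by (rule diff_chain_at) (auto intro!: derivative_eq_intros smooth_bound_has_derivative[OF sb])
    then show ?thesis by (auto simp: o_def intro!: derivative_eq_intros)
  qed
  then have "frechet_derivative ?f (at x) = ?f' x" for x by (metis frechet_derivative_at)
  moreover have "frechet_derivative (iter_deriv g vs) (at y) (H *\<^sub>R v) =
      H * frechet_derivative (iter_deriv g vs) (at y) v" for y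
    using linear_cmul[OF has_derivative_linear[OF smooth_bound_has_derivative[OF sb]], of y H v]
    by simp
  moreover have "smooth_bound (length vs) C U g"
    using smooth_bound_le[OF Cons.prems, of "length vs"] by simp
  ultimately show ?case using Cons.IH by (simp add: mult_ac)
qed (simp add: fun_eq_iff)

section \<open>Membership of rescaled functions in the Hoelder class\<close>

lemma form_norm_le:
  assumes "\<And>vs::'a::euclidean_space list. length vs = k \<Longrightarrow> \<forall>v\<in>set vs. norm v = 1 \<Longrightarrow> \<bar>A vs\<bar> \<le> B"
  shows "form_norm k A \<le> B"
  unfolding form_norm_def
proof (rule cSUP_least)
  \<comment> \<open>The supremum of reals can be bounded only over a nonempty index set; repeating a
    basis vector supplies an element for every \<open>k\<close>, the empty list for
    \<open>k = 0\<close>.\<close>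
  obtain e :: 'a where "e \<in> Basis" using nonempty_Basis by blast
  then have "replicate k e \<in> {vs. length vs = k \<and> (\<forall>v\<in>set vs. norm v = 1)}" by auto
  then show "{vs::'a list. length vs = k \<and> (\<forall>v\<in>set vs. norm v = 1)} \<noteq> {}" by blast
qed (use assms in auto)

lemma prod_list_norm_unit: "\<forall>v\<in>set vs. norm v = 1 \<Longrightarrow> prod_list (map norm vs) = 1"
  by (induction vs) auto

text \<open>Interpolation: an increment that is both bounded and Lipschitz is Hoelder for every
  exponent in between.\<close>

lemma min_le_powr:
  fixes t \<theta> :: real
  assumes "t \<ge> 0" "0 \<le> \<theta>" "\<theta> \<le> 1"
  shows "min 1 t \<le> t powr \<theta>"
proof (cases "t \<ge> 1")
  case True then show ?thesis using ge_one_powr_ge_zero[of t \<theta>] assms by simp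
next
  case False
  show ?thesis
  proof (cases "t = 0")
    case False
    then have "t powr 1 \<le> t powr \<theta>" using assms \<open>\<not> t \<ge> 1\<close> by (intro powr_mono') auto
    then show ?thesis using False assms by simp
  qed simp
qed

text \<open>Rescaling multiplies the derivative of order \<open>k\<close> by
  \<open>a * H ^ k\<close>, which is at most \<open>c\<close> for \<open>k \<le> l\<close> because
  \<open>l < \<beta>\<close>. At order \<open>l\<close> the increment is bounded by
  \<open>2 * C\<close> and, thanks to the extra derivative in \<open>Suc l\<close>, Lipschitz with
  constant \<open>C\<close> in the rescaled variable; interpolation with exponent
  \<open>\<beta> - l\<close> produces a power of \<open>H\<close> that cancels against the amplitude
  exactly. Half of \<open>L 0\<close> is reserved for the offset \<open>b\<close>.\<close>

lemma hoelder_class_scaled: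
  fixes g :: "real^'d \<Rightarrow> real"
  assumes sb: "smooth_bound (Suc l) C U g" and \<beta>: "real l < \<beta>" "\<beta> \<le> real l + 1"
    and H: "H \<ge> 1" and a: "0 \<le> a" "a \<le> c * H powr (- \<beta>)"
    and b: "\<bar>b\<bar> \<le> L 0 / 2" and c: "\<And>k. k \<le> l \<Longrightarrow> c * C \<le> L k / 2" "2 * c * C \<le> L\<beta>"
  shows "(\<lambda>x. axis i (b + a * g (H *\<^sub>R x))) \<in> hoelder_class l \<beta> L L\<beta>"
proof -
  have C: "C \<ge> 0" using smooth_bound_nonneg[OF sb] .
  have "0 \<le> c * H powr (- \<beta>)" using a by linarith
  then have c0: "c \<ge> 0" using H by (simp add: zero_le_mult_iff)
  have aH: "a * H ^ k \<le> c" if "k \<le> l" for k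
  proof -
    have "a * H ^ k \<le> c * H powr (- \<beta>) * H powr real k"
      using a H by (simp add: powr_realpow mult_right_mono)
    also have "\<dots> = c * H powr (real k - \<beta>)" by (simp add: powr_add[symmetric] mult.assoc)
    also have "\<dots> \<le> c * 1"
      using that \<beta> H c0 powr_mono[of "real k - \<beta>" 0 H] by (intro mult_left_mono) auto
    finally show ?thesis by simp
  qed
  \<comment> \<open>Generalised over offset and amplitude so that the components other than
    \<open>i\<close>, which vanish, are the case where both are 0.\<close>
  have main: "times_differentiable l g \<and>
       (\<forall>k\<le>l. \<forall>x. form_norm k (\<lambda>vs. iter_deriv g vs x) \<le> L k) \<and>
       (\<forall>x x'. form_norm l (\<lambda>vs. iter_deriv g vs x - iter_deriv g vs x')
                 \<le> L\<beta> * norm (x - x') powr (\<beta> - real l))"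
    if g_eq: "g = (\<lambda>x. b + a * h (H *\<^sub>R x))" and sb: "smooth_bound (Suc l) C U h"
      and b: "\<bar>b\<bar> \<le> L 0 / 2" and a: "0 \<le> a" "a \<le> c * H powr (- \<beta>)"
      and aH: "\<And>k. k \<le> l \<Longrightarrow> a * H ^ k \<le> c"
    for g h :: "real^'d \<Rightarrow> real" and a b
  proof (intro conjI allI impI)
    have sbk: "smooth_bound k C U h" if "k \<le> Suc l" for k
      using smooth_bound_le[OF sb that] .
    have it: "iter_deriv g vs =
        (\<lambda>x. (if vs = [] then b else 0) + a * H ^ length vs * iter_deriv h vs (H *\<^sub>R x))"
      if "length vs \<le> Suc l" for vs
      unfolding g_eq by (rule iter_deriv_affine) (rule sbk[OF that])
    have Dh: "smooth_bound j (C * prod_list (map norm vs)) U (iter_deriv h vs)"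
      if "length vs + j \<le> Suc l" for j vs
      using smooth_bound_iter_deriv[OF sbk[OF that]] .
    show "times_differentiable l g"
      unfolding times_differentiable_def
    proof (intro allI impI)
      fix vs :: "(real^'d) list" and x assume vs: "length vs < l"
      have "smooth_bound (Suc 0) (C * prod_list (map norm vs)) U (iter_deriv h vs)"
        using Dh[of vs "Suc 0"] vs by simp
      then have "iter_deriv h vs differentiable at (H *\<^sub>R x)" by simp
      then have "(iter_deriv h vs \<circ> (\<lambda>x. H *\<^sub>R x)) differentiable at x"
        by (intro differentiable_chain_at) auto
      then show "iter_deriv g vs differentiable at x"
        using vs by (subst it) (auto simp: o_def intro!: derivative_intros)
    qed
    show "form_norm k (\<lambda>vs. iter_deriv g vs x) \<le> L k" if k: "k \<le> l" for k x
    proof (rule form_norm_le)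
      fix vs :: "(real^'d) list" assume vs: "length vs = k" "\<forall>v\<in>set vs. norm v = 1"
      have "\<bar>iter_deriv h vs (H *\<^sub>R x)\<bar> \<le> C"
        using smooth_bound_abs_le[OF Dh[of vs 0]] vs k by (simp add: prod_list_norm_unit)
      then have "\<bar>a * H ^ k * iter_deriv h vs (H *\<^sub>R x)\<bar> \<le> c * C"
        using aH[OF k] a H c0 by (auto simp: abs_mult intro!: mult_mono)
      with c(1)[OF k] b vs k show "\<bar>iter_deriv g vs x\<bar> \<le> L k"
        by (subst it) auto
    qed
    show "form_norm l (\<lambda>vs. iter_deriv g vs x - iter_deriv g vs x') \<le> L\<beta> * norm (x - x') powr (\<beta> - real l)" for x x'
    proof (rule form_norm_le)
      fix vs :: "(real^'d) list" assume vs: "length vs = l" "\<forall>v\<in>set vs. norm v = 1"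
      define t where "t = H * norm (x - x')"
      let ?d = "iter_deriv h vs (H *\<^sub>R x) - iter_deriv h vs (H *\<^sub>R x')"
      have "\<bar>?d\<bar> \<le> C * norm (H *\<^sub>R x - H *\<^sub>R x')"
        using smooth_bound_lipschitz[OF Dh[of vs "Suc 0"], of "H *\<^sub>R x" "H *\<^sub>R x'"] vs
        by (simp add: prod_list_norm_unit)
      then have d1: "\<bar>?d\<bar> \<le> C * t" using H by (simp add: t_def scaleR_diff_right[symmetric])
      have "\<bar>iter_deriv h vs y\<bar> \<le> C" for y
        using smooth_bound_abs_le[OF Dh[of vs 0], of y] vs by (simp add: prod_list_norm_unit)
      from this[of "H *\<^sub>R x"] this[of "H *\<^sub>R x'"] have d2: "\<bar>?d\<bar> \<le> 2 * C * 1" by linarith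
      have t: "t \<ge> 0" using H by (simp add: t_def)
      have "\<bar>?d\<bar> \<le> 2 * C * min 1 t"
        using d1 d2 C t by (cases "t \<le> 1") (auto simp: min_def intro: order_trans mult_nonneg_nonneg)
      also have "\<dots> \<le> 2 * C * t powr (\<beta> - real l)"
        using \<beta> C t by (intro mult_left_mono min_le_powr) auto
      also have "t powr (\<beta> - real l) = H powr (\<beta> - real l) * norm (x - x') powr (\<beta> - real l)"
        using H by (simp add: t_def powr_mult)
      finally have d: "\<bar>?d\<bar> \<le> 2 * C * (H powr (\<beta> - real l) * norm (x - x') powr (\<beta> - real l))" .
      have "H ^ l * H powr (\<beta> - real l) = H powr \<beta>"
        using H by (simp add: powr_realpow[symmetric] powr_add[symmetric])
      then have "a * H ^ l * H powr (\<beta> - real l) = a * H powr \<beta>" by (simp add: mult.assoc)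
      also have "\<dots> \<le> c * H powr (- \<beta>) * H powr \<beta>" using a by (intro mult_right_mono) auto
      also have "\<dots> = c" using H by (simp add: powr_minus field_simps)
      finally have c': "a * H ^ l * H powr (\<beta> - real l) \<le> c" .
      have "iter_deriv g vs x - iter_deriv g vs x' = a * H ^ l * ?d"
        using vs by (subst (1 2) it) (auto simp: algebra_simps)
      then have "\<bar>iter_deriv g vs x - iter_deriv g vs x'\<bar> = a * H ^ l * \<bar>?d\<bar>"
        using a H by (simp add: abs_mult)
      also have "\<dots> \<le> a * H ^ l * (2 * C * (H powr (\<beta> - real l) * norm (x - x') powr (\<beta> - real l)))"
        using d a H by (intro mult_left_mono) auto
      also have "\<dots> = (a * H ^ l * H powr (\<beta> - real l)) * (2 * C * norm (x - x') powr (\<beta> - real l))"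
        by simp
      also have "\<dots> \<le> c * (2 * C * norm (x - x') powr (\<beta> - real l))"
        using c' C by (intro mult_right_mono) auto
      also have "\<dots> = (2 * c * C) * norm (x - x') powr (\<beta> - real l)" by simp
      also have "\<dots> \<le> L\<beta> * norm (x - x') powr (\<beta> - real l)"
        using c(2) by (intro mult_right_mono) auto
      finally show "\<bar>iter_deriv g vs x - iter_deriv g vs x'\<bar> \<le> L\<beta> * norm (x - x') powr (\<beta> - real l)" .
    qed
  qed
  have comp: "(\<lambda>x. axis i (b + a * g (H *\<^sub>R x)) $ j) = (\<lambda>x. (if j = i then b else 0) +
      (if j = i then a else 0) * g (H *\<^sub>R x))" for j
    by (auto simp: axis_def fun_eq_iff)
  show ?thesis
    unfolding hoelder_class_def Let_def mem_Collect_eq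
    by (intro allI main[OF comp sb]) (use a aH b c0 in auto)
qed

text \<open>Differentiation shifts the phase by a quarter turn, so the induction runs over all
  phases at once and the constant stays 1.\<close>

lemma smooth_bound_cos:
  fixes i :: "'d::finite"
  shows "smooth_bound k 1 UNIV (\<lambda>x::real^'d. cos (x $ i - \<phi>))"
proof (induction k arbitrary: \<phi>)
  case (Suc k)
  show ?case
  proof (rule smooth_bound_SucI)
    show "((\<lambda>x::real^'d. cos (x $ i - \<phi>)) has_derivative (\<lambda>v. v $ i * cos (x $ i - (\<phi> - pi / 2)))) (at x)" for x
    proof -
      have "((\<lambda>x::real^'d. cos (x $ i - \<phi>)) has_derivative (\<lambda>v. - (v $ i * sin (x $ i - \<phi>)))) (at x)"
        by (auto intro!: derivative_eq_intros bounded_linear_imp_has_derivative[OF bounded_linear_vec_nth])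
      moreover have "cos (x $ i - (\<phi> - pi / 2)) = - sin (x $ i - \<phi>)"
        by (simp add: cos_diff cos_add sin_diff sin_add)
      ultimately show ?thesis by simp
    qed
    fix v :: "real^'d"
    have "smooth_bound k (\<bar>v $ i\<bar> * 1) UNIV (\<lambda>x::real^'d. v $ i * cos (x $ i - (\<phi> - pi / 2)))"
      by (rule smooth_bound_cmult[OF Suc.IH])
    then show "smooth_bound k (1 * norm v) UNIV (\<lambda>x. v $ i * cos (x $ i - (\<phi> - pi / 2)))"
      by (rule smooth_bound_mono) (auto simp: component_le_norm_cart)
  qed auto
qed auto

section \<open>Bump functions\<close>

text \<open>A truncated power. The class involves finitely many derivatives, so finite smoothness
  suffices, and derivatives stay within multiples of truncated powers.\<close>

definition ramp :: "nat \<Rightarrow> real \<Rightarrow> real" where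
  "ramp a s = max 0 s ^ a"

lemma ramp_has_derivative:
  assumes "a \<ge> 2"
  shows "(ramp a has_real_derivative real a * ramp (a - 1) s) (at s)"
proof -
  consider "s > 0" | "s < 0" | "s = 0" by linarith
  then show ?thesis
  proof cases
    case 1
    have "((\<lambda>s. s ^ a) has_real_derivative real a * s ^ (a - 1)) (at s)"
      by (auto intro!: derivative_eq_intros)
    then have "(ramp a has_real_derivative real a * s ^ (a - 1)) (at s)"
      by (rule has_field_derivative_transform_within_open[of _ _ _ "{0<..}"])
         (use 1 in \<open>auto simp: ramp_def\<close>)
    then show ?thesis using 1 by (simp add: ramp_def)
  next
    case 2
    have "((\<lambda>s. 0) has_real_derivative 0) (at s)" by simp
    then have "(ramp a has_real_derivative 0) (at s)"
      by (rule has_field_derivative_transform_within_open[of _ _ _ "{..<0}"])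
         (use 2 assms in \<open>auto simp: ramp_def zero_power\<close>)
    then show ?thesis using 2 assms by (simp add: ramp_def zero_power)
  next
    case 3
    have "((\<lambda>h. ramp a h / h) \<longlongrightarrow> 0) (at 0)"
    proof (rule Lim_null_comparison)
      have "norm (ramp a h / h) \<le> \<bar>h\<bar> ^ (a - 1)" for h
      proof (cases "h > 0")
        case True
        have "h ^ a = h * h ^ (a - 1)" using assms by (cases a) auto
        then show ?thesis using True by (simp add: ramp_def)
      next
        case False then show ?thesis using assms by (simp add: ramp_def zero_power)
      qed
      then show "\<forall>\<^sub>F h in at 0. norm (ramp a h / h) \<le> \<bar>h\<bar> ^ (a - 1)" by simp
      have "((\<lambda>h::real. \<bar>h\<bar> ^ (a - 1)) \<longlongrightarrow> \<bar>0\<bar> ^ (a - 1)) (at 0)" by (intro tendsto_intros)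
      then show "((\<lambda>h::real. \<bar>h\<bar> ^ (a - 1)) \<longlongrightarrow> 0) (at 0)" using assms by (simp add: zero_power)
    qed
    then show ?thesis using 3 assms by (simp add: DERIV_def ramp_def zero_power)
  qed
qed

text \<open>The derivative is a combination of two products of the same kind, each with one exponent
  lowered. The exponents are therefore kept separate in the induction; starting from
  \<open>k + 2\<close> they are still at least 2 after \<open>k\<close> derivatives.\<close>

lemma smooth_bound_edge:
  fixes i :: "'d::finite"
  assumes "a \<ge> k + 2" "b \<ge> k + 2"
  shows "\<exists>C. smooth_bound k C {x::real^'d. \<bar>x $ i\<bar> < 1} (\<lambda>x. ramp a (1 - x $ i) * ramp b (1 + x $ i))"
  using assms
proof (induction k arbitrary: a b)
  have bd: "\<bar>ramp a (1 - x $ i) * ramp b (1 + x $ i)\<bar> \<le> 2 ^ (a + b)"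
    and supp: "x \<notin> {x. \<bar>x $ i\<bar> < 1} \<Longrightarrow> ramp a (1 - x $ i) * ramp b (1 + x $ i) = 0"
    if "a \<ge> 2" "b \<ge> 2" for a b and x :: "real^'d"
  proof -
    show *: "ramp a (1 - x $ i) * ramp b (1 + x $ i) = 0" if "x \<notin> {x. \<bar>x $ i\<bar> < 1}"
      using that \<open>a \<ge> 2\<close> \<open>b \<ge> 2\<close> by (auto simp: ramp_def max_def)
    show "\<bar>ramp a (1 - x $ i) * ramp b (1 + x $ i)\<bar> \<le> 2 ^ (a + b)"
    proof (cases "\<bar>x $ i\<bar> < 1")
      case True
      then have "ramp a (1 - x $ i) \<le> 2 ^ a" "ramp b (1 + x $ i) \<le> 2 ^ b"
        unfolding ramp_def by (intro power_mono; simp)+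
      then have "ramp a (1 - x $ i) * ramp b (1 + x $ i) \<le> 2 ^ a * 2 ^ b"
        by (intro mult_mono) (auto simp: ramp_def)
      then show ?thesis by (simp add: power_add ramp_def)
    next
      case False
      then have "ramp a (1 - x $ i) * ramp b (1 + x $ i) = 0" using * by blast
      then show ?thesis by (simp only:) simp
    qed
  qed
  {
    case 0
    then show ?case using bd[of a b] supp[of a b] by (intro exI[of _ "2 ^ (a + b)"]) auto
  next
    case (Suc k)
    let ?e = "\<lambda>a b (x::real^'d). ramp a (1 - x $ i) * ramp b (1 + x $ i)"
    let ?U = "{x::real^'d. \<bar>x $ i\<bar> < 1}"
    obtain A where A: "smooth_bound k A ?U (?e (a - 1) b)"
      using Suc.IH[of "a - 1" b] Suc.prems by force
    obtain B where B: "smooth_bound k B ?U (?e a (b - 1))"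
      using Suc.IH[of a "b - 1"] Suc.prems by force
    define D where "D = a * A + b * B"
    have D: "smooth_bound k D ?U (\<lambda>x. - real a * ?e (a - 1) b x + real b * ?e a (b - 1) x)"
      using smooth_bound_add[OF smooth_bound_cmult[OF A, of "- real a"] smooth_bound_cmult[OF B, of "real b"]]
      by (simp add: D_def)
    have "smooth_bound (Suc k) (max (2 ^ (a + b)) D) ?U (?e a b)"
    proof (rule smooth_bound_SucI)
      show "(?e a b has_derivative
          (\<lambda>v. v $ i * (- real a * ?e (a - 1) b x + real b * ?e a (b - 1) x))) (at x)" for x
      proof -
        have x: "((\<lambda>x::real^'d. x $ i) has_derivative (\<lambda>v. v $ i)) (at x)"
          by (rule bounded_linear_imp_has_derivative[OF bounded_linear_vec_nth])
        have "((\<lambda>s. ramp a (1 - s) * ramp b (1 + s)) has_real_derivative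
            - real a * (ramp (a - 1) (1 - x $ i) * ramp b (1 + x $ i))
            + real b * (ramp a (1 - x $ i) * ramp (b - 1) (1 + x $ i))) (at (x $ i))"
        proof -
          have "a \<ge> 2" "b \<ge> 2" using Suc.prems by auto
          note d1 = DERIV_chain2[OF ramp_has_derivative[OF \<open>a \<ge> 2\<close>] DERIV_diff[OF DERIV_const DERIV_ident]]
          note d2 = DERIV_chain2[OF ramp_has_derivative[OF \<open>b \<ge> 2\<close>] DERIV_add[OF DERIV_const DERIV_ident]]
          show ?thesis
            by (rule DERIV_cong[OF DERIV_mult[OF d1 d2]]) (simp add: mult_ac)
        qed
        from has_derivative_compose[OF x this[unfolded has_field_derivative_def]]
        show ?thesis by (simp add: mult_ac)
      qed
      show "\<bar>?e a b x\<bar> \<le> max (2 ^ (a + b)) D" for x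
        using bd[of a b x] Suc.prems by simp
      show "x \<notin> ?U \<Longrightarrow> ?e a b x = 0" for x using supp[of a b x] Suc.prems by simp
      fix v :: "real^'d"
      show "smooth_bound k (max (2 ^ (a + b)) D * norm v) ?U
          (\<lambda>x. v $ i * (- real a * ?e (a - 1) b x + real b * ?e a (b - 1) x))"
      proof (rule smooth_bound_mono[OF smooth_bound_cmult[OF D]])
        show "\<bar>v $ i\<bar> * D \<le> max (2 ^ (a + b)) D * norm v"
          using smooth_bound_nonneg[OF D] component_le_norm_cart[of v i]
          by (subst mult.commute, intro mult_mono) auto
      qed simp
    qed
    then show ?case by blast
  }
qed

text \<open>On the cube where all coordinates are at most 1 in modulus this is the product of the
  factors \<open>(1 - (x $ i)\<^sup>2) ^ m\<close>, and it is 0 elsewhere when \<open>m > 0\<close>.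
  The tensor form gives a cubical support, and cubes tile the unit cube.\<close>

definition bump :: "nat \<Rightarrow> real^'d \<Rightarrow> real" where
  "bump m x = (\<Prod>i\<in>UNIV. ramp m (1 - x $ i) * ramp m (1 + x $ i))"

lemma smooth_bound_bump:
  "\<exists>C. smooth_bound k C {x::real^'d. \<forall>i. \<bar>x $ i\<bar> < 1} (bump (k + 2))"
proof -
  have "\<exists>C. smooth_bound k C (\<Inter>i\<in>UNIV. {x::real^'d. \<bar>x $ i\<bar> < 1})
      (\<lambda>x. \<Prod>i\<in>UNIV. ramp (k + 2) (1 - x $ i) * ramp (k + 2) (1 + x $ i))"
    by (rule smooth_bound_prod) (auto intro: smooth_bound_edge)
  moreover have "(\<Inter>i\<in>UNIV. {x::real^'d. \<bar>x $ i\<bar> < 1}) = {x. \<forall>i. \<bar>x $ i\<bar> < 1}" by auto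
  ultimately show ?thesis by (simp add: bump_def[abs_def])
qed

lemma bump_zero [simp]: "bump m 0 = 1"
  by (simp add: bump_def ramp_def)

lemma ramp_mult: "\<bar>s\<bar> \<le> 1 \<Longrightarrow> ramp m (1 - s) * ramp m (1 + s) = (1 - s\<^sup>2) ^ m"
proof -
  assume "\<bar>s\<bar> \<le> 1"
  then have "ramp m (1 - s) * ramp m (1 + s) = (1 - s) ^ m * (1 + s) ^ m"
    by (simp add: ramp_def)
  also have "\<dots> = ((1 - s) * (1 + s)) ^ m" by (rule power_mult_distrib[symmetric])
  also have "(1 - s) * (1 + s) = 1 - s\<^sup>2" by (simp add: power2_eq_square algebra_simps)
  finally show ?thesis .
qed

lemma bump_nonneg: "bump m x \<ge> 0"
  by (auto simp: bump_def ramp_def intro!: prod_nonneg)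

text \<open>Here \<open>1 - s\<^sup>2 \<ge> 3 / 4\<close> in every coordinate. The integrated loss
  needs a lower bound on a set of positive volume, not only at the centre.\<close>

lemma bump_ge:
  fixes x :: "real^'d"
  assumes "\<And>i. \<bar>x $ i\<bar> \<le> 1 / 2"
  shows "(3 / 4) ^ (m * CARD('d)) \<le> bump m x"
proof -
  have "(\<Prod>i\<in>(UNIV::'d set). (3 / 4) ^ m) \<le> bump m x"
    unfolding bump_def
  proof (rule prod_mono)
    fix i
    have "(x $ i)\<^sup>2 \<le> (1 / 2)\<^sup>2" using assms[of i] by (metis abs_ge_zero power2_abs power_mono)
    then have "3 / 4 \<le> 1 - (x $ i)\<^sup>2" by (simp add: power2_eq_square)
    then show "0 \<le> (3 / 4 :: real) ^ m \<and> (3 / 4) ^ m \<le> ramp m (1 - x $ i) * ramp m (1 + x $ i)"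
      using assms[of i] by (auto simp: ramp_mult intro!: power_mono)
  qed
  then show ?thesis by (simp add: power_mult)
qed

lemma bump_neq_zeroD:
  assumes "m > 0" "bump m x \<noteq> 0" shows "\<bar>x $ i\<bar> < 1"
proof (rule ccontr)
  assume "\<not> \<bar>x $ i\<bar> < 1"
  then have "ramp m (1 - x $ i) * ramp m (1 + x $ i) = 0"
    using assms by (auto simp: ramp_def max_def)
  then show False using assms by (auto simp: bump_def)
qed

text \<open>The supports are open cubes of half-width 1, so a distance of 2 in some coordinate is
  exactly what makes them disjoint.\<close>

definition separated :: "(real^'d) set \<Rightarrow> bool" where
  "separated S \<longleftrightarrow> (\<forall>c\<in>S. \<forall>c'\<in>S. c \<noteq> c' \<longrightarrow> (\<exists>i. \<bar>c $ i - c' $ i\<bar> \<ge> 2))"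

lemma separated_subset: "separated S \<Longrightarrow> S' \<subseteq> S \<Longrightarrow> separated S'"
  unfolding separated_def by blast

definition bumps :: "nat \<Rightarrow> (real^'d) set \<Rightarrow> real^'d \<Rightarrow> real" where
  "bumps m S y = (\<Sum>c\<in>S. bump m (y - c))"

lemma separated_bump_eq_0:
  assumes "separated S" "c \<in> S" "c' \<in> S" "c \<noteq> c'" "m > 0" "bump m (y - c) \<noteq> 0"
  shows "bump m (y - c') = 0"
proof (rule ccontr)
  assume *: "bump m (y - c') \<noteq> 0"
  obtain i where i: "\<bar>c $ i - c' $ i\<bar> \<ge> 2" using assms by (auto simp: separated_def)
  have "\<bar>(y - c) $ i\<bar> < 1" "\<bar>(y - c') $ i\<bar> < 1" using bump_neq_zeroD assms * by blast+
  then show False using i by simp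
qed

text \<open>The constant is chosen before the set of centres, so it does not depend on how many
  bumps are placed. Adding 1 makes it strictly positive, as the later choice of the amplitude
  divides by it.\<close>

lemma smooth_bound_bumps:
  obtains C where "C > 0"
    "\<And>S::(real^'d) set. finite S \<Longrightarrow> separated S \<Longrightarrow> smooth_bound k C UNIV (bumps (k + 2) S)"
proof -
  obtain C where C: "smooth_bound k C {x::real^'d. \<forall>i. \<bar>x $ i\<bar> < 1} (bump (k + 2))"
    using smooth_bound_bump by blast
  have C0: "C \<ge> 0" using smooth_bound_nonneg[OF C] .
  have "smooth_bound k (C + 1) UNIV (bumps (k + 2) S)"
    if S: "finite S" "separated S" for S :: "(real^'d) set"
  proof -
    let ?U = "\<lambda>c. {x::real^'d. x - c \<in> {x. \<forall>i. \<bar>x $ i\<bar> < 1}}"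
    have "?U c \<inter> ?U c' = {}" if cc: "c \<in> S" "c' \<in> S" "c \<noteq> c'" for c c'
    proof -
      obtain i where i: "\<bar>c $ i - c' $ i\<bar> \<ge> 2" using cc S by (auto simp: separated_def)
      have "\<not> (\<bar>(y - c) $ i\<bar> < 1 \<and> \<bar>(y - c') $ i\<bar> < 1)" for y using i by auto
      then show ?thesis by blast
    qed
    then have "smooth_bound k C (\<Union>c\<in>S. ?U c) (\<lambda>y. \<Sum>c\<in>S. bump (k + 2) (y - c))"
      using S(1) C0
      by (intro smooth_bound_disjoint_sum smooth_bound_translate[OF C]) (auto simp: disjoint_family_on_def)
    then show ?thesis
      unfolding bumps_def[abs_def] by (rule smooth_bound_mono) auto
  qed
  then show ?thesis using that[of "C + 1"] C0 by simp
qed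

section \<open>Testing under a Kullback--Leibler bound\<close>

text \<open>The event is split at likelihood ratio \<open>exp \<tau>\<close>. Below the threshold
  \<open>P\<close> is at most \<open>exp \<tau>\<close> times \<open>Q\<close>. Above it Markov's
  inequality is applied to \<open>ln (D x) + 1 / D x\<close>, because \<open>ln (D x)\<close> alone
  can be negative, whereas the sum is nonnegative by \<open>ln u \<le> u - 1\<close> at
  \<open>u = 1 / D x\<close>. The correction has \<open>P\<close>-integral at most 1, which is the
  \<open>+ 1\<close> in the bound.\<close>

lemma measure_le_of_log_density:
  fixes D :: "'a \<Rightarrow> real"
  assumes Q: "prob_space Q" and P: "prob_space P" and D[measurable]: "D \<in> borel_measurable Q"
    and D0: "\<And>x. 0 \<le> D x" and P_eq: "P = density Q (\<lambda>x. ennreal (D x))"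
    and pos: "AE x in P. D x > 0" and int: "integrable P (\<lambda>x. ln (D x))"
    and le: "(\<integral>x. ln (D x) \<partial>P) \<le> \<kappa>" and A[measurable]: "A \<in> sets Q" and "\<tau> > 0"
  shows "measure P A \<le> (\<kappa> + 1) / \<tau> + exp \<tau> * measure Q A"
proof -
  interpret P: prob_space P by fact
  interpret Q: prob_space Q by fact
  have [measurable_cong]: "sets P = sets Q" by (simp add: P_eq)
  have "(\<integral>\<^sup>+x. ennreal (1 / D x) \<partial>P) = (\<integral>\<^sup>+x. ennreal (D x) * ennreal (1 / D x) \<partial>Q)"
    unfolding P_eq by (rule nn_integral_density) auto
  also have "\<dots> \<le> (\<integral>\<^sup>+x. 1 \<partial>Q)"
    by (intro nn_integral_mono) (use D0 in \<open>auto simp: ennreal_mult[symmetric]\<close>)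
  finally have le1: "(\<integral>\<^sup>+x. ennreal (1 / D x) \<partial>P) \<le> 1" by (simp add: Q.emeasure_space_1)
  have int1: "integrable P (\<lambda>x. 1 / D x)"
    by (rule integrableI_nonneg) (use D0 le1 in \<open>auto intro: le_less_trans\<close>)
  have "ennreal (\<integral>x. 1 / D x \<partial>P) = (\<integral>\<^sup>+x. ennreal (1 / D x) \<partial>P)"
    by (rule nn_integral_eq_integral[symmetric, OF int1]) (use D0 in auto)
  then have "ennreal (\<integral>x. 1 / D x \<partial>P) \<le> 1" using le1 by simp
  then have le1': "(\<integral>x. 1 / D x \<partial>P) \<le> 1" by (simp only: ennreal_le_1)
  define B where "B = {x \<in> space P. D x > exp \<tau>}"
  have B[measurable]: "B \<in> sets P" unfolding B_def by measurable
  have "\<tau> * measure P B = (\<integral>x. \<tau> * indicator B x \<partial>P)" by simp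
  also have "\<dots> \<le> (\<integral>x. ln (D x) + 1 / D x \<partial>P)"
  proof (rule integral_mono_AE)
    show "integrable P (\<lambda>x. \<tau> * indicator B x)"
      by (intro integrable_mult_right integrable_real_indicator B) (simp add: P.emeasure_eq_measure)
    show "integrable P (\<lambda>x. ln (D x) + 1 / D x)" using int int1 by simp
    show "AE x in P. \<tau> * indicator B x \<le> ln (D x) + 1 / D x"
    proof (use pos in eventually_elim)
      fix x assume x: "D x > 0"
      have "ln (1 / D x) \<le> 1 / D x - 1" using x by (intro ln_le_minus_one) simp
      then have "0 \<le> ln (D x) + 1 / D x" using x by (simp add: ln_div)
      moreover have "\<tau> \<le> ln (D x) + 1 / D x" if "D x > exp \<tau>"
        using that x by (simp add: ln_ge_iff add_increasing2 less_imp_le)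
      ultimately show "\<tau> * indicator B x \<le> ln (D x) + 1 / D x" by (auto simp: B_def indicator_def)
    qed
  qed
  also have "\<dots> \<le> \<kappa> + 1" using int int1 le le1' by simp
  finally have PB: "measure P B \<le> (\<kappa> + 1) / \<tau>" using \<open>\<tau> > 0\<close> by (simp add: field_simps)
  have [measurable]: "B \<in> sets Q" using B by (simp add: P_eq)
  have "emeasure P (A - B) = (\<integral>\<^sup>+x. ennreal (D x) * indicator (A - B) x \<partial>Q)"
    unfolding P_eq by (rule emeasure_density) auto
  also have "\<dots> \<le> (\<integral>\<^sup>+x. ennreal (exp \<tau>) * indicator A x \<partial>Q)"
    using sets.sets_into_space[OF A]
    by (intro nn_integral_mono) (auto simp: B_def indicator_def P_eq intro!: ennreal_leI)
  also have "\<dots> = ennreal (exp \<tau> * measure Q A)"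
    by (simp add: nn_integral_cmult_indicator Q.emeasure_eq_measure ennreal_mult)
  finally have PAB: "measure P (A - B) \<le> exp \<tau> * measure Q A"
    by (simp add: P.emeasure_eq_measure)
  have "measure P A \<le> measure P (B \<union> (A - B))"
    by (intro P.finite_measure_mono) auto
  also have "\<dots> \<le> measure P B + measure P (A - B)"
    by (intro measure_Un_le) auto
  finally show ?thesis using PB PAB by simp
qed

text \<open>A finite bound excludes the infinite branch of \<open>KL\<close>. The Radon-Nikodym
  derivative is then replaced by a real density, nonnegative everywhere, whose logarithm is the
  entropy density almost surely.\<close>

lemma KL_leE:
  assumes P: "prob_space P" and Q: "prob_space Q" and sets: "sets P = sets Q"
    and KL: "KL P Q \<le> ereal \<kappa>"
  obtains D :: "'a \<Rightarrow> real" where "D \<in> borel_measurable Q" "\<And>x. 0 \<le> D x"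
    "P = density Q (\<lambda>x. ennreal (D x))" "AE x in P. D x > 0"
    "integrable P (\<lambda>x. ln (D x))" "(\<integral>x. ln (D x) \<partial>P) \<le> \<kappa>"
proof -
  interpret P: prob_space P by fact
  interpret Q: prob_space Q by fact
  have ac: "absolutely_continuous Q P" and int: "integrable P (entropy_density (exp 1) Q P)"
    and le: "KL_divergence (exp 1) Q P \<le> \<kappa>"
    using KL by (auto simp: KL_def split: if_splits)
  obtain D where D: "D \<in> borel_measurable Q" "AE x in Q. RN_deriv Q P x = ennreal (D x)"
    "AE x in P. 0 < D x" "\<And>x. 0 \<le> D x"
    using Q.real_RN_deriv[OF P.finite_measure_axioms ac sets] by metis
  have P_eq: "P = density Q (\<lambda>x. ennreal (D x))"
  proof -
    have "P = density Q (RN_deriv Q P)" using Q.density_RN_deriv[OF ac sets] by simp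
    also have "\<dots> = density Q (\<lambda>x. ennreal (D x))"
      using D by (intro density_cong) auto
    finally show ?thesis .
  qed
  have "AE x in P. RN_deriv Q P x = ennreal (D x)"
    using ac D(2) sets absolutely_continuous_AE by metis
  then have eq: "AE x in P. entropy_density (exp 1) Q P x = ln (D x)"
    using D(4) by (auto simp: entropy_density_def log_def elim!: eventually_mono)
  have [measurable]: "D \<in> borel_measurable P" "entropy_density (exp 1) Q P \<in> borel_measurable P"
    using D(1) sets by (auto cong: measurable_cong_sets)
  have "integrable P (\<lambda>x. ln (D x))"
    using int eq by (subst integrable_cong_AE[symmetric]) (auto elim!: eventually_mono)
  moreover have "(\<integral>x. ln (D x) \<partial>P) = KL_divergence (exp 1) Q P"
    unfolding KL_divergence_def using eq by (intro integral_cong_AE) (auto elim!: eventually_mono)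
  ultimately show ?thesis using that[OF D(1,4) P_eq D(3)] le by simp
qed

lemma prod_indicator_PiE:
  assumes "finite I" "x \<in> extensional I"
  shows "(\<Prod>i\<in>I. indicator (A i) (x i)) = (indicator (PiE I A) x :: ennreal)"
proof (cases "x \<in> PiE I A")
  case True then show ?thesis by (auto simp: PiE_def Pi_def indicator_def)
next
  case False
  then obtain i where "i \<in> I" "x i \<notin> A i" using assms by (auto simp: PiE_def Pi_def)
  then have "(\<Prod>i\<in>I. indicator (A i) (x i)) = (0::ennreal)"
    using assms by (intro prod_zero bexI[of _ i]) auto
  then show ?thesis using False by simp
qed

text \<open>A product measure is determined by rectangles, and on these both the density and the
  indicator factor over the coordinates.\<close>

lemma PiM_density:
  fixes D :: "'i \<Rightarrow> 'a \<Rightarrow> ennreal"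
  assumes I: "finite I" and Q: "\<And>i. prob_space (Q i)" and P: "\<And>i. prob_space (P i)"
    and D[measurable]: "\<And>i. i \<in> I \<Longrightarrow> D i \<in> borel_measurable (Q i)"
    and P_eq: "\<And>i. i \<in> I \<Longrightarrow> P i = density (Q i) (D i)"
  shows "PiM I P = density (PiM I Q) (\<lambda>y. \<Prod>i\<in>I. D i (y i))"
proof -
  interpret Q: product_sigma_finite Q
    by (intro product_sigma_finite.intro prob_space_imp_sigma_finite Q)
  interpret P: product_sigma_finite P
    by (intro product_sigma_finite.intro prob_space_imp_sigma_finite P)
  have sets: "sets (PiM I P) = sets (PiM I Q)"
    by (rule sets_PiM_cong) (auto simp: P_eq)
  have [measurable]: "(\<lambda>y. \<Prod>i\<in>I. D i (y i)) \<in> borel_measurable (PiM I Q)"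
    by measurable
  show ?thesis
  proof (rule P.PiM_eqI[symmetric, OF I])
    show "sets (density (PiM I Q) (\<lambda>y. \<Prod>i\<in>I. D i (y i))) = sets (PiM I P)" by (simp add: sets)
    fix A assume A: "\<And>i. i \<in> I \<Longrightarrow> A i \<in> sets (P i)"
    have A'[measurable]: "\<And>i. i \<in> I \<Longrightarrow> A i \<in> sets (Q i)" using A by (auto simp: P_eq)
    have "emeasure (density (PiM I Q) (\<lambda>y. \<Prod>i\<in>I. D i (y i))) (PiE I A)
        = (\<integral>\<^sup>+y. (\<Prod>i\<in>I. D i (y i)) * indicator (PiE I A) y \<partial>PiM I Q)"
      using A' I by (intro emeasure_density) (auto intro!: sets_PiM_I_finite)
    also have "\<dots> = (\<integral>\<^sup>+y. (\<Prod>i\<in>I. D i (y i) * indicator (A i) (y i)) \<partial>PiM I Q)"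
      by (intro nn_integral_cong)
         (auto simp: prod.distrib space_PiM PiE_def prod_indicator_PiE[OF I])
    also have "\<dots> = (\<Prod>i\<in>I. \<integral>\<^sup>+x. D i x * indicator (A i) x \<partial>Q i)"
      by (rule Q.product_nn_integral_prod[OF I]) measurable
    also have "\<dots> = (\<Prod>i\<in>I. emeasure (P i) (A i))"
      by (intro prod.cong refl) (simp add: P_eq emeasure_density)
    finally show "emeasure (density (PiM I Q) (\<lambda>y. \<Prod>i\<in>I. D i (y i))) (PiE I A)
      = (\<Prod>i\<in>I. emeasure (P i) (A i))" .
  qed
qed

text \<open>
  The testing bound behind all three minimax estimates. With a fixed \<open>\<tau>\<close> it separates two
  hypotheses, with \<open>\<tau>\<close> proportional to the logarithm of the number of hypotheses it replaces
  Fano's inequality.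
\<close>

lemma measure_PiM_le_of_KL:
  fixes P Q :: "'i \<Rightarrow> 'a measure"
  assumes I: "finite I" and P: "\<And>i. prob_space (P i)" and Q: "\<And>i. prob_space (Q i)"
    and sets: "\<And>i. i \<in> I \<Longrightarrow> sets (P i) = sets (Q i)"
    and KL: "\<And>i. i \<in> I \<Longrightarrow> KL (P i) (Q i) \<le> ereal (\<kappa> i)"
    and A: "A \<in> sets (PiM I Q)" and "\<tau> > 0"
  shows "measure (PiM I P) A \<le> ((\<Sum>i\<in>I. \<kappa> i) + 1) / \<tau> + exp \<tau> * measure (PiM I Q) A"
proof -
  have "\<exists>D. D \<in> borel_measurable (Q i) \<and> (\<forall>x. 0 \<le> D x) \<and>
    P i = density (Q i) (\<lambda>x. ennreal (D x)) \<and> (AE x in P i. D x > 0) \<and>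
    integrable (P i) (\<lambda>x. ln (D x)) \<and> (\<integral>x. ln (D x) \<partial>P i) \<le> \<kappa> i" if "i \<in> I" for i
    using KL_leE[OF P Q sets[OF that] KL[OF that]] by metis
  then have "\<forall>i\<in>I. \<exists>D. D \<in> borel_measurable (Q i) \<and> (\<forall>x. 0 \<le> D x) \<and>
    P i = density (Q i) (\<lambda>x. ennreal (D x)) \<and> (AE x in P i. D x > 0) \<and>
    integrable (P i) (\<lambda>x. ln (D x)) \<and> (\<integral>x. ln (D x) \<partial>P i) \<le> \<kappa> i" by blast
  from bchoice[OF this] obtain D where D:
    "\<And>i. i \<in> I \<Longrightarrow> D i \<in> borel_measurable (Q i)" "\<And>i x. i \<in> I \<Longrightarrow> 0 \<le> D i x"
    "\<And>i. i \<in> I \<Longrightarrow> P i = density (Q i) (\<lambda>x. ennreal (D i x))"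
    "\<And>i. i \<in> I \<Longrightarrow> AE x in P i. D i x > 0"
    "\<And>i. i \<in> I \<Longrightarrow> integrable (P i) (\<lambda>x. ln (D i x))"
    "\<And>i. i \<in> I \<Longrightarrow> (\<integral>x. ln (D i x) \<partial>P i) \<le> \<kappa> i"
    by blast
  have [measurable]: "i \<in> I \<Longrightarrow> D i \<in> borel_measurable (Q i)" for i by (rule D)
  \<comment> \<open>The logarithm of the product splits into a sum only where all factors are
    positive. This holds almost surely under \<open>P\<close>, although it may fail under
    \<open>Q\<close>.\<close>
  have pos: "AE y in PiM I P. D i (y i) > 0" if "i \<in> I" for i
    by (rule AE_PiM_component[where P = "\<lambda>z. D i z > 0" and M = P, OF P that D(4)[OF that]])
  then have "AE y in PiM I P. \<forall>i\<in>I. D i (y i) > 0"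
    using I by (intro AE_finite_allI) auto
  then have ln_eq: "AE y in PiM I P. ln (\<Prod>i\<in>I. D i (y i)) = (\<Sum>i\<in>I. ln (D i (y i)))"
    by eventually_elim (auto intro!: ln_prod simp: I)
  have int: "integrable (PiM I P) (\<lambda>y. ln (D i (y i)))" "(\<integral>y. ln (D i (y i)) \<partial>PiM I P) \<le> \<kappa> i"
    if "i \<in> I" for i
  proof -
    have [measurable]: "D i \<in> borel_measurable (P i)"
      using D(1)[OF that] sets[OF that] by (simp cong: measurable_cong_sets)
    have d: "distr (PiM I P) (P i) (\<lambda>\<omega>. \<omega> i) = P i"
      by (rule distr_PiM_component[OF P that])
    have comp[measurable]: "(\<lambda>\<omega>. \<omega> i) \<in> measurable (PiM I P) (P i)" using that by measurable
    show "integrable (PiM I P) (\<lambda>y. ln (D i (y i)))"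
      using D(5)[OF that] integrable_distr_eq[OF comp, of "\<lambda>x. ln (D i x)"] by (simp add: d)
    show "(\<integral>y. ln (D i (y i)) \<partial>PiM I P) \<le> \<kappa> i"
      using D(6)[OF that] integral_distr[OF comp, of "\<lambda>x. ln (D i x)"] by (simp add: d)
  qed
  have sP: "sets (PiM I P) = sets (PiM I Q)" by (rule sets_PiM_cong) (auto simp: sets)
  have m: "(\<lambda>y. \<Prod>i\<in>I. D i (y i)) \<in> borel_measurable (PiM I Q)" by measurable
  have m': "(\<lambda>y. \<Prod>i\<in>I. D i (y i)) \<in> borel_measurable (PiM I P)"
    using m sP by (simp cong: measurable_cong_sets)
  show ?thesis
  proof (rule measure_le_of_log_density[OF _ _ m _ _ _ _ _ A \<open>\<tau> > 0\<close>])
    show "prob_space (PiM I Q)" "prob_space (PiM I P)"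
      by (intro prob_space_PiM P Q)+
    show "0 \<le> (\<Prod>i\<in>I. D i (x i))" for x using D(2) by (auto intro: prod_nonneg)
    have "PiM I P = density (PiM I Q) (\<lambda>y. \<Prod>i\<in>I. ennreal (D i (y i)))"
      using D by (intro PiM_density I P Q) auto
    then show "PiM I P = density (PiM I Q) (\<lambda>y. ennreal (\<Prod>i\<in>I. D i (y i)))"
      using D(2) by (simp add: prod_ennreal)
    show "AE y in PiM I P. 0 < (\<Prod>i\<in>I. D i (y i))"
      using \<open>AE y in PiM I P. \<forall>i\<in>I. D i (y i) > 0\<close> by eventually_elim (auto intro: prod_pos)
    have int_sum: "integrable (PiM I P) (\<lambda>y. \<Sum>i\<in>I. ln (D i (y i)))"
      using int by (intro Bochner_Integration.integrable_sum) auto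
    show "integrable (PiM I P) (\<lambda>y. ln (\<Prod>i\<in>I. D i (y i)))"
      by (rule integrable_cong_AE_imp[OF int_sum]) (use m' ln_eq in \<open>auto elim!: eventually_mono\<close>)
    have "(\<integral>y. ln (\<Prod>i\<in>I. D i (y i)) \<partial>PiM I P) = (\<integral>y. (\<Sum>i\<in>I. ln (D i (y i))) \<partial>PiM I P)"
      using m' ln_eq int_sum by (intro integral_cong_AE) auto
    also have "\<dots> = (\<Sum>i\<in>I. \<integral>y. ln (D i (y i)) \<partial>PiM I P)"
      by (rule Bochner_Integration.integral_sum) (rule int)
    also have "\<dots> \<le> (\<Sum>i\<in>I. \<kappa> i)" by (intro sum_mono int)
    finally show "(\<integral>y. ln (\<Prod>i\<in>I. D i (y i)) \<partial>PiM I P) \<le> (\<Sum>i\<in>I. \<kappa> i)" .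
  qed
qed

section \<open>The law of the data as a product measure\<close>

definition obs_law ::
  "(real^'d) measure \<Rightarrow> (nat \<times> nat) set \<Rightarrow> (nat \<Rightarrow> real^'d) \<Rightarrow> (nat \<Rightarrow> nat \<Rightarrow> real) \<Rightarrow>
   (real^'d \<Rightarrow> real^'d) \<Rightarrow> (nat \<times> nat \<Rightarrow> real^'d) measure" where
  "obs_law P I x t f = PiM I (\<lambda>(j, i). shifted (ode_flow f (x j) (t j i)) P)"

lemma sets_shifted [simp]: "sets (shifted v P) = sets borel"
  by (simp add: shifted_def)

lemma prob_space_shifted:
  fixes v :: "real^'d"
  assumes "prob_space P" "sets P = sets borel"
  shows "prob_space (shifted v P)"
proof -
  have [measurable_cong]: "sets P = sets borel" by fact
  show ?thesis
    unfolding shifted_def by (rule prob_space.prob_space_distr[OF assms(1)]) measurable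
qed

lemma sets_obs_law [simp, measurable_cong]: "sets (obs_law P I x t f) = sets (PiM I (\<lambda>_. borel))"
  unfolding obs_law_def by (rule sets_PiM_cong) auto

lemma prob_space_obs_law:
  assumes "prob_space P" "sets P = sets borel"
  shows "prob_space (obs_law P I x t f)"
  unfolding obs_law_def by (rule prob_space_PiM) (auto intro!: prob_space_shifted[OF assms])

text \<open>Adding a fixed vector to each coordinate pulls rectangles back to rectangles, so the
  image of the product noise is again a product. In this form divergences add over the
  observations.\<close>

lemma observations_law:
  fixes P :: "(real^'d) measure"
  assumes P: "prob_space P" and [measurable_cong]: "sets P = sets borel" and I: "finite I"
  shows "observations I x t f \<in> PiM I (\<lambda>_. P) \<rightarrow>\<^sub>M PiM I (\<lambda>_. borel)" (is ?m)
    and "distr (PiM I (\<lambda>_. P)) (PiM I (\<lambda>_. borel)) (observations I x t f) = obs_law P I x t f"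
proof -
  let ?v = "\<lambda>k. ode_flow f (x (fst k)) (t (fst k) (snd k))"
  have obs: "observations I x t f = (\<lambda>\<epsilon>. \<lambda>k\<in>I. ?v k + \<epsilon> k)"
    by (auto simp: observations_def fun_eq_iff restrict_def split: prod.split)
  show m: ?m unfolding obs by measurable
  let ?Q = "\<lambda>k. shifted (?v k) P"
  interpret Q: product_sigma_finite ?Q
    by (intro product_sigma_finite.intro prob_space_imp_sigma_finite prob_space_shifted P \<open>sets P = sets borel\<close>)
  interpret P: product_sigma_finite "\<lambda>_. P"
    by (intro product_sigma_finite.intro prob_space_imp_sigma_finite P)
  have "obs_law P I x t f = PiM I ?Q" by (simp add: obs_law_def case_prod_unfold)
  also have "\<dots> = distr (PiM I (\<lambda>_. P)) (PiM I (\<lambda>_. borel)) (observations I x t f)"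
  proof (rule Q.PiM_eqI[symmetric, OF I])
    show "sets (distr (PiM I (\<lambda>_. P)) (PiM I (\<lambda>_. borel)) (observations I x t f)) = sets (PiM I ?Q)"
      by (simp, rule sets_PiM_cong) auto
    fix A assume "\<And>k. k \<in> I \<Longrightarrow> A k \<in> sets (?Q k)"
    then have A[measurable]: "\<And>k. k \<in> I \<Longrightarrow> A k \<in> sets borel" by simp
    have sp: "space P = UNIV" using \<open>sets P = sets borel\<close> sets_eq_imp_space_eq by fastforce
    have mv: "(\<lambda>z. v + z) \<in> P \<rightarrow>\<^sub>M borel" for v by measurable
    have "observations I x t f -` PiE I A \<inter> space (PiM I (\<lambda>_. P)) = PiE I (\<lambda>k. (\<lambda>z. ?v k + z) -` A k)"
      by (auto simp: obs space_PiM PiE_def Pi_def sp extensional_def)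
    then have "emeasure (distr (PiM I (\<lambda>_. P)) (PiM I (\<lambda>_. borel)) (observations I x t f)) (PiE I A)
        = emeasure (PiM I (\<lambda>_. P)) (PiE I (\<lambda>k. (\<lambda>z. ?v k + z) -` A k))"
      using I A by (subst emeasure_distr[OF m]) (auto intro!: sets_PiM_I_finite)
    also have "\<dots> = (\<Prod>k\<in>I. emeasure P ((\<lambda>z. ?v k + z) -` A k))"
      using measurable_sets[OF mv A] by (intro P.emeasure_PiM I) (auto simp: sp)
    also have "\<dots> = (\<Prod>k\<in>I. emeasure (?Q k) (A k))"
      using A by (intro prod.cong refl) (simp add: shifted_def emeasure_distr[OF mv] sp)
    finally show "emeasure (distr (PiM I (\<lambda>_. P)) (PiM I (\<lambda>_. borel)) (observations I x t f)) (PiE I A)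
        = (\<Prod>k\<in>I. emeasure (?Q k) (A k))" .
  qed
  finally show "distr (PiM I (\<lambda>_. P)) (PiM I (\<lambda>_. borel)) (observations I x t f) = obs_law P I x t f" ..
qed

lemma obs_expectation_eq:
  fixes P :: "(real^'d) measure"
  assumes "prob_space P" "sets P = sets borel" "finite I"
    and "h \<in> borel_measurable (PiM I (\<lambda>_. borel))"
  shows "obs_expectation P I x t f h = (\<integral>\<^sup>+y. h y \<partial>obs_law P I x t f)"
  unfolding obs_expectation_def observations_law(2)[OF assms(1-3), symmetric]
  using assms observations_law(1)[OF assms(1-3)] by (subst nn_integral_distr) auto

text \<open>\<open>nn_integral\<close> is monotone for arbitrary functions. This is how the supremum
  loss is treated: it is only ever bounded below by a statistic whose expectation is under
  control.\<close>

lemma obs_expectation_mono: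
  "(\<And>y. g y \<le> h y) \<Longrightarrow> obs_expectation P I x t f g \<le> obs_expectation P I x t f h"
  unfolding obs_expectation_def by (rule nn_integral_mono) auto

section \<open>Oscillations hidden by the time grid\<close>

text \<open>\<open>J\<close> is the time that \<open>s' = 1 + \<epsilon> * cos s\<close> takes for
  one turn. The speed lies between 1/2 and 3/2, which confines \<open>J\<close> and makes
  \<open>s\<close> surjective. After time \<open>J\<close> the shifted solution and
  \<open>s + 2 * pi\<close> solve the same equation from the same value, by periodicity of the
  cosine, so they coincide by uniqueness.\<close>

lemma phase_solution:
  fixes \<epsilon> :: real
  assumes \<epsilon>: "0 \<le> \<epsilon>" "\<epsilon> \<le> 1 / 2"
  obtains s :: "real \<Rightarrow> real" and J where "4 * pi / 3 \<le> J" "J \<le> 4 * pi"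
    "\<And>t. (s has_real_derivative 1 + \<epsilon> * cos (s t)) (at t)"
    "\<And>t k. s (t + real k * J) = s t + 2 * pi * real k" "surj s"
proof -
  define G where "G r = 1 + \<epsilon> * cos r" for r :: real
  have lip: "norm (G r - G q) \<le> 1 * norm (r - q)" for r q
  proof -
    have "(cos has_real_derivative - sin r) (at r)" for r :: real by (auto intro!: derivative_eq_intros)
    then have "norm (cos r - cos q) \<le> 1 * norm (r - q)"
      by (intro field_differentiable_bound[of UNIV cos "\<lambda>r. - sin r"]) auto
    then have "\<bar>\<epsilon>\<bar> * \<bar>cos r - cos q\<bar> \<le> 1 * \<bar>r - q\<bar>" using \<epsilon> by (intro mult_mono) auto
    then show ?thesis by (simp add: G_def right_diff_distrib[symmetric] abs_mult)
  qed
  have eps_cos: "\<bar>\<epsilon> * cos r\<bar> \<le> 1 / 2" for r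
  proof -
    have "\<bar>\<epsilon>\<bar> * \<bar>cos r\<bar> \<le> 1 / 2 * 1" using \<epsilon> by (intro mult_mono) auto
    then show ?thesis by (simp add: abs_mult)
  qed
  have G: "1 / 2 \<le> G r" "G r \<le> 3 / 2" for r
    using eps_cos[of r] unfolding G_def by linarith+
  have nG: "norm (G r) \<le> 3 / 2" for r using G[of r] unfolding real_norm_def by linarith
  define s where "s = ode_flow G 0"
  have s: "solves_ode G 0 s" unfolding s_def by (rule solves_ode_ode_flow[OF lip nG])
  have ds: "(s has_real_derivative G (s t)) (at t)" for t
    using s by (simp add: solves_ode_def has_real_derivative_iff_has_vector_derivative)
  have s0: "s 0 = 0" using s by (simp add: solves_ode_def)
  have mono: "s a - a / 2 \<le> s b - b / 2" if "a \<le> b" for a b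
  proof (rule DERIV_nonneg_imp_nondecreasing[OF that])
    fix x
    have "((\<lambda>x. s x - x / 2) has_real_derivative G (s x) - 1 / 2) (at x)"
      by (auto intro!: derivative_eq_intros ds)
    then show "\<exists>y. ((\<lambda>x. s x - x / 2) has_real_derivative y) (at x) \<and> 0 \<le> y" using G by force
  qed
  have cont: "continuous_on A s" for A
    using ds by (intro continuous_at_imp_continuous_on ballI) (blast intro: DERIV_isCont)
  have surj: "\<exists>t. s t = r" for r
  proof -
    define b where "b = 2 * \<bar>r\<bar>"
    have "s (- b) \<le> r" "r \<le> s b" using mono[of "- b" 0] mono[of 0 b] s0 by (auto simp: b_def)
    then show ?thesis using IVT'[of s "- b" r b] cont by (auto simp: b_def)
  qed
  have "s (4 * pi) \<ge> 2 * pi" using mono[of 0 "4 * pi"] s0 by simp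
  then obtain J where J: "0 \<le> J" "J \<le> 4 * pi" "s J = 2 * pi"
    using IVT'[of s 0 "2 * pi" "4 * pi"] cont s0 by auto
  have "norm (s J - 0) \<le> 3 / 2 * J" by (rule solves_ode_dist_le[OF s nG J(1)])
  then have J1: "4 * pi / 3 \<le> J" using J by simp
  have "solves_ode G (s J) (\<lambda>t. s (J + t))" by (rule solves_ode_time_shift[OF s])
  moreover have "solves_ode G (s J) (\<lambda>t. s t + 2 * pi)"
    unfolding solves_ode_def
    using ds by (auto simp: s0 J G_def has_real_derivative_iff_has_vector_derivative[symmetric]
        intro!: derivative_eq_intros)
  ultimately have "(\<lambda>t. s (J + t)) = (\<lambda>t. s t + 2 * pi)" by (rule solves_ode_unique[OF lip])
  then have per: "s (J + t) = s t + 2 * pi" for t by (rule fun_cong)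
  have "s (t + real k * J) = s t + 2 * pi * real k" for t k
  proof (induction k)
    case (Suc k)
    then show ?case using per[of "t + real k * J"] by (simp add: algebra_simps)
  qed simp
  then show ?thesis using that[of J s] J J1 ds surj by (auto simp: G_def surj_def) metis
qed

text \<open>The scaled vector is kept inside the cosine so that the field is an instance of
  \<open>hoelder_class_scaled\<close>, with the drift \<open>v\<close> as offset.\<close>

definition wave :: "'d \<Rightarrow> real \<Rightarrow> real \<Rightarrow> real \<Rightarrow> real \<Rightarrow> real^'d \<Rightarrow> real^'d::finite" where
  "wave i v a H \<phi> x = axis i (v + a * cos ((H *\<^sub>R x) $ i - \<phi>))"

lemma norm_axis [simp]: "norm (axis i (r::real)) = \<bar>r\<bar>"
  by (simp add: norm_axis_1 norm_eq_sqrt_inner inner_axis_axis)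

lemma axis_diff: "axis i r - axis i s = (axis i (r - s) :: real^'d)"
  by (simp add: axis_def vec_eq_iff)

lemma wave_lipschitz:
  assumes "0 \<le> a" "0 \<le> H"
  shows "norm (wave i v a H \<phi> x - wave i v a H \<phi> y) \<le> (a * H) * norm (x - y)"
proof -
  have "\<bar>cos ((H *\<^sub>R x) $ i - \<phi>) - cos ((H *\<^sub>R y) $ i - \<phi>)\<bar> \<le> 1 * norm (H *\<^sub>R x - H *\<^sub>R y)"
    by (rule smooth_bound_lipschitz[OF smooth_bound_cos])
  then have "a * \<bar>cos ((H *\<^sub>R x) $ i - \<phi>) - cos ((H *\<^sub>R y) $ i - \<phi>)\<bar> \<le> a * (H * norm (x - y))"
    using assms by (intro mult_left_mono) (auto simp: scaleR_diff_right[symmetric])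
  then show ?thesis
    using assms by (simp add: wave_def axis_diff right_diff_distrib[symmetric] abs_mult)
qed

text \<open>
  The oscillation has the same period in space for every phase, and it takes the time \<open>\<Delta>\<close> to
  traverse one period. Observations at multiples of \<open>\<Delta>\<close> therefore do not reveal the phase.
\<close>

lemma wave_flow:
  fixes i :: "'d::finite"
  assumes "v > 0" "0 \<le> a" "a \<le> v / 2" "\<Delta> > 0"
  obtains H where "4 * pi / (3 * v * \<Delta>) \<le> H" "H \<le> 4 * pi / (v * \<Delta>)"
    "\<And>\<phi> x k. ode_flow (wave i v a H \<phi>) x (real k * \<Delta>) = x + axis i (2 * pi * real k / H)"
proof -
  define \<epsilon> where "\<epsilon> = a / v"
  have "0 \<le> \<epsilon>" "\<epsilon> \<le> 1 / 2" using assms by (auto simp: \<epsilon>_def field_simps)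
  then obtain s J where J: "4 * pi / 3 \<le> J" "J \<le> 4 * pi"
    and ds: "\<And>t. (s has_real_derivative 1 + \<epsilon> * cos (s t)) (at t)"
    and per: "\<And>t k. s (t + real k * J) = s t + 2 * pi * real k" and "surj s"
    using phase_solution by metis
  \<comment> \<open>The phase \<open>H * x $ i - \<phi>\<close> along a trajectory follows the
    scalar equation at speed \<open>v * H\<close>, so one turn takes the time
    \<open>J / (v * H)\<close>, which this choice makes equal to \<open>\<Delta>\<close>.\<close>
  define H where "H = J / (v * \<Delta>)"
  have J0: "J > 0" using J(1) pi_gt_zero by linarith
  then have H: "H > 0" using assms by (simp add: H_def)
  show ?thesis
  proof (rule that[of H])
    show "4 * pi / (3 * v * \<Delta>) \<le> H" "H \<le> 4 * pi / (v * \<Delta>)"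
      using J assms by (auto simp: H_def field_simps)
    fix \<phi> :: real and x :: "real^'d" and k :: nat
    \<comment> \<open>Starting point and phase enter only through the time \<open>\<tau>\<close> at
      which the single solution \<open>s\<close> is joined; surjectivity provides it.\<close>
    obtain \<tau> where \<tau>: "s \<tau> = H * x $ i - \<phi>" using \<open>surj s\<close> by (metis surj_def)
    let ?u = "\<lambda>t. x + ((s (\<tau> + v * H * t) - s \<tau>) / H) *\<^sub>R axis i (1::real)"
    have "ode_flow (wave i v a H \<phi>) x = ?u"
    proof (rule ode_flow_eqI[OF wave_lipschitz])
      have ph: "(H *\<^sub>R ?u t) $ i - \<phi> = s (\<tau> + v * H * t)" for t
        using H \<tau> by (simp add: distrib_left)
      have "(?u has_vector_derivative ((1 + \<epsilon> * cos (s (\<tau> + v * H * t))) * (v * H) / H) *\<^sub>R axis i 1) (at t)" for t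
      proof -
        have "((\<lambda>t. s (\<tau> + v * H * t)) has_real_derivative
            (1 + \<epsilon> * cos (s (\<tau> + v * H * t))) * (v * H)) (at t)"
          by (rule DERIV_chain2[OF ds]) (auto intro!: derivative_eq_intros)
        then have "((\<lambda>t. (s (\<tau> + v * H * t) - s \<tau>) / H) has_real_derivative
            (1 + \<epsilon> * cos (s (\<tau> + v * H * t))) * (v * H) / H) (at t)"
          using H by (auto intro!: derivative_eq_intros)
        from has_vector_derivative_add[OF has_vector_derivative_const
            has_vector_derivative_scaleR[OF this has_vector_derivative_const]]
        show ?thesis using H by simp
      qed
      moreover have "((1 + \<epsilon> * cos (s (\<tau> + v * H * t))) * (v * H) / H) *\<^sub>R axis i 1 = wave i v a H \<phi> (?u t)" for t
        unfolding wave_def ph using H assms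
        by (auto simp: vec_eq_iff axis_def \<epsilon>_def field_simps)
      ultimately have "(?u has_vector_derivative wave i v a H \<phi> (?u t)) (at t)" for t by metis
      then show "solves_ode (wave i v a H \<phi>) x ?u" by (simp add: solves_ode_def)
    qed (use assms H in auto)
    moreover have "v * H * (real k * \<Delta>) = real k * J" using assms by (simp add: H_def)
    then have "s (\<tau> + v * H * (real k * \<Delta>)) - s \<tau> = 2 * pi * real k" by (simp only: per)
    ultimately show "ode_flow (wave i v a H \<phi>) x (real k * \<Delta>) = x + axis i (2 * pi * real k / H)"
      by (simp add: vec_eq_iff axis_def)
  qed
qed

lemma wave_in_hoelder_class:
  assumes "real l < \<beta>" "\<beta> \<le> real l + 1" "H \<ge> 1" "0 \<le> a" "a \<le> c * H powr (- \<beta>)"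
    "\<bar>v\<bar> \<le> L 0 / 2" "\<And>k. k \<le> l \<Longrightarrow> c \<le> L k / 2" "2 * c \<le> L\<beta>"
  shows "wave i v a H \<phi> \<in> hoelder_class l \<beta> L L\<beta>"
  unfolding wave_def[abs_def]
  by (rule hoelder_class_scaled[OF smooth_bound_cos]) (use assms in auto)

lemma wave_measurable [measurable]: "wave i v a H \<phi> \<in> borel_measurable borel"
proof -
  have "wave i v a H \<phi> = (\<lambda>x. (v + a * cos (H * x $ i - \<phi>)) *\<^sub>R axis i 1)"
    by (auto simp: wave_def fun_eq_iff vec_eq_iff axis_def)
  moreover have "continuous_on UNIV (\<lambda>x. (v + a * cos (H * x $ i - \<phi>)) *\<^sub>R axis i (1::real))"
    by (intro continuous_intros)
  ultimately show ?thesis by (simp add: borel_measurable_continuous_onI)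
qed

text \<open>With \<open>p\<close> the centred component of \<open>w\<close> and
  \<open>\<theta>\<close> the local phase, the four errors are \<open>p\<close> minus or plus
  \<open>a * cos \<theta>\<close> and \<open>a * sin \<theta>\<close>. Opposite phases cancel the
  terms linear in \<open>p\<close>, and quadrature turns the rest into \<open>2 * a\<^sup>2\<close>,
  free of \<open>\<theta>\<close>, so the bound holds at every point.\<close>

lemma sum_wave_dist_ge:
  "2 * a\<^sup>2 \<le> (\<Sum>k<4. (norm (w - wave i v a H (real k * (pi / 2)) z))\<^sup>2)"
proof -
  define p where "p = w $ i - v"
  define \<theta> where "\<theta> = (H *\<^sub>R z) $ i"
  have "(p - a * cos (\<theta> - real k * (pi / 2)))\<^sup>2 \<le> (norm (w - wave i v a H (real k * (pi / 2)) z))\<^sup>2" for k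
  proof -
    have "\<bar>(w - wave i v a H (real k * (pi / 2)) z) $ i\<bar> \<le> norm (w - wave i v a H (real k * (pi / 2)) z)"
      by (rule component_le_norm_cart)
    then show ?thesis
      by (simp add: wave_def axis_def p_def \<theta>_def abs_le_square_iff[symmetric] algebra_simps)
  qed
  then have "(\<Sum>k<4. (p - a * cos (\<theta> - real k * (pi / 2)))\<^sup>2)
      \<le> (\<Sum>k<4. (norm (w - wave i v a H (real k * (pi / 2)) z))\<^sup>2)"
    by (intro sum_mono)
  moreover have "(\<Sum>k<4. (p - a * cos (\<theta> - real k * (pi / 2)))\<^sup>2) =
      (p - a * cos \<theta>)\<^sup>2 + (p - a * sin \<theta>)\<^sup>2 + (p + a * cos \<theta>)\<^sup>2 + (p + a * sin \<theta>)\<^sup>2"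
  proof -
    have "cos (\<theta> - pi / 2) = sin \<theta>" by (simp add: cos_diff)
    moreover have "cos (\<theta> - 3 * (pi / 2)) = - sin \<theta>"
    proof -
      have "\<theta> - 3 * (pi / 2) = (\<theta> - pi / 2) - pi" by simp
      then have "cos (\<theta> - 3 * (pi / 2)) = - cos (\<theta> - pi / 2)" by (simp only: cos_minus_pi)
      then show ?thesis by (simp add: cos_diff)
    qed
    moreover have "cos (\<theta> - 2 * (pi / 2)) = - cos \<theta>" by (simp add: cos_diff)
    ultimately show ?thesis by (simp add: numeral_eq_Suc lessThan_Suc mult.commute)
  qed
  moreover have "\<dots> = 4 * p\<^sup>2 + 2 * a\<^sup>2 * ((cos \<theta>)\<^sup>2 + (sin \<theta>)\<^sup>2)"
    by algebra
  ultimately have "4 * p\<^sup>2 + 2 * a\<^sup>2 \<le> (\<Sum>k<4. (norm (w - wave i v a H (real k * (pi / 2)) z))\<^sup>2)"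
    by simp
  then show ?thesis using zero_le_power2[of p] by linarith
qed

section \<open>Measurable losses and indistinguishable hypotheses\<close>

lemma estimator_loss_measurable:
  fixes fh :: "(nat \<times> nat \<Rightarrow> real^'d) \<Rightarrow> real^'d \<Rightarrow> real^'d"
  assumes fh: "fh \<in> estimators I" and f: "f \<in> borel_measurable borel"
  shows "(\<lambda>(y, z). ennreal ((norm (fh y z - f z))\<^sup>2)) \<in> borel_measurable (PiM I (\<lambda>_. borel) \<Otimes>\<^sub>M borel)"
    and "(\<lambda>y. ennreal ((norm (fh y z - f z))\<^sup>2)) \<in> borel_measurable (PiM I (\<lambda>_. borel))"
    and "(\<lambda>y. \<integral>\<^sup>+z\<in>cbox 0 1. ennreal ((norm (fh y z - f z))\<^sup>2) \<partial>lborel)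
      \<in> borel_measurable (PiM I (\<lambda>_. borel))"
    and "y \<in> space (PiM I (\<lambda>_. borel)) \<Longrightarrow> (\<lambda>z. ennreal ((norm (fh y z - f z))\<^sup>2)) \<in> borel_measurable borel"
proof -
  have [measurable]: "(\<lambda>(y, z). fh y z) \<in> PiM I (\<lambda>_. borel) \<Otimes>\<^sub>M borel \<rightarrow>\<^sub>M borel"
    using fh by (simp add: estimators_def)
  note [measurable] = f
  show pair[measurable]: "(\<lambda>(y, z). ennreal ((norm (fh y z - f z))\<^sup>2))
      \<in> borel_measurable (PiM I (\<lambda>_. borel) \<Otimes>\<^sub>M borel)"
    by measurable
  show "(\<lambda>y. ennreal ((norm (fh y z - f z))\<^sup>2)) \<in> borel_measurable (PiM I (\<lambda>_. borel))"
    using measurable_compose[OF measurable_Pair2'[of z] pair] by simp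
  show "(\<lambda>y. \<integral>\<^sup>+z\<in>cbox 0 1. ennreal ((norm (fh y z - f z))\<^sup>2) \<partial>lborel)
      \<in> borel_measurable (PiM I (\<lambda>_. borel))"
    by measurable
  show "(\<lambda>z. ennreal ((norm (fh y z - f z))\<^sup>2)) \<in> borel_measurable borel" if "y \<in> space (PiM I (\<lambda>_. borel))"
    using measurable_compose[OF measurable_Pair1'[OF that] pair] by simp
qed

lemma emeasure_lborel_unit_cube: "emeasure lborel (cbox 0 (1::real^'d)) = 1"
proof -
  have "b \<in> Basis \<Longrightarrow> 1 \<bullet> b = 1" for b :: "real^'d" by (auto simp: Basis_vec_def inner_axis)
  then show ?thesis by (simp add: emeasure_lborel_cbox_eq)
qed

abbreviation (input) sq_err ::
  "('y \<Rightarrow> real^'d \<Rightarrow> real^'d) \<Rightarrow> (real^'d \<Rightarrow> real^'d) \<Rightarrow> real^'d \<Rightarrow> 'y \<Rightarrow> ennreal" where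
  "sq_err fh f z y \<equiv> ennreal ((norm (fh y z - f z))\<^sup>2)"

abbreviation (input) int_sq_err ::
  "('y \<Rightarrow> real^'d \<Rightarrow> real^'d) \<Rightarrow> (real^'d \<Rightarrow> real^'d) \<Rightarrow> 'y \<Rightarrow> ennreal" where
  "int_sq_err fh f y \<equiv> \<integral>\<^sup>+z\<in>cbox 0 1. ennreal ((norm (fh y z - f z))\<^sup>2) \<partial>lborel"

text \<open>For every realisation of the noise the estimator sees the same data under all
  hypotheses, hence returns the same function, which faces the sum of all losses. The supremum risk
  is at least the average of the individual risks.\<close>

lemma SUP_ge_of_indistinguishable:
  fixes P :: "(real^'d) measure" and f :: "nat \<Rightarrow> real^'d \<Rightarrow> real^'d"
  assumes P: "prob_space P" "sets P = sets borel" and I: "finite I"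
    and F: "\<And>k. k < K \<Longrightarrow> f k \<in> F"
    and same: "\<And>k. observations I x t (f k) = observations I x t (f 0)"
    and h: "\<And>k. k < K \<Longrightarrow> h (f k) \<in> borel_measurable (PiM I (\<lambda>_. borel))"
    and ge: "\<And>y. y \<in> space (PiM I (\<lambda>_. borel)) \<Longrightarrow> c \<le> (\<Sum>k<K. h (f k) y)"
  shows "c \<le> of_nat K * (SUP g\<in>F. obs_expectation P I x t g (h g))"
proof -
  let ?o = "observations I x t (f 0)"
  interpret prob_space "PiM I (\<lambda>_. P)" by (rule prob_space_PiM) (rule P)
  have o[measurable]: "?o \<in> PiM I (\<lambda>_. P) \<rightarrow>\<^sub>M PiM I (\<lambda>_. borel)"
    by (rule observations_law(1)[OF P I])
  have "c = (\<integral>\<^sup>+\<epsilon>. c \<partial>PiM I (\<lambda>_. P))" by (simp add: emeasure_space_1)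
  also have "\<dots> \<le> (\<integral>\<^sup>+\<epsilon>. (\<Sum>k<K. h (f k) (?o \<epsilon>)) \<partial>PiM I (\<lambda>_. P))"
    using measurable_space[OF o] by (intro nn_integral_mono ge)
  also have "\<dots> = (\<Sum>k<K. \<integral>\<^sup>+\<epsilon>. h (f k) (?o \<epsilon>) \<partial>PiM I (\<lambda>_. P))"
    by (rule nn_integral_sum) (rule measurable_compose[OF o h], simp)
  also have "\<dots> = (\<Sum>k<K. obs_expectation P I x t (f k) (h (f k)))"
    unfolding obs_expectation_def by (intro sum.cong refl, subst same) (rule refl)
  also have "\<dots> \<le> (\<Sum>k<K. SUP g\<in>F. obs_expectation P I x t g (h g))"
    by (intro sum_mono SUP_upper F) auto
  finally show ?thesis by simp
qed

lemma ennreal_le_of_numeral_mult: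
  fixes x :: real and y :: ennreal
  assumes "ennreal (r * x) \<le> ennreal r * y" "r > 0"
  shows "ennreal x \<le> y"
proof -
  have "ennreal (1 / r) * ennreal (r * x) \<le> ennreal (1 / r) * (ennreal r * y)"
    using assms(1) by (rule mult_left_mono) simp
  then show ?thesis
    using assms(2) by (simp add: mult.assoc[symmetric] ennreal_mult'[symmetric])
qed

lemma discretization_lower_bound:
  fixes L :: "nat \<Rightarrow> real"
  assumes \<beta>: "real l < \<beta>" "\<beta> \<le> real l + 1" and L: "\<And>k. k \<le> l \<Longrightarrow> L k > 0" and L\<beta>: "L\<beta> > 0"
  defines "F \<equiv> (hoelder_class l \<beta> L L\<beta> :: (real^'d \<Rightarrow> real^'d) set)"
  shows "\<exists>c>0. \<exists>\<delta>>0. \<forall>\<Delta> (P :: (real^'d) measure) I x t fh.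
       0 < \<Delta> \<longrightarrow> \<Delta> \<le> \<delta> \<longrightarrow> prob_space P \<longrightarrow> sets P = sets borel \<longrightarrow> finite I \<longrightarrow>
       (\<forall>(j, i)\<in>I. t j i = real i * \<Delta>) \<longrightarrow> fh \<in> estimators I \<longrightarrow>
       (\<forall>z. ennreal (c * \<Delta> powr (2 * \<beta>)) \<le> (SUP f\<in>F. obs_expectation P I x t f (sq_err fh f z))) \<and>
       ennreal (c * \<Delta> powr (2 * \<beta>)) \<le> (SUP f\<in>F. obs_expectation P I x t f (int_sq_err fh f))"
proof -
  \<comment> \<open>A quarter serves three purposes: the class bounds with room for the drift, the
    Hoelder bound, and \<open>c0 \<le> v / 2\<close> for the drift
    \<open>v = L 0 / 2\<close>.\<close>
  define c0 where "c0 = Min (insert L\<beta> (L ` {..l})) / 4"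
  have c0: "c0 > 0" using L L\<beta> by (auto simp: c0_def Min_gr_iff)
  have c0L: "c0 \<le> L k / 4" if "k \<le> l" for k
    using that unfolding c0_def by (intro divide_right_mono Min_le) auto
  have c0\<beta>: "c0 \<le> L\<beta> / 4" unfolding c0_def by (intro divide_right_mono Min_le) auto
  define v where "v = L 0 / 2"
  have v: "v > 0" using L[of 0] by (simp add: v_def)
  have b0: "\<beta> > 0" using \<beta> by linarith
  \<comment> \<open>Averaging the total squared error \<open>2 * a\<^sup>2\<close> over four phases
    leaves \<open>a\<^sup>2 / 2\<close>.\<close>
  define c where "c = c0\<^sup>2 * (v / (4 * pi)) powr (2 * \<beta>) / 2"
  show ?thesis
  proof (rule exI[of _ c], rule conjI[OF _ exI[of _ "1 / v"]], goal_cases)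
    case 1
    show ?case using c0 v by (simp add: c_def)
  next
    case 2
    show ?case
    proof (intro conjI[of "0 < 1 / v"] allI impI)
    show "1 / v > 0" using v by simp
    fix \<Delta> and P :: "(real^'d) measure" and I and x :: "nat \<Rightarrow> real^'d" and t
      and fh :: "(nat \<times> nat \<Rightarrow> real^'d) \<Rightarrow> real^'d \<Rightarrow> real^'d"
    assume \<Delta>: "0 < \<Delta>" "\<Delta> \<le> 1 / v" and P: "prob_space P" "sets P = sets borel" and I: "finite I"
      and "\<forall>(j, i)\<in>I. t j i = real i * \<Delta>" and fh: "fh \<in> estimators I"
    then have t: "\<And>j i. (j, i) \<in> I \<Longrightarrow> t j i = real i * \<Delta>" by auto
    \<comment> \<open>The frequency \<open>H\<close> depends on \<open>a\<close>, so
      \<open>a\<close> cannot be defined through \<open>H\<close>. It is fixed from the a priori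
      bound \<open>H \<le> 4 * pi / (v * \<Delta>)\<close>, which later gives
      \<open>a \<le> c0 * H powr (- \<beta>)\<close>.\<close>
    define a where "a = c0 * (v * \<Delta> / (4 * pi)) powr \<beta>"
    have v\<Delta>: "v * \<Delta> \<le> 1" "v * \<Delta> > 0" using \<Delta> v by (auto simp: field_simps)
    have "v * \<Delta> / (4 * pi) \<le> 1" using v\<Delta> pi_gt3 by (simp add: field_simps)
    then have "(v * \<Delta> / (4 * pi)) powr \<beta> \<le> 1 powr \<beta>"
      using v\<Delta> b0 by (intro powr_mono2) auto
    then have "a \<le> c0 * 1" unfolding a_def using c0 by (intro mult_left_mono) auto
    also have "c0 \<le> v / 2" using c0L[of 0] by (simp add: v_def)
    finally have a: "0 \<le> a" "a \<le> v / 2" using c0 by (auto simp: a_def)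
    obtain H where H: "4 * pi / (3 * v * \<Delta>) \<le> H" "H \<le> 4 * pi / (v * \<Delta>)"
      and flow: "\<And>\<phi> x k. ode_flow (wave (undefined :: 'd) v a H \<phi>) x (real k * \<Delta>)
        = x + axis undefined (2 * pi * real k / H)"
      using wave_flow[OF v a \<Delta>(1), of "undefined :: 'd"] by metis
    have "1 \<le> 4 * pi / (3 * v * \<Delta>)" using v\<Delta> pi_gt3 by (simp add: field_simps)
    with H have H1: "H \<ge> 1" by simp
    have "v * \<Delta> / (4 * pi) \<le> 1 / H" using H(2) H1 v\<Delta> by (simp add: field_simps)
    then have "(v * \<Delta> / (4 * pi)) powr \<beta> \<le> (1 / H) powr \<beta>"
      using v\<Delta> b0 by (intro powr_mono2) auto
    then have aH: "a \<le> c0 * H powr (- \<beta>)"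
      using c0 H1 by (simp add: a_def powr_minus powr_divide field_simps)
    define f where "f k = wave (undefined :: 'd) v a H (real k * (pi / 2))" for k :: nat
    have F: "f k \<in> F" for k
      unfolding f_def F_def
      by (rule wave_in_hoelder_class[OF \<beta> H1 a(1) aH]) (use c0L c0\<beta> c0 v in \<open>force simp: v_def\<close>)+
    have same: "observations I x t (f k) = observations I x t (f 0)" for k
      unfolding observations_def f_def
      by (auto simp: fun_eq_iff restrict_def t flow)
    have fm: "f k \<in> borel_measurable borel" for k by (simp add: f_def)
    note m = estimator_loss_measurable[OF fh fm]
    have dist: "ennreal (2 * a\<^sup>2) \<le> (\<Sum>k<4. sq_err fh (f k) z y)" for z y
      using sum_wave_dist_ge[of a "fh y z" undefined v H z]
      by (simp add: f_def sum_ennreal ennreal_leI)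
    have eq: "a\<^sup>2 / 2 = c * \<Delta> powr (2 * \<beta>)"
    proof -
      have "((v * \<Delta> / (4 * pi)) powr \<beta>)\<^sup>2 = (v / (4 * pi) * \<Delta>) powr (2 * \<beta>)"
        by (simp add: power2_eq_square powr_add[symmetric])
      also have "\<dots> = (v / (4 * pi)) powr (2 * \<beta>) * \<Delta> powr (2 * \<beta>)"
        by (rule powr_mult)
      finally show ?thesis by (simp add: a_def c_def power_mult_distrib)
    qed
    have fin: "ennreal (a\<^sup>2 / 2) \<le> S" if "ennreal (2 * a\<^sup>2) \<le> of_nat 4 * S" for S
    proof (rule ennreal_le_of_numeral_mult[of 4])
      have "4 * (a\<^sup>2 / 2) = 2 * a\<^sup>2" by simp
      moreover have "(of_nat 4 :: ennreal) = ennreal 4" by (simp add: ennreal_of_nat_eq_real_of_nat)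
      ultimately show "ennreal (4 * (a\<^sup>2 / 2)) \<le> ennreal 4 * S" using that by (simp only:)
    qed simp
    have "ennreal (a\<^sup>2 / 2) \<le> (SUP f\<in>F. obs_expectation P I x t f (sq_err fh f z))" for z
      by (rule fin, rule SUP_ge_of_indistinguishable[where f = f, OF P I F same m(2) dist])
    moreover have "ennreal (a\<^sup>2 / 2) \<le> (SUP f\<in>F. obs_expectation P I x t f (int_sq_err fh f))"
    proof (rule fin, rule SUP_ge_of_indistinguishable[where f = f and K = 4 and h = "int_sq_err fh" and F = F and x = x
          and t = t, OF P I F same m(3)])
      fix y :: "nat \<times> nat \<Rightarrow> real^'d" assume y: "y \<in> space (PiM I (\<lambda>_. borel))"
      have [measurable]: "(\<lambda>z. sq_err fh (f k) z y) \<in> borel_measurable borel" for k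
        by (rule m(4)[OF y])
      have "ennreal (2 * a\<^sup>2) = (\<integral>\<^sup>+z\<in>cbox 0 (1::real^'d). ennreal (2 * a\<^sup>2) \<partial>lborel)"
        by (simp add: nn_integral_cmult_indicator emeasure_lborel_unit_cube)
      also have "\<dots> \<le> (\<integral>\<^sup>+z\<in>cbox 0 1. (\<Sum>k<4. sq_err fh (f k) z y) \<partial>lborel)"
        by (intro nn_integral_mono mult_right_mono dist) auto
      also have "\<dots> = (\<Sum>k<4. int_sq_err fh (f k) y)"
        by (subst sum_distrib_right, rule nn_integral_sum) measurable
      finally show "ennreal (2 * a\<^sup>2) \<le> (\<Sum>k<4. int_sq_err fh (f k) y)" .
    qed
    ultimately show "(\<forall>z. ennreal (c * \<Delta> powr (2 * \<beta>)) \<le> (SUP f\<in>F. obs_expectation P I x t f (sq_err fh f z))) \<and>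
       ennreal (c * \<Delta> powr (2 * \<beta>)) \<le> (SUP f\<in>F. obs_expectation P I x t f (int_sq_err fh f))"
      unfolding eq by blast
    qed
  qed
qed

section \<open>Localised perturbations\<close>

text \<open>The centres in \<open>S\<close> live in the rescaled coordinates
  \<open>H *\<^sub>R x\<close>; the actual bumps sit at \<open>(1 / H) *\<^sub>R c\<close>. One
  notion of separation thus serves all widths.\<close>

definition bump_field :: "'d \<Rightarrow> nat \<Rightarrow> real \<Rightarrow> real \<Rightarrow> (real^'d) set \<Rightarrow> real^'d \<Rightarrow> real^'d::finite" where
  "bump_field i m a H S x = axis i (a * bumps m S (H *\<^sub>R x))"

lemma bump_field_insert:
  assumes "finite S" "c \<notin> S"
  shows "bump_field i m a H (insert c S) x = bump_field i m a H S x + axis i (a * bump m (H *\<^sub>R x - c))"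
  using assms by (simp add: bump_field_def bumps_def axis_def vec_eq_iff algebra_simps)

lemma bump_field_eq_0:
  assumes "separated (insert c S)" "c \<notin> S" "m > 0" "bump m (H *\<^sub>R x - c) \<noteq> 0"
  shows "bump_field i m a H S x = 0"
proof -
  have "bumps m S (H *\<^sub>R x) = 0"
    unfolding bumps_def
  proof (rule sum.neutral, rule ballI)
    fix c' assume "c' \<in> S"
    then show "bump m (H *\<^sub>R x - c') = 0"
      using separated_bump_eq_0[OF assms(1) _ _ _ assms(3,4), of c'] assms(2) by auto
  qed
  then show ?thesis by (simp add: bump_field_def axis_def vec_eq_iff)
qed

lemma bump_field_norm_le:
  assumes "smooth_bound k C U (bumps m S)" "0 \<le> a"
  shows "norm (bump_field i m a H S x) \<le> a * C"
  using smooth_bound_abs_le[OF assms(1)] assms(2)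
  by (simp add: bump_field_def abs_mult mult_left_mono)

lemma bump_field_lipschitz:
  assumes "smooth_bound (Suc k) C U (bumps m S)" "0 \<le> a" "0 \<le> H"
  shows "norm (bump_field i m a H S x - bump_field i m a H S y) \<le> (a * (C * H)) * norm (x - y)"
proof -
  have "a * \<bar>bumps m S (H *\<^sub>R x) - bumps m S (H *\<^sub>R y)\<bar> \<le> a * (C * norm (H *\<^sub>R x - H *\<^sub>R y))"
    using assms by (intro mult_left_mono smooth_bound_lipschitz)
  then show ?thesis
    using assms by (simp add: bump_field_def axis_diff right_diff_distrib[symmetric] abs_mult
        scaleR_diff_right[symmetric] mult.assoc)
qed

lemma bump_field_measurable:
  assumes "smooth_bound (Suc k) C U (bumps m S)" "0 \<le> a" "0 \<le> H"
  shows "bump_field i m a H S \<in> borel_measurable borel"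
proof -
  have "(a * (C * H))-lipschitz_on UNIV (bump_field i m a H S)"
    using bump_field_lipschitz[OF assms] smooth_bound_nonneg[OF assms(1)] assms(2,3)
    by (intro lipschitz_onI) (auto simp: dist_norm)
  then show ?thesis by (intro borel_measurable_continuous_onI lipschitz_on_continuous_on)
qed

text \<open>Separation makes the old field vanish on the support of the new bump. A start outside
  that support has the same trajectory under both fields; a start inside rests under the old field
  and moves at speed at most \<open>a * C\<close> under the new one. The bound is therefore linear
  in time.\<close>

lemma bump_flow_dist_le:
  assumes S: "separated (insert c S)" "finite S" "c \<notin> S" and "m > 0"
    and sb: "smooth_bound (Suc k) C U (bumps m S)"
    and sb': "smooth_bound (Suc k) C U (bumps m (insert c S))"
    and "0 \<le> a" "0 \<le> H" "0 \<le> t"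
  shows "norm (ode_flow (bump_field i m a H (insert c S)) x t - ode_flow (bump_field i m a H S) x t)
    \<le> (if bump m (H *\<^sub>R x - c) = 0 then 0 else a * C * t)"
proof -
  let ?f = "bump_field i m a H S" and ?g = "bump_field i m a H (insert c S)"
  let ?A = "{y. bump m (H *\<^sub>R y - c) \<noteq> 0}"
  note lf = bump_field_lipschitz[OF sb \<open>0 \<le> a\<close> \<open>0 \<le> H\<close>]
  note lg = bump_field_lipschitz[OF sb' \<open>0 \<le> a\<close> \<open>0 \<le> H\<close>]
  note bf = bump_field_norm_le[OF sb \<open>0 \<le> a\<close>]
  note bg = bump_field_norm_le[OF sb' \<open>0 \<le> a\<close>]
  have zero: "?f y = 0" if "y \<in> ?A" for y
    using bump_field_eq_0[OF S(1,3) \<open>m > 0\<close>] that by simp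
  show ?thesis
  proof (cases "x \<in> ?A")
    case False
    have "ode_flow ?g x = ode_flow ?f x"
    proof (rule ode_flow_eq_outside[OF lf bf lg zero])
      show "?g y = ?f y" if "y \<notin> ?A" for y
        using that bump_field_insert[OF S(2,3)] by (simp add: axis_def vec_eq_iff)
    qed (use False in auto)
    then show ?thesis using False by simp
  next
    case True
    have "ode_flow ?f x = (\<lambda>_. x)" by (rule ode_flow_equilibrium[OF lf zero[OF True]])
    moreover have "norm (ode_flow ?g x t - x) \<le> a * C * t"
      by (rule solves_ode_dist_le[OF solves_ode_ode_flow[OF lg bg] bg \<open>0 \<le> t\<close>])
    ultimately show ?thesis using True by simp
  qed
qed

section \<open>The fixed experiment and the information carried by one bump\<close>

lemma norm_less_of_components:
  fixes w :: "real^'d"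
  assumes "\<And>i. \<bar>w $ i\<bar> < r"
  shows "norm w < real CARD('d) * r"
proof -
  have "norm w \<le> (\<Sum>i\<in>UNIV. \<bar>w $ i\<bar>)" by (rule norm_le_l1_cart)
  also have "\<dots> < (\<Sum>i\<in>(UNIV::'d set). r)" by (rule sum_strict_mono) (use assms in auto)
  finally show ?thesis by simp
qed

locale design =
  fixes P :: "(real^'d) measure" and m :: nat and n :: "nat \<Rightarrow> nat" and x :: "nat \<Rightarrow> real^'d"
    and t :: "nat \<Rightarrow> nat \<Rightarrow> real" and \<Delta> Cn Cc :: real and nmax :: nat
  assumes P: "prob_space P" "sets P = sets borel"
    and noise: "noise_condition Cn P" and cover: "cover_condition Cc m x"
    and n: "\<And>j. j \<in> {1..m} \<Longrightarrow> 1 \<le> n j \<and> n j \<le> nmax" and m: "m \<ge> 1"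
    and t: "\<And>j i. j \<in> {1..m} \<Longrightarrow> i \<le> n j \<Longrightarrow> t j i = real i * \<Delta>"
    and pos: "\<Delta> > 0" "Cn > 0" "Cc > 0"
begin

abbreviation "I \<equiv> obs_index m n"
abbreviation "N \<equiv> real (\<Sum>j=1..m. n j)"
abbreviation "law \<equiv> obs_law P I x t"
abbreviation "E \<equiv> obs_expectation P I x t"

lemma finite_I: "finite I" by (simp add: obs_index_def)

lemma t_I: "(j, i) \<in> I \<Longrightarrow> t j i = real i * \<Delta>" using t by (auto simp: obs_index_def)

lemma m_le_N: "real m \<le> N"
proof -
  have "(\<Sum>j=1..m. 1) \<le> (\<Sum>j=1..m. n j)" using n by (intro sum_mono) auto
  then show ?thesis by (simp only: of_nat_le_iff) simp
qed

lemma prob_law: "prob_space (law f)" by (rule prob_space_obs_law[OF P])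

lemma E_eq: "h \<in> borel_measurable (PiM I (\<lambda>_. borel)) \<Longrightarrow> E f h = (\<integral>\<^sup>+y. h y \<partial>law f)"
  by (rule obs_expectation_eq[OF P finite_I])

text \<open>The bound that (Noise) gives on the divergence of \<open>law f\<close> from
  \<open>law g\<close>; it reduces the statistics to displacements of trajectories.\<close>

definition info :: "(real^'d \<Rightarrow> real^'d) \<Rightarrow> (real^'d \<Rightarrow> real^'d) \<Rightarrow> real" where
  "info f g = (\<Sum>(j, i)\<in>I. Cn * (norm (ode_flow f (x j) (t j i) - ode_flow g (x j) (t j i)))\<^sup>2)"

lemma law_le_info:
  assumes "A \<in> sets (PiM I (\<lambda>_. borel))" "\<tau> > 0"
  shows "measure (law f) A \<le> (info f g + 1) / \<tau> + exp \<tau> * measure (law g) A"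
  unfolding obs_law_def info_def case_prod_beta
proof (rule measure_PiM_le_of_KL[OF finite_I])
  show "KL (shifted (ode_flow f (x (fst k)) (t (fst k) (snd k))) P)
      (shifted (ode_flow g (x (fst k)) (t (fst k) (snd k))) P)
    \<le> ereal (Cn * (norm (ode_flow f (x (fst k)) (t (fst k) (snd k)) - ode_flow g (x (fst k)) (t (fst k) (snd k))))\<^sup>2)" for k
    using noise unfolding noise_condition_def by blast
  have "sets (PiM I (\<lambda>k. shifted (ode_flow g (x (fst k)) (t (fst k) (snd k))) P)) = sets (PiM I (\<lambda>_. borel))"
    by (rule sets_PiM_cong) auto
  then show "A \<in> sets (PiM I (\<lambda>k. shifted (ode_flow g (x (fst k)) (t (fst k) (snd k))) P))"
    using assms by simp
qed (use assms in \<open>auto intro: prob_space_shifted[OF P]\<close>)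

text \<open>The support is a cube of half-width \<open>1 / H\<close>, contained by the l1 bound in
  the ball of radius \<open>d / H\<close> around its centre, to which (Cover) applies. The summand 1
  is \<open>m\<close> times the \<open>1 / m\<close> of (Cover); in the other term \<open>m\<close>
  is replaced by the larger \<open>N\<close>.\<close>

lemma card_bump_le:
  fixes c :: "real^'d"
  assumes "H > 0" "(1 / H) *\<^sub>R c \<in> cbox 0 1" "q > 0"
  shows "real (card {j\<in>{1..m}. bump q (H *\<^sub>R x j - c) \<noteq> 0})
    \<le> 1 + N * Cc * (real CARD('d) / H) ^ CARD('d)"
proof -
  let ?z = "(1 / H) *\<^sub>R c" and ?r = "real CARD('d) * (1 / H)"
  have sub: "{j\<in>{1..m}. bump q (H *\<^sub>R x j - c) \<noteq> 0} \<subseteq> {j\<in>{1..m}. norm (x j - ?z) < ?r}"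
  proof safe
    fix j assume "bump q (H *\<^sub>R x j - c) \<noteq> 0"
    from bump_neq_zeroD[OF assms(3) this] have *: "\<bar>(H *\<^sub>R x j - c) $ i\<bar> < 1" for i .
    show "norm (x j - ?z) < ?r"
    proof (rule norm_less_of_components)
      fix i
      have "H * (x j - ?z) $ i = (H *\<^sub>R x j - c) $ i" using assms(1) by (simp add: right_diff_distrib)
      then have "H * \<bar>(x j - ?z) $ i\<bar> < 1" using *[of i] assms(1) by (metis abs_mult abs_of_pos)
      then show "\<bar>(x j - ?z) $ i\<bar> < 1 / H" using assms(1) by (simp add: field_simps)
    qed
  qed
  have "real (card {j\<in>{1..m}. bump q (H *\<^sub>R x j - c) \<noteq> 0}) / real m
      \<le> real (card {j\<in>{1..m}. norm (x j - ?z) < ?r}) / real m"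
    using sub by (intro divide_right_mono) (auto intro!: card_mono)
  also have "\<dots> \<le> max (1 / real m) (Cc * ?r ^ CARD('d))"
    using cover assms unfolding cover_condition_def by auto
  finally have "real (card {j\<in>{1..m}. bump q (H *\<^sub>R x j - c) \<noteq> 0})
      \<le> max (1 / real m) (Cc * ?r ^ CARD('d)) * real m"
    using m by (simp add: field_simps)
  also have "\<dots> \<le> (1 / real m + Cc * ?r ^ CARD('d)) * real m"
    using pos assms by (intro mult_right_mono) (auto simp: max_def)
  also have "\<dots> = 1 + real m * (Cc * ?r ^ CARD('d))" using m by (simp add: field_simps)
  also have "\<dots> \<le> 1 + N * (Cc * ?r ^ CARD('d))"
    using m_le_N pos assms by (intro add_left_mono mult_right_mono) auto
  finally show ?thesis by simp
qed

text \<open>One power of \<open>nmax\<close> counts the observations of a trajectory; the other two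
  come from squaring its duration, at most \<open>nmax * \<Delta>\<close>. The power of the
  dimension comes from the radius of the ball around a bump.\<close>

definition info_const :: "real \<Rightarrow> real" where
  "info_const C = Cn * real nmax ^ 3 * C\<^sup>2 * (1 + Cc * real CARD('d) ^ CARD('d))"

lemma info_bump_le:
  assumes S: "separated (insert c S)" "finite S" "c \<notin> S" and "q > 0"
    and sb: "smooth_bound (Suc k) C U (bumps q S)"
    and sb': "smooth_bound (Suc k) C U (bumps q (insert c S))"
    and a: "0 \<le> a" and H: "H \<ge> 1" and c: "(1 / H) *\<^sub>R c \<in> cbox 0 1"
  shows "info (bump_field i q a H (insert c S)) (bump_field i q a H S)
    \<le> info_const C * a\<^sup>2 * (\<Delta>\<^sup>2 + N * \<Delta>\<^sup>2 / H ^ CARD('d))"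
proof -
  let ?g = "bump_field i q a H (insert c S)" and ?f = "bump_field i q a H S"
  define J where "J = {j\<in>{1..m}. bump q (H *\<^sub>R x j - c) \<noteq> 0}"
  define M where "M = Cn * (a * C * (real nmax * \<Delta>))\<^sup>2"
  have C: "C \<ge> 0" using smooth_bound_nonneg[OF sb] .
  have M0: "M \<ge> 0" using pos by (simp add: M_def)
  have "info ?g ?f = (\<Sum>j=1..m. \<Sum>i=1..n j. Cn * (norm (ode_flow ?g (x j) (t j i) - ode_flow ?f (x j) (t j i)))\<^sup>2)"
    unfolding info_def obs_index_def by (subst sum.Sigma) auto
  also have "\<dots> \<le> (\<Sum>j=1..m. if j \<in> J then real nmax * M else 0)"
  proof (rule sum_mono)
    fix j assume j: "j \<in> {1..m}"
    have le: "Cn * (norm (ode_flow ?g (x j) (t j i) - ode_flow ?f (x j) (t j i)))\<^sup>2 \<le> (if j \<in> J then M else 0)"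
      if i: "i \<in> {1..n j}" for i
    proof -
      have t0: "0 \<le> t j i" and t1: "t j i \<le> real nmax * \<Delta>"
        using t[OF j, of i] i n[OF j] pos by (auto intro!: mult_right_mono)
      have d: "norm (ode_flow ?g (x j) (t j i) - ode_flow ?f (x j) (t j i)) \<le> (if j \<in> J then a * C * t j i else 0)"
        using H j by (intro order_trans[OF bump_flow_dist_le[OF S \<open>q > 0\<close> sb sb' a _ t0]]) (auto simp: J_def)
      have "(norm (ode_flow ?g (x j) (t j i) - ode_flow ?f (x j) (t j i)))\<^sup>2
          \<le> (if j \<in> J then a * C * (real nmax * \<Delta>) else 0)\<^sup>2"
        using t1 a C by (intro power_mono order_trans[OF d]) (auto intro!: mult_left_mono)
      then have "Cn * (norm (ode_flow ?g (x j) (t j i) - ode_flow ?f (x j) (t j i)))\<^sup>2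
          \<le> Cn * (if j \<in> J then a * C * (real nmax * \<Delta>) else 0)\<^sup>2"
        using pos by (intro mult_left_mono) auto
      then show ?thesis by (auto simp: M_def split: if_splits)
    qed
    have "(\<Sum>i=1..n j. Cn * (norm (ode_flow ?g (x j) (t j i) - ode_flow ?f (x j) (t j i)))\<^sup>2)
        \<le> (\<Sum>i=1..n j. if j \<in> J then M else 0)"
      by (rule sum_mono) (rule le)
    also have "\<dots> \<le> (if j \<in> J then real nmax * M else 0)"
      using n[OF j] M0 by (auto intro!: mult_right_mono)
    finally show "(\<Sum>i=1..n j. Cn * (norm (ode_flow ?g (x j) (t j i) - ode_flow ?f (x j) (t j i)))\<^sup>2)
        \<le> (if j \<in> J then real nmax * M else 0)" .
  qed
  also have "\<dots> = real (card J) * (real nmax * M)"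
  proof -
    have "{1..m} \<inter> {j. j \<in> J} = J" by (auto simp: J_def)
    then show ?thesis by (simp add: sum.If_cases)
  qed
  also have "\<dots> \<le> (1 + N * Cc * (real CARD('d) / H) ^ CARD('d)) * (real nmax * M)"
    unfolding J_def using card_bump_le[OF _ c \<open>q > 0\<close>] H M0 by (intro mult_right_mono) auto
  also have "\<dots> = Cn * real nmax ^ 3 * C\<^sup>2 * a\<^sup>2 *
      (\<Delta>\<^sup>2 + Cc * real CARD('d) ^ CARD('d) * (N * \<Delta>\<^sup>2 / H ^ CARD('d)))"
    by (simp add: M_def power_mult_distrib power_divide power3_eq_cube power2_eq_square algebra_simps)
  also have "\<dots> \<le> Cn * real nmax ^ 3 * C\<^sup>2 * a\<^sup>2 *
      ((1 + Cc * real CARD('d) ^ CARD('d)) * (\<Delta>\<^sup>2 + N * \<Delta>\<^sup>2 / H ^ CARD('d)))"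
  proof (rule mult_left_mono)
    define w where "w = N * \<Delta>\<^sup>2 / H ^ CARD('d)"
    define D where "D = Cc * real CARD('d) ^ CARD('d)"
    have "w \<ge> 0" "D \<ge> 0"
      using H pos by (auto simp: w_def D_def intro!: divide_nonneg_nonneg mult_nonneg_nonneg sum_nonneg)
    then have "0 \<le> D * \<Delta>\<^sup>2 + w" by simp
    then have "\<Delta>\<^sup>2 + D * w \<le> (1 + D) * (\<Delta>\<^sup>2 + w)" by (simp add: algebra_simps)
    then show "\<Delta>\<^sup>2 + Cc * real CARD('d) ^ CARD('d) * (N * \<Delta>\<^sup>2 / H ^ CARD('d))
      \<le> (1 + Cc * real CARD('d) ^ CARD('d)) * (\<Delta>\<^sup>2 + N * \<Delta>\<^sup>2 / H ^ CARD('d))"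
      by (simp only: w_def D_def)
  qed (use pos in simp)
  also have "\<dots> = info_const C * a\<^sup>2 * (\<Delta>\<^sup>2 + N * \<Delta>\<^sup>2 / H ^ CARD('d))"
    by (simp add: info_const_def)
  finally show ?thesis .
qed

end

section \<open>Risk bounds from testing\<close>

text \<open>The product of 1/4, from the threshold \<open>b\<^sup>2 / 4\<close>, of 3/4 = 1 - (1 +
  1) / 8, from the testing bound with information at most 1 and \<open>\<tau> = 8\<close>, and of
  \<open>exp (- 8)\<close>.\<close>

definition test_const :: real where
  "test_const = 3 / 16 * exp (- 8)"

lemma test_const_pos: "test_const > 0"
  by (simp add: test_const_def)

context design
begin

lemma nn_integral_compl_law:
  assumes A: "A \<in> sets (PiM I (\<lambda>_. borel))"
  shows "(\<integral>\<^sup>+y. ennreal r * indicator (space (law f) - A) y \<partial>law f) = ennreal (r * (1 - measure (law f) A))"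
proof -
  interpret prob_space "law f" by (rule prob_law)
  have A': "A \<in> sets (law f)" using A by simp
  show ?thesis
    unfolding nn_integral_cmult_indicator[OF sets.compl_sets[OF A']] emeasure_eq_measure prob_compl[OF A']
    by (rule ennreal_mult''[symmetric]) simp
qed

text \<open>Le Cam's two-point argument. \<open>A\<close> is the event that the estimate is within
  \<open>b / 2\<close> of \<open>f z\<close>; then it is at least \<open>b / 2\<close> away from
  \<open>g z\<close>. The testing bound prevents \<open>A\<close> from being likely under
  \<open>f\<close> and very unlikely under \<open>g\<close>.\<close>

lemma two_point_risk:
  assumes fh: "fh \<in> estimators I" and f: "f \<in> borel_measurable borel" and g: "g \<in> borel_measurable borel"
    and info: "info f g \<le> 1" and b: "0 \<le> b" "b \<le> norm (f z - g z)"
  shows "ennreal (test_const * b\<^sup>2) \<le> E f (sq_err fh f z) + E g (sq_err fh g z)"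
proof -
  interpret f: prob_space "law f" by (rule prob_law)
  interpret g: prob_space "law g" by (rule prob_law)
  note mf[measurable] = estimator_loss_measurable(2)[OF fh f, of z]
  note mg[measurable] = estimator_loss_measurable(2)[OF fh g, of z]
  define A where "A = {y \<in> space (PiM I (\<lambda>_. borel)). sq_err fh f z y < ennreal (b\<^sup>2 / 4)}"
  have A[measurable]: "A \<in> sets (PiM I (\<lambda>_. borel))" unfolding A_def by measurable
  have sp: "space (law h) = space (PiM I (\<lambda>_. borel))" for h
    using sets_eq_imp_space_eq[OF sets_obs_law] .
  have "(norm (fh y z - g z))\<^sup>2 \<ge> b\<^sup>2 / 4" if "y \<in> A" for y
  proof -
    have "(norm (fh y z - f z))\<^sup>2 < (b / 2)\<^sup>2"
      using that by (simp add: A_def ennreal_less_iff power_divide)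
    then have "norm (fh y z - f z) < b / 2"
      by (rule power_less_imp_less_base) (use b in simp)
    moreover have "norm (f z - g z) \<le> norm (fh y z - f z) + norm (fh y z - g z)"
      using norm_triangle_ineq4[of "fh y z - g z" "fh y z - f z"] by simp
    ultimately have "b / 2 \<le> norm (fh y z - g z)" using b by linarith
    then have "(b / 2)\<^sup>2 \<le> (norm (fh y z - g z))\<^sup>2" using b by (intro power_mono) auto
    then show ?thesis by (simp add: power_divide)
  qed
  then have "(\<integral>\<^sup>+y. ennreal (b\<^sup>2 / 4) * indicator A y \<partial>law g) \<le> E g (sq_err fh g z)"
    unfolding E_eq[OF mg]
    by (intro nn_integral_mono) (auto simp: indicator_def intro!: ennreal_leI)
  moreover have "(\<integral>\<^sup>+y. ennreal (b\<^sup>2 / 4) * indicator A y \<partial>law g) = ennreal (b\<^sup>2 / 4 * measure (law g) A)"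
    by (simp add: nn_integral_cmult_indicator g.emeasure_eq_measure ennreal_mult'[symmetric])
  ultimately have Eg: "ennreal (b\<^sup>2 / 4 * measure (law g) A) \<le> E g (sq_err fh g z)" by simp
  have "(\<integral>\<^sup>+y. ennreal (b\<^sup>2 / 4) * indicator (space (law f) - A) y \<partial>law f) \<le> E f (sq_err fh f z)"
    unfolding E_eq[OF mf]
    by (intro nn_integral_mono) (auto simp: A_def sp not_less indicator_def)
  moreover have "(\<integral>\<^sup>+y. ennreal (b\<^sup>2 / 4) * indicator (space (law f) - A) y \<partial>law f)
      = ennreal (b\<^sup>2 / 4 * (1 - measure (law f) A))"
    by (rule nn_integral_compl_law[OF A])
  ultimately have Ef: "ennreal (b\<^sup>2 / 4 * (1 - measure (law f) A)) \<le> E f (sq_err fh f z)" by simp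
  have "measure (law f) A \<le> (info f g + 1) / 8 + exp 8 * measure (law g) A"
    by (rule law_le_info[OF A]) simp
  moreover have "(info f g + 1) / 8 \<le> 1 / 4" using info by simp
  ultimately have "3 / 4 \<le> (1 - measure (law f) A) + exp 8 * measure (law g) A" by argo
  also have "\<dots> \<le> exp 8 * (1 - measure (law f) A) + exp 8 * measure (law g) A"
    using mult_right_mono[of 1 "exp 8" "1 - measure (law f) A"] by simp
  finally have "3 / 4 * exp (- 8) \<le> (1 - measure (law f) A) + measure (law g) A"
    by (simp add: exp_minus field_simps)
  then have "b\<^sup>2 / 4 * (3 / 4 * exp (- 8)) \<le> b\<^sup>2 / 4 * ((1 - measure (law f) A) + measure (law g) A)"
    by (intro mult_left_mono) auto
  then have "test_const * b\<^sup>2 \<le> b\<^sup>2 / 4 * (1 - measure (law f) A) + b\<^sup>2 / 4 * measure (law g) A"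
    by (simp add: test_const_def algebra_simps)
  then have "ennreal (test_const * b\<^sup>2)
      \<le> ennreal (b\<^sup>2 / 4 * (1 - measure (law f) A) + b\<^sup>2 / 4 * measure (law g) A)"
    by (rule ennreal_leI)
  also have "\<dots> = ennreal (b\<^sup>2 / 4 * (1 - measure (law f) A)) + ennreal (b\<^sup>2 / 4 * measure (law g) A)"
    by (rule ennreal_plus) (auto intro!: mult_nonneg_nonneg)
  also have "\<dots> \<le> E f (sq_err fh f z) + E g (sq_err fh g z)" by (intro add_mono Ef Eg)
  finally show ?thesis .
qed

text \<open>The events \<open>A c\<close>, that the estimate is close to \<open>f c\<close> at all
  test points, are disjoint: being close to both \<open>f c\<close> and \<open>f c'\<close> is
  impossible at \<open>p c\<close>. One of them has probability at most \<open>1 / card S\<close>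
  under the reference \<open>g\<close>, and the testing bound keeps its probability under
  \<open>f c\<close> at most 1/2.\<close>

lemma many_point_risk:
  assumes fh: "fh \<in> estimators I" and fm: "\<And>c. c \<in> S \<Longrightarrow> f c \<in> borel_measurable borel"
    and S: "finite S" "S \<noteq> {}" and cube: "\<And>c. c \<in> S \<Longrightarrow> p c \<in> cbox 0 1"
    and info: "\<And>c. c \<in> S \<Longrightarrow> info (f c) g \<le> K" and a: "0 \<le> a"
    and f: "\<And>c c'. c \<in> S \<Longrightarrow> c' \<in> S \<Longrightarrow> c \<noteq> c' \<Longrightarrow> a \<le> norm (f c (p c) - f c' (p c))"
    and tau: "\<tau> > 0" "(K + 1) / \<tau> + exp \<tau> / real (card S) \<le> 1 / 2"
  shows "\<exists>c\<in>S. ennreal (a\<^sup>2 / 8) \<le> E (f c) (\<lambda>y. SUP z\<in>cbox 0 1. sq_err fh (f c) z y)"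
proof -
  interpret g: prob_space "law g" by (rule prob_law)
  \<comment> \<open>Closeness is tested at the finitely many points \<open>p c'\<close> in place of
    the whole cube, so the event is measurable.\<close>
  define A where "A c = {y \<in> space (PiM I (\<lambda>_. borel)). \<forall>c'\<in>S. sq_err fh (f c) (p c') y < ennreal (a\<^sup>2 / 4)}" for c
  have A[measurable]: "A c \<in> sets (PiM I (\<lambda>_. borel))" if "c \<in> S" for c
  proof -
    have [measurable]: "(\<lambda>y. sq_err fh (f c) z y) \<in> borel_measurable (PiM I (\<lambda>_. borel))" for z
      using estimator_loss_measurable(2)[OF fh fm[OF that]] .
    show ?thesis unfolding A_def using S by measurable
  qed
  have disj: "disjoint_family_on A S"
    unfolding disjoint_family_on_def
  proof (intro ballI impI equals0I)
    fix c c' y assume c: "c \<in> S" "c' \<in> S" "c \<noteq> c'" and y: "y \<in> A c \<inter> A c'"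
    have "(norm (fh y (p c) - f b (p c)))\<^sup>2 < (a / 2)\<^sup>2" if "b \<in> {c, c'}" for b
      using y that c by (auto simp: A_def ennreal_less_iff power_divide)
    then have "norm (fh y (p c) - f b (p c)) < a / 2" if "b \<in> {c, c'}" for b
      by (rule power_less_imp_less_base[OF _ divide_nonneg_pos[OF a]]) (use that in auto)
    from this[of c] this[of c'] have "norm (f c (p c) - f c' (p c)) < a"
      using norm_triangle_ineq4[of "fh y (p c) - f c' (p c)" "fh y (p c) - f c (p c)"] by simp
    with f[OF c] show False by simp
  qed
  have "(\<Sum>c\<in>S. measure (law g) (A c)) = measure (law g) (\<Union>c\<in>S. A c)"
    using A disj S by (intro g.finite_measure_finite_Union[symmetric]) auto
  also have "\<dots> \<le> 1" by simp
  finally have sum1: "(\<Sum>c\<in>S. measure (law g) (A c)) \<le> 1" .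
  have "\<exists>c\<in>S. measure (law g) (A c) \<le> 1 / real (card S)"
  proof (rule ccontr)
    assume "\<not> ?thesis"
    then have "(\<Sum>c\<in>S. 1 / real (card S)) < (\<Sum>c\<in>S. measure (law g) (A c))"
      using S by (intro sum_strict_mono) auto
    with sum1 S show False by simp
  qed
  then obtain c where c: "c \<in> S" "measure (law g) (A c) \<le> 1 / real (card S)" by blast
  interpret f: prob_space "law (f c)" by (rule prob_law)
  have sp: "space (law (f c)) = space (PiM I (\<lambda>_. borel))"
    using sets_eq_imp_space_eq[OF sets_obs_law] .
  have "measure (law (f c)) (A c) \<le> (info (f c) g + 1) / \<tau> + exp \<tau> * measure (law g) (A c)"
    by (rule law_le_info[OF A tau(1)]) (rule c)
  also have "\<dots> \<le> (K + 1) / \<tau> + exp \<tau> * (1 / real (card S))"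
    using info[OF c(1)] c(2) tau(1) by (intro add_mono divide_right_mono mult_left_mono) auto
  also have "\<dots> \<le> 1 / 2" using tau(2) by simp
  finally have half: "measure (law (f c)) (A c) \<le> 1 / 2" .
  have "ennreal (a\<^sup>2 / 8) \<le> ennreal (a\<^sup>2 / 4 * (1 - measure (law (f c)) (A c)))"
    using mult_left_mono[of "1 / 2" "1 - measure (law (f c)) (A c)" "a\<^sup>2 / 4"] half
    by (intro ennreal_leI) simp
  also have "\<dots> = (\<integral>\<^sup>+y. ennreal (a\<^sup>2 / 4) * indicator (space (law (f c)) - A c) y \<partial>law (f c))"
    by (rule nn_integral_compl_law[OF A[OF c(1)], symmetric])
  also have "\<dots> = E (f c) (\<lambda>y. ennreal (a\<^sup>2 / 4) * indicator (space (law (f c)) - A c) y)"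
    unfolding sp
    by (intro E_eq[symmetric] borel_measurable_times_ennreal borel_measurable_const
        borel_measurable_indicator sets.compl_sets A c(1))
  also have "\<dots> \<le> E (f c) (\<lambda>y. SUP z\<in>cbox 0 1. sq_err fh (f c) z y)"
  proof (rule obs_expectation_mono)
    fix y
    show "ennreal (a\<^sup>2 / 4) * indicator (space (law (f c)) - A c) y \<le> (SUP z\<in>cbox 0 1. sq_err fh (f c) z y)"
    proof (cases "y \<in> space (law (f c)) - A c")
      case True
      then obtain c' where c': "c' \<in> S" "ennreal (a\<^sup>2 / 4) \<le> sq_err fh (f c) (p c') y"
        by (auto simp: A_def sp not_less)
      note c'(2)
      also have "sq_err fh (f c) (p c') y \<le> (SUP z\<in>cbox 0 1. sq_err fh (f c) z y)"
        by (rule SUP_upper[OF cube[OF c'(1)]])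
      finally show ?thesis using True by simp
    qed simp
  qed
  finally show ?thesis using c(1) by blast
qed

lemma sum_Pow_split:
  fixes r :: "'b set \<Rightarrow> ennreal"
  assumes "finite S" "c \<in> S"
  shows "(\<Sum>A\<in>Pow S. r A) = (\<Sum>A\<in>Pow (S - {c}). r (insert c A) + r A)"
proof -
  have S: "insert c (S - {c}) = S" using assms by auto
  have "(\<Sum>A\<in>Pow (insert c (S - {c})). r A) = (\<Sum>A\<in>Pow (S - {c}). r A) + (\<Sum>A\<in>insert c ` Pow (S - {c}). r A)"
    unfolding Pow_insert using assms by (intro sum.union_disjoint) auto
  also have "(\<Sum>A\<in>insert c ` Pow (S - {c}). r A) = (\<Sum>A\<in>Pow (S - {c}). r (insert c A))"
    by (subst sum.reindex) (auto simp: inj_on_def o_def insert_ident)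
  finally show ?thesis unfolding S by (simp add: sum.distrib add.commute)
qed

text \<open>Assouad's argument: the risk averaged over all subsets is bounded cell by cell.\<close>

lemma assouad_risk:
  fixes f :: "'c set \<Rightarrow> real^'d \<Rightarrow> real^'d"
  assumes fh: "fh \<in> estimators I" and fm: "\<And>A. A \<subseteq> S \<Longrightarrow> f A \<in> borel_measurable borel"
    and S: "finite S" and FS: "\<And>A. A \<subseteq> S \<Longrightarrow> f A \<in> F"
    and B: "\<And>c. c \<in> S \<Longrightarrow> B c \<in> sets borel" "\<And>c. c \<in> S \<Longrightarrow> B c \<subseteq> cbox 0 1" "disjoint_family_on B S"
      "\<And>c. c \<in> S \<Longrightarrow> emeasure lborel (B c) = ennreal w" "w \<ge> 0"
    and info: "\<And>A c. c \<in> S \<Longrightarrow> A \<subseteq> S - {c} \<Longrightarrow> info (f (insert c A)) (f A) \<le> 1"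
    and b: "0 \<le> b" "\<And>A c z. c \<in> S \<Longrightarrow> A \<subseteq> S - {c} \<Longrightarrow> z \<in> B c \<Longrightarrow> b \<le> norm (f (insert c A) z - f A z)"
  shows "ennreal (test_const * b\<^sup>2 * w * real (card S) / 2) \<le> (SUP g\<in>F. E g (int_sq_err fh g))"
proof (cases "S = {}")
  case True then show ?thesis by simp
next
  case False
  define M where "M = card S"
  have M: "M \<ge> 1" using False S by (simp add: M_def Suc_le_eq card_gt_0_iff)
  let ?U = "SUP g\<in>F. E g (int_sq_err fh g)"
  let ?r = "\<lambda>A z. E (f A) (sq_err fh (f A) z)"
  note meas = estimator_loss_measurable[OF fh fm]
  \<comment> \<open>The two-point bound applies at a fixed point \<open>z\<close>, so expectation
    and spatial integral are exchanged before the subsets are paired.\<close>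
  have swap: "E (f A) (int_sq_err fh (f A)) = (\<integral>\<^sup>+z\<in>cbox 0 1. ?r A z \<partial>lborel)"
    and rm: "?r A \<in> borel_measurable borel" if A: "A \<subseteq> S" for A
  proof -
    interpret law: prob_space "law (f A)" by (rule prob_law)
    interpret pair_sigma_finite "law (f A)" "lborel :: (real^'d) measure" ..
    have [measurable]: "(\<lambda>(y, z). sq_err fh (f A) z y) \<in> borel_measurable (law (f A) \<Otimes>\<^sub>M lborel)"
      using meas(1)[OF A] by (simp cong: measurable_cong_sets sets_pair_measure_cong)
    have E: "?r A z = (\<integral>\<^sup>+y. sq_err fh (f A) z y \<partial>law (f A))" for z
      by (rule E_eq[OF meas(2)[OF A]])
    show "?r A \<in> borel_measurable borel"
    proof -
      have "(\<lambda>z. \<integral>\<^sup>+y. sq_err fh (f A) z y \<partial>law (f A)) \<in> borel_measurable lborel"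
        by (rule law.borel_measurable_nn_integral) measurable
      then show ?thesis by (simp add: E)
    qed
    have "E (f A) (int_sq_err fh (f A)) = (\<integral>\<^sup>+y. (\<integral>\<^sup>+z. sq_err fh (f A) z y * indicator (cbox 0 1) z \<partial>lborel) \<partial>law (f A))"
      by (rule E_eq[OF meas(3)[OF A]])
    also have "\<dots> = (\<integral>\<^sup>+z. (\<integral>\<^sup>+y. sq_err fh (f A) z y * indicator (cbox 0 1) z \<partial>law (f A)) \<partial>lborel)"
      by (rule Fubini'[symmetric]) measurable
    also have "\<dots> = (\<integral>\<^sup>+z\<in>cbox 0 1. ?r A z \<partial>lborel)"
      unfolding E using measurable_compose[OF measurable_Pair2' meas(1)[OF A]]
      by (intro nn_integral_cong nn_integral_multc) (simp add: meas(2)[OF A] cong: measurable_cong_sets)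
    finally show "E (f A) (int_sq_err fh (f A)) = (\<integral>\<^sup>+z\<in>cbox 0 1. ?r A z \<partial>lborel)" .
  qed
  \<comment> \<open>At a point of the cell of \<open>c\<close> the \<open>2 ^ M\<close> subsets form
    \<open>2 ^ (M - 1)\<close> pairs that differ only in \<open>c\<close>; dividing by
    \<open>2 ^ M\<close> later leaves the factor 1/2.\<close>
  define \<rho> where "\<rho> = 2 ^ (M - 1) * (test_const * b\<^sup>2)"
  have \<rho>: "\<rho> \<ge> 0" using test_const_pos by (simp add: \<rho>_def)
  have ptw: "ennreal \<rho> \<le> (\<Sum>A\<in>Pow S. ?r A z)" if c: "c \<in> S" and z: "z \<in> B c" for c z
  proof -
    have "ennreal \<rho> = (\<Sum>A\<in>Pow (S - {c}). ennreal (test_const * b\<^sup>2))"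
      using S c test_const_pos
      by (simp add: \<rho>_def card_Pow M_def ennreal_mult ennreal_power ennreal_of_nat_eq_real_of_nat)
    also have "\<dots> \<le> (\<Sum>A\<in>Pow (S - {c}). ?r (insert c A) z + ?r A z)"
    proof (rule sum_mono)
      fix A assume "A \<in> Pow (S - {c})"
      then have A: "A \<subseteq> S - {c}" "A \<subseteq> S" "insert c A \<subseteq> S" using c by auto
      show "ennreal (test_const * b\<^sup>2) \<le> ?r (insert c A) z + ?r A z"
        by (rule two_point_risk[OF fh fm[OF A(3)] fm[OF A(2)] info[OF c A(1)] b(1) b(2)[OF c A(1) z]])
    qed
    also have "\<dots> = (\<Sum>A\<in>Pow S. ?r A z)" by (rule sum_Pow_split[OF S c, symmetric])
    finally show ?thesis .
  qed
  have "ennreal (\<rho> * (w * real M)) = ennreal \<rho> * (\<Sum>c\<in>S. emeasure lborel (B c))"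
    using \<rho> B(4,5) by (simp add: M_def ennreal_mult ennreal_of_nat_eq_real_of_nat mult.commute)
  also have "(\<Sum>c\<in>S. emeasure lborel (B c)) = emeasure lborel (\<Union>c\<in>S. B c)"
    using B(1,3) S by (intro sum_emeasure) auto
  also have "ennreal \<rho> * emeasure lborel (\<Union>c\<in>S. B c) = (\<integral>\<^sup>+z. ennreal \<rho> * indicator (\<Union>c\<in>S. B c) z \<partial>lborel)"
    using B(1) S by (intro nn_integral_cmult_indicator[symmetric]) auto
  also have "\<dots> \<le> (\<integral>\<^sup>+z. (\<Sum>A\<in>Pow S. ?r A z) * indicator (cbox 0 1) z \<partial>lborel)"
    using B(2) ptw by (intro nn_integral_mono) (auto simp: indicator_def)
  also have "\<dots> = (\<Sum>A\<in>Pow S. \<integral>\<^sup>+z\<in>cbox 0 1. ?r A z \<partial>lborel)"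
  proof (subst sum_distrib_right, rule nn_integral_sum)
    fix A assume "A \<in> Pow S"
    then have [measurable]: "?r A \<in> borel_measurable borel" using rm by auto
    show "(\<lambda>z. ?r A z * indicator (cbox 0 1) z) \<in> borel_measurable lborel" by measurable
  qed
  also have "\<dots> = (\<Sum>A\<in>Pow S. E (f A) (int_sq_err fh (f A)))"
    by (intro sum.cong refl swap[symmetric]) auto
  also have "\<dots> \<le> (\<Sum>A\<in>Pow S. ?U)"
    by (intro sum_mono SUP_upper FS) auto
  also have "\<dots> = ennreal (2 ^ M) * ?U"
    using S by (simp add: card_Pow M_def ennreal_power[symmetric])
  finally have "ennreal (\<rho> * (w * real M)) \<le> ennreal (2 ^ M) * ?U" .
  moreover have "\<rho> * (w * real M) = 2 ^ M * (test_const * b\<^sup>2 * w * real M / 2)"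
  proof -
    have "(2::real) ^ M = 2 * 2 ^ (M - 1)" using M power_Suc[of "2::real" "M - 1"] by simp
    then show ?thesis unfolding \<rho>_def by simp
  qed
  ultimately have "ennreal (2 ^ M * (test_const * b\<^sup>2 * w * real M / 2)) \<le> ennreal (2 ^ M) * ?U"
    by metis
  then have "ennreal (test_const * b\<^sup>2 * w * real M / 2) \<le> ?U"
    by (rule ennreal_le_of_numeral_mult) simp
  then show ?thesis by (simp only: M_def)
qed

end

section \<open>Bumps on a grid\<close>

text \<open>Odd coordinates are the midpoints of the cubes of side 2 that tile the cube of side
  \<open>2 * q\<close>. Dividing by \<open>H = 2 * q\<close> gives the centres of the
  \<open>q ^ d\<close> grid cells of the unit cube.\<close>

definition lattice_points :: "nat \<Rightarrow> (real^'d) set" where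
  "lattice_points q = (\<lambda>g. \<chi> i. 2 * real (g i) + 1) ` PiE UNIV (\<lambda>_. {..<q})"

lemma lattice_pointsE:
  assumes "c \<in> lattice_points q"
  obtains g where "\<And>i. g i < q" "\<And>i. c $ i = 2 * real (g i) + 1"
proof -
  obtain g where "g \<in> PiE UNIV (\<lambda>_. {..<q})" "c = (\<chi> i. 2 * real (g i) + 1)"
    using assms unfolding lattice_points_def by blast
  then show ?thesis by (intro that[of g]) auto
qed

lemma finite_lattice_points: "finite (lattice_points q)"
  by (auto simp: lattice_points_def intro!: finite_imageI finite_PiE)

lemma card_lattice_points: "card (lattice_points q :: (real^'d) set) = q ^ CARD('d)"
proof -
  have "inj (\<lambda>g::'d \<Rightarrow> nat. \<chi> i. 2 * real (g i) + 1)" by (auto simp: inj_def vec_eq_iff)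
  then have "card (lattice_points q :: (real^'d) set) = card (PiE (UNIV::'d set) (\<lambda>_. {..<q}))"
    unfolding lattice_points_def by (intro card_image) (auto intro: inj_on_subset)
  then show ?thesis by (simp add: card_PiE)
qed

lemma separated_lattice_points: "separated (lattice_points q)"
  unfolding separated_def
proof (intro ballI impI)
  fix c c' :: "real^'d" assume "c \<in> lattice_points q" "c' \<in> lattice_points q" "c \<noteq> c'"
  then obtain g g' where g: "\<And>i. c $ i = 2 * real (g i) + 1" "\<And>i. c' $ i = 2 * real (g' i) + 1"
    by (metis lattice_pointsE)
  obtain i where i: "c $ i \<noteq> c' $ i" using \<open>c \<noteq> c'\<close> by (auto simp: vec_eq_iff)
  then have "g i \<noteq> g' i" by (auto simp: g)
  then have "1 \<le> \<bar>real (g i) - real (g' i)\<bar>" by linarith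
  then have "2 \<le> \<bar>c $ i - c' $ i\<bar>" unfolding g by linarith
  then show "\<exists>i. 2 \<le> \<bar>c $ i - c' $ i\<bar>" by blast
qed

lemma in_unit_cube: "(z::real^'d) \<in> cbox 0 1 \<longleftrightarrow> (\<forall>i. 0 \<le> z $ i \<and> z $ i \<le> 1)"
  by (simp add: mem_box_cart)

lemma lattice_points_scaled_in_cube:
  assumes "c \<in> lattice_points q" shows "(1 / (2 * real q)) *\<^sub>R c \<in> cbox 0 1"
proof -
  obtain g where g: "\<And>i. g i < q" "\<And>i. c $ i = 2 * real (g i) + 1"
    using lattice_pointsE[OF assms] by blast
  have "0 \<le> c $ i \<and> c $ i \<le> 2 * real q" for i using g[of i] by (auto simp flip: of_nat_Suc)
  moreover have "q > 0" using g(1) by (metis gr_zeroI not_less0)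
  ultimately show ?thesis by (auto simp: in_unit_cube field_simps)
qed

text \<open>The concentric cube of half the side of a grid cell: the points whose rescaled
  coordinates are within 1/2 of \<open>c\<close>, where \<open>bump_ge\<close> applies.\<close>

definition cell :: "nat \<Rightarrow> real^'d \<Rightarrow> (real^'d) set" where
  "cell q c = cbox ((1 / (2 * real q)) *\<^sub>R (c - (\<chi> i. 1 / 2))) ((1 / (2 * real q)) *\<^sub>R (c + (\<chi> i. 1 / 2)))"

lemma mem_cell:
  assumes "q > 0"
  shows "z \<in> cell q c \<longleftrightarrow> (\<forall>i. \<bar>(((2 * real q) *\<^sub>R z) - c) $ i\<bar> \<le> 1 / 2)"
proof -
  have "(1 / (2 * real q)) * (u - 1 / 2) \<le> v \<longleftrightarrow> u - 1 / 2 \<le> 2 * real q * v"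
    "v \<le> (1 / (2 * real q)) * (u + 1 / 2) \<longleftrightarrow> 2 * real q * v \<le> u + 1 / 2" for u v :: real
    using assms by (simp_all add: field_simps)
  moreover have "u - 1 / 2 \<le> w \<and> w \<le> u + 1 / 2 \<longleftrightarrow> \<bar>w - u\<bar> \<le> 1 / 2" for u w :: real by linarith
  ultimately show ?thesis by (simp add: cell_def mem_box_cart)
qed

lemma emeasure_cell:
  fixes c :: "real^'d"
  assumes "q > 0"
  shows "emeasure lborel (cell q c) = ennreal ((1 / (2 * real q)) ^ CARD('d))"
proof -
  let ?a = "(1 / (2 * real q)) *\<^sub>R (c - (\<chi> i. 1 / 2))" and ?b = "(1 / (2 * real q)) *\<^sub>R (c + (\<chi> i. 1 / 2))"
  have d: "(?b - ?a) \<bullet> e = 1 / (2 * real q)" if "e \<in> Basis" for e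
    using that assms by (auto simp: Basis_vec_def inner_axis field_simps)
  have "?a \<bullet> e \<le> ?b \<bullet> e" if "e \<in> Basis" for e
  proof -
    have "?b \<bullet> e - ?a \<bullet> e = 1 / (2 * real q)" using d[OF that] by (simp only: inner_diff_left)
    moreover have "0 \<le> 1 / (2 * real q)" by simp
    ultimately show ?thesis by linarith
  qed
  then have "emeasure lborel (cell q c) = (\<Prod>e\<in>Basis. (?b - ?a) \<bullet> e)"
    unfolding cell_def by (intro emeasure_lborel_cbox)
  also have "(\<Prod>e\<in>Basis. (?b - ?a) \<bullet> e) = (\<Prod>e\<in>(Basis::(real^'d) set). 1 / (2 * real q))"
    by (rule prod.cong[OF refl d])
  finally show ?thesis by simp
qed

lemma cell_subset_cube:
  assumes "c \<in> lattice_points q" "q > 0" shows "cell q c \<subseteq> cbox 0 1"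
proof
  fix z assume z: "z \<in> cell q c"
  obtain g where g: "\<And>i. g i < q" "\<And>i. c $ i = 2 * real (g i) + 1"
    using lattice_pointsE[OF assms(1)] by blast
  have "0 \<le> z $ i \<and> z $ i \<le> 1" for i
  proof -
    have "\<bar>2 * real q * z $ i - c $ i\<bar> \<le> 1 / 2" using z assms by (simp add: mem_cell)
    moreover have "1 \<le> c $ i" "c $ i \<le> 2 * real q - 1" using g[of i] by linarith+
    ultimately have "0 \<le> 2 * real q * z $ i" "2 * real q * z $ i \<le> 2 * real q" by linarith+
    then show ?thesis using assms by (auto simp: zero_le_mult_iff)
  qed
  then show "z \<in> cbox 0 1" by (simp add: in_unit_cube)
qed

lemma disjoint_cells:
  assumes "q > 0" shows "disjoint_family_on (cell q) (lattice_points q)"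
  unfolding disjoint_family_on_def
proof (intro ballI impI equals0I)
  fix c c' z :: "real^'d"
  assume "c \<in> lattice_points q" "c' \<in> lattice_points q" "c \<noteq> c'" and z: "z \<in> cell q c \<inter> cell q c'"
  then obtain i where i: "2 \<le> \<bar>c $ i - c' $ i\<bar>"
    using separated_lattice_points unfolding separated_def by blast
  have "\<bar>2 * real q * z $ i - c $ i\<bar> \<le> 1 / 2" "\<bar>2 * real q * z $ i - c' $ i\<bar> \<le> 1 / 2"
    using z assms by (auto simp: mem_cell)
  with i show False by linarith
qed

section \<open>Bump fields of critical amplitude and their risks\<close>

locale bump_design = design P m n x t \<Delta> Cn Cc nmax
  for P :: "(real^'d) measure" and m n x t \<Delta> Cn Cc nmax +
  fixes l :: nat and \<beta> :: real and L :: "nat \<Rightarrow> real" and L\<beta> C c0 :: real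
  assumes \<beta>: "real l < \<beta>" "\<beta> \<le> real l + 1"
    and L: "\<And>k. k \<le> l \<Longrightarrow> c0 * C \<le> L k / 2" "2 * c0 * C \<le> L\<beta>" "L 0 > 0"
    and c0: "c0 > 0"
    and bumps: "\<And>S::(real^'d) set. finite S \<Longrightarrow> separated S \<Longrightarrow> smooth_bound (Suc l) C UNIV (bumps (Suc l + 2) S)"
    and \<Delta>_le: "\<Delta> \<le> 1"
begin

abbreviation "F \<equiv> (hoelder_class l \<beta> L L\<beta> :: (real^'d \<Rightarrow> real^'d) set)"
abbreviation "R \<equiv> N * \<Delta>\<^sup>2"
abbreviation "amp H \<equiv> c0 * H powr (- \<beta>)"

text \<open>The exponent \<open>Suc l + 2\<close> buys \<open>Suc l\<close> bounded derivatives, so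
  that the one of order \<open>l\<close> is Lipschitz. \<open>undefined\<close> is an arbitrary
  fixed coordinate direction. The factor \<open>c0\<close> stays a parameter of the locale because
  the rates ask for different degrees of smallness.\<close>

definition fld :: "real \<Rightarrow> (real^'d) set \<Rightarrow> real^'d \<Rightarrow> real^'d" where
  "fld H S = bump_field undefined (Suc l + 2) (amp H) H S"

lemma amp_nonneg: "amp H \<ge> 0" using c0 by simp

lemma fld_in_F: "H \<ge> 1 \<Longrightarrow> finite S \<Longrightarrow> separated S \<Longrightarrow> fld H S \<in> F"
  using hoelder_class_scaled[OF bumps \<beta> _ amp_nonneg order_refl, of S H 0 L L\<beta> undefined] L
  by (simp add: fld_def bump_field_def[abs_def])

lemma fld_measurable: "H \<ge> 1 \<Longrightarrow> finite S \<Longrightarrow> separated S \<Longrightarrow> fld H S \<in> borel_measurable borel"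
  unfolding fld_def by (rule bump_field_measurable[OF bumps amp_nonneg]) auto

text \<open>The squared amplitude contributes \<open>H powr (- 2 * \<beta>)\<close> and (Cover)
  another \<open>H powr (- d)\<close>. The term without \<open>R\<close> is merely bounded by 1,
  using \<open>H \<ge> 1\<close> and \<open>\<Delta> \<le> 1\<close>.\<close>

lemma info_fld_le:
  assumes S: "separated (insert c S)" "finite S" "c \<notin> S" and H: "H \<ge> 1" and c: "(1 / H) *\<^sub>R c \<in> cbox 0 1"
  shows "info (fld H (insert c S)) (fld H S) \<le> info_const C * c0\<^sup>2 * (1 + R * H powr (- (2 * \<beta> + real CARD('d))))"
proof -
  have sep: "separated S" using S(1) by (rule separated_subset) auto
  have "info (fld H (insert c S)) (fld H S) \<le> info_const C * (amp H)\<^sup>2 * (\<Delta>\<^sup>2 + R / H ^ CARD('d))"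
    unfolding fld_def
    by (rule info_bump_le[OF S _ bumps[OF S(2) sep] bumps[OF _ S(1)] amp_nonneg H c]) (use S in auto)
  also have "\<dots> = info_const C * c0\<^sup>2 * ((H powr (- \<beta>))\<^sup>2 * \<Delta>\<^sup>2 + R * ((H powr (- \<beta>))\<^sup>2 / H ^ CARD('d)))"
    by (simp add: power_mult_distrib algebra_simps)
  also have "(H powr (- \<beta>))\<^sup>2 / H ^ CARD('d) = H powr (- (2 * \<beta> + real CARD('d)))"
  proof -
    have "(H powr (- \<beta>))\<^sup>2 / H ^ CARD('d) = H powr (- \<beta> + - \<beta> - real CARD('d))"
      using H by (simp only: powr_diff powr_add power2_eq_square) (simp add: powr_realpow)
    also have "- \<beta> + - \<beta> - real CARD('d) = - (2 * \<beta> + real CARD('d))" by simp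
    finally show ?thesis .
  qed
  also have "info_const C * c0\<^sup>2 * ((H powr (- \<beta>))\<^sup>2 * \<Delta>\<^sup>2 + R * H powr (- (2 * \<beta> + real CARD('d))))
      \<le> info_const C * c0\<^sup>2 * (1 + R * H powr (- (2 * \<beta> + real CARD('d))))"
  proof (intro mult_left_mono add_right_mono)
    have "H powr (- \<beta>) \<le> 1" using H \<beta> powr_mono[of "- \<beta>" 0 H] by simp
    then have "(H powr (- \<beta>))\<^sup>2 \<le> 1" by (simp add: power_le_one)
    moreover have "\<Delta>\<^sup>2 \<le> 1" using \<Delta>_le pos by (simp add: power_le_one)
    ultimately show "(H powr (- \<beta>))\<^sup>2 * \<Delta>\<^sup>2 \<le> 1" by (simp add: mult_le_one)
    show "0 \<le> info_const C * c0\<^sup>2"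
      using pos by (auto simp: info_const_def intro!: mult_nonneg_nonneg add_nonneg_nonneg)
  qed
  finally show ?thesis .
qed

lemma fld_diff:
  assumes "finite S" "c \<notin> S"
  shows "norm (fld H (insert c S) z - fld H S z) = amp H * bump (Suc l + 2) (H *\<^sub>R z - c)"
  using c0 bump_nonneg[of "Suc l + 2" "H *\<^sub>R z - c"]
  by (simp add: fld_def bump_field_insert[OF assms] abs_mult)

lemma separated_singleton: "separated {c}" by (simp add: separated_def)

lemma separated_empty: "separated {}" by (simp add: separated_def)

lemma info_le_1:
  assumes "info_const C * c0\<^sup>2 \<le> 1 / 2" "R * H powr (- (2 * \<beta> + real CARD('d))) \<le> 1"
    and "separated (insert c S)" "finite S" "c \<notin> S" "H \<ge> 1" "(1 / H) *\<^sub>R c \<in> cbox 0 1"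
  shows "info (fld H (insert c S)) (fld H S) \<le> 1"
proof -
  have "0 \<le> R * H powr (- (2 * \<beta> + real CARD('d)))" by (intro mult_nonneg_nonneg) (auto intro: sum_nonneg)
  then have "info_const C * c0\<^sup>2 * (1 + R * H powr (- (2 * \<beta> + real CARD('d)))) \<le> 1 / 2 * 2"
    using assms(1,2) by (intro mult_mono) auto
  then show ?thesis using info_fld_le[OF assms(3-7)] by simp
qed

lemma pointwise_risk:
  assumes fh: "fh \<in> estimators I" and x0: "x0 \<in> cbox 0 1" and H: "H \<ge> 1"
    and small: "info_const C * c0\<^sup>2 \<le> 1 / 2" "R * H powr (- (2 * \<beta> + real CARD('d))) \<le> 1"
  shows "ennreal (test_const * (amp H)\<^sup>2 / 2) \<le> (SUP f\<in>F. E f (sq_err fh f x0))"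
proof -
  \<comment> \<open>The single bump is centred at \<open>x0\<close> itself and not at a grid point,
    so it attains its maximum 1 there; the alternative is the zero field.\<close>
  let ?c = "H *\<^sub>R x0" and ?U = "SUP f\<in>F. E f (sq_err fh f x0)"
  have "info (fld H {?c}) (fld H {}) \<le> 1"
    by (rule info_le_1[OF small]) (use H x0 separated_singleton in auto)
  moreover have "amp H \<le> norm (fld H {?c} x0 - fld H {} x0)"
    using fld_diff[of "{}" ?c H x0] by simp
  ultimately have "ennreal (test_const * (amp H)\<^sup>2)
      \<le> E (fld H {?c}) (sq_err fh (fld H {?c}) x0) + E (fld H {}) (sq_err fh (fld H {}) x0)"
    using H amp_nonneg
    by (intro two_point_risk[OF fh] fld_measurable separated_singleton separated_empty) auto
  also have "\<dots> \<le> ?U + ?U"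
    using H by (intro add_mono SUP_upper fld_in_F separated_singleton separated_empty) auto
  also have "\<dots> = ennreal 2 * ?U" by (simp add: mult_2)
  finally have le: "ennreal (test_const * (amp H)\<^sup>2) \<le> ennreal 2 * ?U" .
  have eq: "2 * (test_const * (amp H)\<^sup>2 / 2) = test_const * (amp H)\<^sup>2" by simp
  show ?thesis
    by (rule ennreal_le_of_numeral_mult[of 2], unfold eq) (rule le, simp)
qed

lemma uniform_risk:
  assumes fh: "fh \<in> estimators I" and q: "q \<ge> 1"
    and tau: "\<tau> > 0" "(info_const C * c0\<^sup>2 * (1 + R * (2 * real q) powr (- (2 * \<beta> + real CARD('d)))) + 1) / \<tau>
      + exp \<tau> / real q ^ CARD('d) \<le> 1 / 2"
  shows "ennreal ((amp (2 * real q))\<^sup>2 / 8) \<le> (SUP f\<in>F. E f (\<lambda>y. SUP z\<in>cbox 0 1. sq_err fh f z y))"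
proof -
  let ?H = "2 * real q" and ?S = "lattice_points q :: (real^'d) set"
  have H: "?H \<ge> 1" using q by simp
  have "\<exists>c\<in>?S. ennreal ((amp ?H)\<^sup>2 / 8) \<le> E (fld ?H {c}) (\<lambda>y. SUP z\<in>cbox 0 1. sq_err fh (fld ?H {c}) z y)"
  proof (rule many_point_risk[where g = "fld ?H {}" and p = "\<lambda>c. (1 / ?H) *\<^sub>R c", OF fh _ finite_lattice_points])
    show "fld ?H {c} \<in> borel_measurable borel" for c
      by (rule fld_measurable[OF H _ separated_singleton]) simp
    have "card ?S > 0" using q by (simp add: card_lattice_points)
    then show "?S \<noteq> {}" by auto
    show "(1 / ?H) *\<^sub>R c \<in> cbox 0 1" if "c \<in> ?S" for c by (rule lattice_points_scaled_in_cube[OF that])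
    show "info (fld ?H {c}) (fld ?H {}) \<le> info_const C * c0\<^sup>2 * (1 + R * ?H powr (- (2 * \<beta> + real CARD('d))))" if "c \<in> ?S" for c
      using lattice_points_scaled_in_cube[OF that] separated_singleton H by (intro info_fld_le) auto
    show "0 \<le> amp ?H" by (rule amp_nonneg)
    show "\<tau> > 0" by (rule tau)
    show "(info_const C * c0\<^sup>2 * (1 + R * (2 * real q) powr (- (2 * \<beta> + real CARD('d)))) + 1) / \<tau>
      + exp \<tau> / real (card ?S) \<le> 1 / 2" using tau(2) by (simp add: card_lattice_points)
    fix c c' :: "real^'d" assume c: "c \<in> ?S" "c' \<in> ?S" "c \<noteq> c'"
    have "bump (Suc l + 2) (c - c') = 0"
      using separated_bump_eq_0[OF separated_lattice_points c, of "Suc l + 2" c] by simp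
    moreover have "?H *\<^sub>R (1 / ?H) *\<^sub>R c = c" using q by simp
    ultimately show "amp ?H \<le> norm (fld ?H {c} ((1 / ?H) *\<^sub>R c) - fld ?H {c'} ((1 / ?H) *\<^sub>R c))"
      by (simp add: fld_def bump_field_def bumps_def axis_diff)
  qed
  then obtain c where "ennreal ((amp ?H)\<^sup>2 / 8) \<le> E (fld ?H {c}) (\<lambda>y. SUP z\<in>cbox 0 1. sq_err fh (fld ?H {c}) z y)"
    by blast
  also have "\<dots> \<le> (SUP f\<in>F. E f (\<lambda>y. SUP z\<in>cbox 0 1. sq_err fh f z y))"
    by (rule SUP_upper) (rule fld_in_F[OF H _ separated_singleton], simp)
  finally show ?thesis .
qed

lemma integrated_risk:
  assumes fh: "fh \<in> estimators I" and q: "q \<ge> 1"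
    and small: "info_const C * c0\<^sup>2 \<le> 1 / 2" "R * (2 * real q) powr (- (2 * \<beta> + real CARD('d))) \<le> 1"
  defines "\<kappa> \<equiv> (3 / 4 :: real) ^ ((Suc l + 2) * CARD('d))"
  shows "ennreal (test_const * (amp (2 * real q) * \<kappa>)\<^sup>2 * (1 / 2) ^ CARD('d) / 2)
    \<le> (SUP f\<in>F. E f (int_sq_err fh f))"
proof -
  let ?H = "2 * real q" and ?S = "lattice_points q :: (real^'d) set"
  have H: "?H \<ge> 1" "q > 0" using q by auto
  note sep = separated_subset[OF separated_lattice_points]
  note fin = finite_subset[OF _ finite_lattice_points]
  have "ennreal (test_const * (amp ?H * \<kappa>)\<^sup>2 * (1 / ?H) ^ CARD('d) * real (card ?S) / 2)
      \<le> (SUP f\<in>F. E f (int_sq_err fh f))"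
  proof (rule assouad_risk[where f = "fld ?H" and B = "cell q", OF fh _ finite_lattice_points])
    show "fld ?H A \<in> borel_measurable borel" "fld ?H A \<in> F" if "A \<subseteq> ?S" for A
      using that by (auto intro!: fld_measurable fld_in_F H sep fin)
    show "cell q c \<in> sets borel" for c :: "real^'d" by (simp add: cell_def)
    show "cell q c \<subseteq> cbox 0 1" if "c \<in> ?S" for c by (rule cell_subset_cube[OF that H(2)])
    show "disjoint_family_on (cell q) ?S" by (rule disjoint_cells[OF H(2)])
    show "emeasure lborel (cell q c) = ennreal ((1 / ?H) ^ CARD('d))" for c :: "real^'d"
      by (rule emeasure_cell[OF H(2)])
    show "0 \<le> (1 / ?H) ^ CARD('d)" by simp
    show "0 \<le> amp ?H * \<kappa>" using amp_nonneg by (simp add: \<kappa>_def)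
    fix A c assume c: "c \<in> ?S" and A: "A \<subseteq> ?S - {c}"
    have A': "finite A" "c \<notin> A" "separated (insert c A)"
      using A c by (auto intro!: sep intro: fin)
    show "info (fld ?H (insert c A)) (fld ?H A) \<le> 1"
      by (rule info_le_1[OF small A'(3,1,2) H(1) lattice_points_scaled_in_cube[OF c]])
    fix z assume "z \<in> cell q c"
    then have "\<kappa> \<le> bump (Suc l + 2) (?H *\<^sub>R z - c)"
      unfolding \<kappa>_def mem_cell[OF H(2)] by (intro bump_ge) blast
    then show "amp ?H * \<kappa> \<le> norm (fld ?H (insert c A) z - fld ?H A z)"
      unfolding fld_diff[OF A'(1,2)] using amp_nonneg by (intro mult_left_mono)
  qed
  \<comment> \<open>The total volume of the cells is \<open>(1 / 2) ^ d\<close> for every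
    \<open>q\<close>, so only the amplitude decays with the grid.\<close>
  also have "test_const * (amp ?H * \<kappa>)\<^sup>2 * (1 / ?H) ^ CARD('d) * real (card ?S) / 2
      = test_const * (amp ?H * \<kappa>)\<^sup>2 * (1 / 2) ^ CARD('d) / 2"
  proof -
    have "(1 / ?H) ^ CARD('d) * real (card ?S) = (1 / ?H * real q) ^ CARD('d)"
      unfolding card_lattice_points of_nat_power by (rule power_mult_distrib[symmetric])
    also have "1 / ?H * real q = 1 / 2" using q by simp
    finally show ?thesis by (simp add: mult.assoc)
  qed
  finally show ?thesis .
qed

end

section \<open>Rates\<close>

lemma exists_nat_near_powr:
  assumes "W \<ge> 1"
  obtains q :: nat where "q \<ge> 1" "W powr e \<le> real q" "e \<ge> 0 \<Longrightarrow> real q \<le> 2 * W powr e"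
proof (rule that[of "nat \<lceil>W powr e\<rceil>"])
  have p: "W powr e > 0" using assms by simp
  then have "\<lceil>W powr e\<rceil> \<ge> 1" by linarith
  then show "nat \<lceil>W powr e\<rceil> \<ge> 1" by linarith
  show "W powr e \<le> real (nat \<lceil>W powr e\<rceil>)" using p by linarith
  assume "e \<ge> 0"
  then have "W powr e \<ge> 1" using assms by (simp add: ge_one_powr_ge_zero)
  then show "real (nat \<lceil>W powr e\<rceil>) \<le> 2 * W powr e" by linarith
qed

context bump_design
begin

text \<open>Taking \<open>q\<close> to be \<open>W powr (1 / p)\<close> rounded up balances
  \<open>W\<close> against \<open>H powr p\<close>. The base 4 collects the 2 in
  \<open>H = 2 * q\<close> and a 2 from rounding. \<open>W\<close> is \<open>R\<close> for the
  pointwise and integrated losses, and \<open>R / ln R\<close> for the supremum loss.\<close>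

lemma grid_size:
  assumes W: "W \<ge> 1"
  defines "p \<equiv> 2 * \<beta> + real CARD('d)"
  obtains q :: nat where "q \<ge> 1" "W * (2 * real q) powr (- p) \<le> 1" "W powr (1 / p) \<le> real q"
    "c0\<^sup>2 * 4 powr (- (2 * \<beta>)) * W powr (- (2 * \<beta>) / p) \<le> (amp (2 * real q))\<^sup>2"
proof -
  have b0: "\<beta> > 0" using \<beta> by linarith
  have p: "p > 0" unfolding p_def using b0 by (intro add_pos_pos) auto
  obtain q :: nat where q: "q \<ge> 1" "W powr (1 / p) \<le> real q" "real q \<le> 2 * W powr (1 / p)"
    using exists_nat_near_powr[OF W, of "1 / p"] p by auto
  have "W = (W powr (1 / p)) powr p" using W p by (simp add: powr_powr)
  also have "\<dots> \<le> (2 * real q) powr p" using q p by (intro powr_mono2) auto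
  finally have "W \<le> (2 * real q) powr p" .
  then have 1: "W * (2 * real q) powr (- p) \<le> 1"
    using q(1) by (simp add: powr_minus field_simps)
  have "(4 * W powr (1 / p)) powr (- (2 * \<beta>)) \<le> (2 * real q) powr (- (2 * \<beta>))"
    using q b0 by (intro powr_mono2') auto
  then have "4 powr (- (2 * \<beta>)) * W powr (- (2 * \<beta>) / p) \<le> (2 * real q) powr (- (2 * \<beta>))"
    by (simp add: powr_mult powr_powr)
  also have "\<dots> = ((2 * real q) powr (- \<beta>))\<^sup>2"
    by (simp add: power2_eq_square powr_add[symmetric])
  finally have "c0\<^sup>2 * (4 powr (- (2 * \<beta>)) * W powr (- (2 * \<beta>) / p)) \<le> c0\<^sup>2 * ((2 * real q) powr (- \<beta>))\<^sup>2"
    by (rule mult_left_mono) simp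
  then have 2: "c0\<^sup>2 * 4 powr (- (2 * \<beta>)) * W powr (- (2 * \<beta>) / p) \<le> (amp (2 * real q))\<^sup>2"
    by (simp only: mult.assoc power_mult_distrib)
  show ?thesis by (rule that[OF q(1) 1 q(2) 2])
qed

lemma pointwise_rate:
  assumes fh: "fh \<in> estimators I" and x0: "x0 \<in> cbox 0 1" and R: "R \<ge> 1"
    and small: "info_const C * c0\<^sup>2 \<le> 1 / 2"
    and k: "k \<le> test_const * (c0\<^sup>2 * 4 powr (- (2 * \<beta>))) / 2"
  shows "ennreal (k * R powr (- (2 * \<beta>) / (2 * \<beta> + real CARD('d)))) \<le> (SUP f\<in>F. E f (sq_err fh f x0))"
proof -
  let ?w = "R powr (- (2 * \<beta>) / (2 * \<beta> + real CARD('d)))"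
  obtain q :: nat where q: "q \<ge> 1" "R * (2 * real q) powr (- (2 * \<beta> + real CARD('d))) \<le> 1"
    and amp: "c0\<^sup>2 * 4 powr (- (2 * \<beta>)) * ?w \<le> (amp (2 * real q))\<^sup>2"
    using grid_size[OF R] by metis
  have "k * ?w \<le> test_const * (c0\<^sup>2 * 4 powr (- (2 * \<beta>))) / 2 * ?w"
    using k by (rule mult_right_mono) simp
  also have "\<dots> = test_const / 2 * (c0\<^sup>2 * 4 powr (- (2 * \<beta>)) * ?w)" by simp
  also have "\<dots> \<le> test_const / 2 * (amp (2 * real q))\<^sup>2"
    using test_const_pos by (intro mult_left_mono amp) simp
  finally have "k * ?w \<le> test_const * (amp (2 * real q))\<^sup>2 / 2" by simp
  then have "ennreal (k * ?w) \<le> ennreal (test_const * (amp (2 * real q))\<^sup>2 / 2)" by (rule ennreal_leI)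
  also have "\<dots> \<le> (SUP f\<in>F. E f (sq_err fh f x0))"
    using q by (intro pointwise_risk fh x0 small) auto
  finally show ?thesis .
qed

lemma integrated_rate:
  assumes fh: "fh \<in> estimators I" and R: "R \<ge> 1"
    and small: "info_const C * c0\<^sup>2 \<le> 1 / 2"
    and k: "k \<le> test_const * ((3 / 4) ^ ((Suc l + 2) * CARD('d)))\<^sup>2 * (1 / 2) ^ CARD('d) / 2 * (c0\<^sup>2 * 4 powr (- (2 * \<beta>)))"
  shows "ennreal (k * R powr (- (2 * \<beta>) / (2 * \<beta> + real CARD('d)))) \<le> (SUP f\<in>F. E f (int_sq_err fh f))"
proof -
  let ?w = "R powr (- (2 * \<beta>) / (2 * \<beta> + real CARD('d)))"
  define \<kappa> where "\<kappa> = (3 / 4 :: real) ^ ((Suc l + 2) * CARD('d))"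
  define D where "D = test_const * \<kappa>\<^sup>2 * (1 / 2) ^ CARD('d) / 2"
  have D: "D \<ge> 0" using test_const_pos by (simp add: D_def)
  obtain q :: nat where q: "q \<ge> 1" "R * (2 * real q) powr (- (2 * \<beta> + real CARD('d))) \<le> 1"
    and amp: "c0\<^sup>2 * 4 powr (- (2 * \<beta>)) * ?w \<le> (amp (2 * real q))\<^sup>2"
    using grid_size[OF R] by metis
  have "k * ?w \<le> D * (c0\<^sup>2 * 4 powr (- (2 * \<beta>))) * ?w"
    using k unfolding D_def \<kappa>_def by (rule mult_right_mono) simp
  also have "\<dots> = D * (c0\<^sup>2 * 4 powr (- (2 * \<beta>)) * ?w)" by simp
  also have "\<dots> \<le> D * (amp (2 * real q))\<^sup>2" using D by (intro mult_left_mono amp)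
  also have "\<dots> = test_const * (amp (2 * real q) * \<kappa>)\<^sup>2 * (1 / 2) ^ CARD('d) / 2"
    by (simp add: D_def power_mult_distrib)
  finally have "ennreal (k * ?w) \<le> ennreal (test_const * (amp (2 * real q) * \<kappa>)\<^sup>2 * (1 / 2) ^ CARD('d) / 2)"
    by (rule ennreal_leI)
  also have "\<dots> \<le> (SUP f\<in>F. E f (int_sq_err fh f))"
    unfolding \<kappa>_def by (rule integrated_risk[OF fh q(1) small q(2)])
  finally show ?thesis .
qed

text \<open>With \<open>s = ln R\<close> the number of cells \<open>M\<close> satisfies
  \<open>ln M \<ge> \<rho> * s\<close>, while the information is at most
  \<open>\<rho> / 32 * (1 + s)\<close>. Both are of order \<open>ln R\<close>, and the small factor
  \<open>\<rho> / 32\<close> lets the hypotheses outnumber what the data can tell apart. The bound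
  on \<open>R\<close> gives \<open>\<rho> * s \<ge> 16\<close>, which absorbs the additive
  constants.\<close>

lemma uniform_rate:
  defines "\<rho> \<equiv> real CARD('d) / (2 * (2 * \<beta> + real CARD('d)))"
  assumes fh: "fh \<in> estimators I" and R: "R \<ge> exp (16 / \<rho>)"
    and small: "info_const C * c0\<^sup>2 \<le> \<rho> / 32"
    and k: "k \<le> c0\<^sup>2 * 4 powr (- (2 * \<beta>)) / 8"
  shows "ennreal (k * (R / ln R) powr (- (2 * \<beta>) / (2 * \<beta> + real CARD('d))))
    \<le> (SUP f\<in>F. E f (\<lambda>y. SUP z\<in>cbox 0 1. sq_err fh f z y))"
proof -
  define p where "p = 2 * \<beta> + real CARD('d)"
  define s where "s = ln R"
  define W where "W = R / s"
  let ?w = "W powr (- (2 * \<beta>) / p)"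
  have d: "real CARD('d) > 0" by simp
  have b0: "\<beta> > 0" using \<beta> by linarith
  then have p: "p > 0" using d by (simp add: p_def add_pos_pos)
  have \<rho>: "0 < \<rho>" "\<rho> \<le> 1 / 2" using d b0 by (auto simp: \<rho>_def field_simps)
  have R0: "R > 0" using R exp_gt_zero less_le_trans by blast
  have s: "16 / \<rho> \<le> s" unfolding s_def using R R0 by (simp add: ln_ge_iff)
  have "16 / \<rho> \<ge> 32" using \<rho> by (simp add: field_simps)
  with s have s32: "s \<ge> 32" by linarith
  have \<rho>s: "\<rho> * s \<ge> 16" using s \<rho> by (simp add: field_simps)
  \<comment> \<open>Shows \<open>ln s \<le> s / 2\<close>, so that dividing \<open>R\<close> by its
    logarithm at most halves \<open>ln R\<close>.\<close>
  have "ln (s / 2) \<le> s / 2 - 1" using s32 by (intro ln_le_minus_one) simp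
  moreover have "ln (s / 2) = ln s - ln 2" using s32 by (simp add: ln_div)
  moreover have "ln (2::real) \<le> 1" using ln_le_minus_one[of "2::real"] by simp
  ultimately have lns: "ln s \<le> s / 2" by linarith
  have W0: "W > 0" using R0 s32 by (simp add: W_def)
  have "ln W = s - ln s" using R0 s32 by (simp add: W_def s_def ln_div)
  with lns have lnW: "ln W \<ge> s / 2" by simp
  then have "ln W \<ge> 0" using s32 by simp
  then have W1: "W \<ge> 1" using W0 by simp
  obtain q :: nat where q: "q \<ge> 1" "W * (2 * real q) powr (- p) \<le> 1" "W powr (1 / p) \<le> real q"
    and amp: "c0\<^sup>2 * 4 powr (- (2 * \<beta>)) * ?w \<le> (amp (2 * real q))\<^sup>2"
    using grid_size[OF W1] unfolding p_def by metis
  define M where "M = real q ^ CARD('d)"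
  have M1: "M > 0" using q by (simp add: M_def)
  have "ln (W powr (1 / p)) \<le> ln (real q)" using q W0 by (subst ln_le_cancel_iff) auto
  then have "ln W / p \<le> ln (real q)" using W0 by (simp add: ln_powr)
  then have "real CARD('d) * (ln W / p) \<le> real CARD('d) * ln (real q)" by (rule mult_left_mono) simp
  also have "\<dots> = ln M" unfolding M_def using q by (subst ln_realpow) auto
  finally have lnM': "real CARD('d) / p * ln W \<le> ln M" by simp
  have "\<rho> * s = real CARD('d) / p * (s / 2)" by (simp add: \<rho>_def p_def)
  also have "\<dots> \<le> real CARD('d) / p * ln W" using lnW p by (intro mult_left_mono) auto
  finally have lnM: "\<rho> * s \<le> ln M" using lnM' by simp
  \<comment> \<open>With half the logarithm, \<open>exp \<tau> / M = exp (- \<tau>)\<close> is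
    small, and \<open>\<tau>\<close> still exceeds the information by a factor 4. Each summand of
    the testing bound is then at most 1/4.\<close>
  define \<tau> where "\<tau> = ln M / 2"
  have \<tau>: "\<tau> \<ge> \<rho> * s / 2" "\<tau> \<ge> 8" using lnM \<rho>s by (auto simp: \<tau>_def)
  have Rq: "R * (2 * real q) powr (- p) \<le> s"
  proof -
    have "R * (2 * real q) powr (- p) = s * (W * (2 * real q) powr (- p))"
      using s32 by (simp add: W_def)
    also have "\<dots> \<le> s * 1" using q(2) s32 by (intro mult_left_mono) auto
    finally show ?thesis by simp
  qed
  have i0: "0 \<le> info_const C * c0\<^sup>2"
    using pos by (auto simp: info_const_def intro!: mult_nonneg_nonneg add_nonneg_nonneg)
  have "info_const C * c0\<^sup>2 * (1 + R * (2 * real q) powr (- p)) \<le> \<rho> / 32 * (1 + s)"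
    using small Rq i0 R0 \<rho> by (intro mult_mono add_left_mono) (auto intro: add_nonneg_nonneg mult_nonneg_nonneg)
  also have "\<dots> \<le> \<rho> * s / 16" using \<rho> s32 by (simp add: field_simps)
  finally have "info_const C * c0\<^sup>2 * (1 + R * (2 * real q) powr (- p)) + 1 \<le> \<rho> * s / 8"
    using \<rho>s by simp
  also have "\<dots> \<le> 1 / 4 * \<tau>" using \<tau>(1) by simp
  finally have A: "(info_const C * c0\<^sup>2 * (1 + R * (2 * real q) powr (- p)) + 1) / \<tau> \<le> 1 / 4"
    using \<tau>(2) by (simp add: field_simps)
  have "exp \<tau> / M = exp (- \<tau>)"
  proof -
    have "exp \<tau> * exp \<tau> = exp (ln M)" by (simp add: exp_add[symmetric] \<tau>_def)
    then have "M = exp \<tau> * exp \<tau>" using M1 by simp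
    then show ?thesis by (simp add: exp_minus field_simps)
  qed
  also have "\<dots> \<le> 1 / 4"
  proof -
    have "4 \<le> exp \<tau>" using exp_ge_add_one_self[of \<tau>] \<tau>(2) by linarith
    then show ?thesis by (simp add: exp_minus field_simps)
  qed
  finally have B: "exp \<tau> / real q ^ CARD('d) \<le> 1 / 4" by (simp only: M_def)
  have "k * ?w \<le> c0\<^sup>2 * 4 powr (- (2 * \<beta>)) / 8 * ?w" using k by (rule mult_right_mono) simp
  also have "\<dots> \<le> (amp (2 * real q))\<^sup>2 / 8" using amp by simp
  finally have "ennreal (k * ?w) \<le> ennreal ((amp (2 * real q))\<^sup>2 / 8)" by (rule ennreal_leI)
  also have "\<dots> \<le> (SUP f\<in>F. E f (\<lambda>y. SUP z\<in>cbox 0 1. sq_err fh f z y))"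
  proof (rule uniform_risk[OF fh q(1)])
    show "\<tau> > 0" using \<tau>(2) by simp
    show "(info_const C * c0\<^sup>2 * (1 + R * (2 * real q) powr (- (2 * \<beta> + real CARD('d)))) + 1) / \<tau>
      + exp \<tau> / real q ^ CARD('d) \<le> 1 / 2"
      using add_mono[OF A[unfolded p_def] B] by simp
  qed
  finally show ?thesis by (simp only: W_def s_def p_def)
qed

end

section \<open>Combining the two obstructions and choosing the constants\<close>

lemma add_le_const_mult:
  fixes S :: ennreal
  assumes "ennreal (k * u) \<le> S" "ennreal (k * v) \<le> S" "k > 0" "0 \<le> u" "0 \<le> v" "2 / k \<le> C"
  shows "ennreal (u + v) \<le> ennreal C * S"
proof -
  have "ennreal u \<le> ennreal (1 / k) * S" "ennreal v \<le> ennreal (1 / k) * S"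
    using mult_left_mono[OF assms(1), of "ennreal (1 / k)"] mult_left_mono[OF assms(2), of "ennreal (1 / k)"] assms(3)
    by (simp_all add: ennreal_mult'[symmetric])
  then have "ennreal u + ennreal v \<le> ennreal (1 / k) * S + ennreal (1 / k) * S" by (rule add_mono)
  also have "\<dots> = ennreal (2 / k) * S"
    using assms(3) by (simp add: distrib_right[symmetric] ennreal_plus[symmetric] del: ennreal_plus)
  also have "\<dots> \<le> ennreal C * S" using assms(6) by (intro mult_right_mono ennreal_leI) auto
  finally show ?thesis using assms by simp
qed

text \<open>The strict inequality gives \<open>l = \<beta> - 1\<close> for an integer \<beta>, so
  the Hoelder exponent \<open>\<beta> - l\<close> always lies in (0, 1].\<close>

lemma greatest_nat_less:
  assumes "\<beta> > 0" and "l = (GREATEST k::nat. real k < \<beta>)"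
  shows "real l < \<beta>" "\<beta> \<le> real l + 1"
proof -
  have bound: "\<And>y. real y < \<beta> \<Longrightarrow> y \<le> nat \<lceil>\<beta>\<rceil>" by linarith
  show "real l < \<beta>"
    unfolding assms(2) by (rule GreatestI_nat[where P = "\<lambda>k. real k < \<beta>" and k = 0]) (use assms(1) bound in auto)
  show "\<beta> \<le> real l + 1"
  proof (rule ccontr)
    assume "\<not> \<beta> \<le> real l + 1"
    then have "Suc l \<le> (GREATEST k::nat. real k < \<beta>)"
      by (intro Greatest_le_nat[where b = "nat \<lceil>\<beta>\<rceil>"]) (use bound in auto)
    then show False using assms(2) by simp
  qed
qed

lemma equidistant_times_eq:
  assumes "observation_times m n T t" "equidistant_times \<Delta> m n t" "j \<in> {1..m}" "i \<le> n j"
  shows "t j i = real i * \<Delta>"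
  using assms(4)
proof (induction i)
  case 0 then show ?case using assms by (simp add: observation_times_def)
next
  case (Suc i)
  then have "i < n j" by simp
  then have "t j (i + 1) - t j i = \<Delta>" using assms(2,3) unfolding equidistant_times_def by blast
  then show ?case using Suc by (simp add: algebra_simps)
qed

theorem corollary3p11:
  fixes \<beta> L\<beta> Cn Cc :: real and L :: "nat \<Rightarrow> real" and l nmax :: nat
  assumes "\<beta> \<ge> 1" and "l = (GREATEST k::nat. real k < \<beta>)"
    and "\<forall>k\<le>l. L k > 0" and "L\<beta> > 0" and "Cn > 0" and "Cc > 0"
  shows "\<exists>C>0. \<forall>(m::nat) (n::nat \<Rightarrow> nat) (T::nat \<Rightarrow> real) (t::nat \<Rightarrow> nat \<Rightarrow> real)
      (x::nat \<Rightarrow> real^'d) (P::(real^'d) measure) (\<Delta>::real).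
    let I = obs_index m n; N = real (\<Sum>j=1..m. n j);
        F = (hoelder_class l \<beta> L L\<beta> :: (real^'d \<Rightarrow> real^'d) set);
        d = real CARD('d)
    in m \<ge> 1 \<longrightarrow> Max (n ` {1..m}) = nmax \<longrightarrow>
       observation_times m n T t \<longrightarrow> centered_law P \<longrightarrow>
       noise_condition Cn P \<longrightarrow> cover_condition Cc m x \<longrightarrow>
       \<Delta> > 0 \<longrightarrow> equidistant_times \<Delta> m n t \<longrightarrow>
       \<Delta> \<le> 1 / C \<longrightarrow> N * \<Delta>\<^sup>2 \<ge> C \<longrightarrow>
         (\<forall>x0\<in>cbox 0 1.
            ennreal C * (INF fh\<in>estimators I. SUP f\<in>F. obs_expectation P I x t f
               (\<lambda>y. ennreal ((norm (fh y x0 - f x0))\<^sup>2)))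
            \<ge> ennreal ((N * \<Delta>\<^sup>2) powr (- (2 * \<beta>) / (2 * \<beta> + d)) + \<Delta> powr (2 * \<beta>))) \<and>
         ennreal C * (INF fh\<in>estimators I. SUP f\<in>F. obs_expectation P I x t f
            (\<lambda>y. SUP z\<in>cbox 0 1. ennreal ((norm (fh y z - f z))\<^sup>2)))
         \<ge> ennreal ((N * \<Delta>\<^sup>2 / ln (N * \<Delta>\<^sup>2)) powr (- (2 * \<beta>) / (2 * \<beta> + d)) + \<Delta> powr (2 * \<beta>)) \<and>
         ennreal C * (INF fh\<in>estimators I. SUP f\<in>F. obs_expectation P I x t f
            (\<lambda>y. \<integral>\<^sup>+z\<in>cbox 0 1. ennreal ((norm (fh y z - f z))\<^sup>2) \<partial>lborel))
         \<ge> ennreal ((N * \<Delta>\<^sup>2) powr (- (2 * \<beta>) / (2 * \<beta> + d)) + \<Delta> powr (2 * \<beta>))"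
proof -
  have \<beta>: "real l < \<beta>" "\<beta> \<le> real l + 1"
    using greatest_nat_less[OF _ assms(2)] assms(1) by auto
  have Lpos: "\<And>k. k \<le> l \<Longrightarrow> L k > 0" using assms(3) by blast
  obtain c1 \<delta> where c1: "c1 > 0" "\<delta> > 0" and disc:
    "\<forall>\<Delta> (P :: (real^'d) measure) I x t fh.
       0 < \<Delta> \<longrightarrow> \<Delta> \<le> \<delta> \<longrightarrow> prob_space P \<longrightarrow> sets P = sets borel \<longrightarrow> finite I \<longrightarrow>
       (\<forall>(j, i)\<in>I. t j i = real i * \<Delta>) \<longrightarrow> fh \<in> estimators I \<longrightarrow>
       (\<forall>z. ennreal (c1 * \<Delta> powr (2 * \<beta>)) \<le>
          (SUP f\<in>hoelder_class l \<beta> L L\<beta>. obs_expectation P I x t f (sq_err fh f z))) \<and>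
       ennreal (c1 * \<Delta> powr (2 * \<beta>)) \<le>
          (SUP f\<in>hoelder_class l \<beta> L L\<beta>. obs_expectation P I x t f (int_sq_err fh f))"
    using discretization_lower_bound[where 'd = 'd and L = L, OF \<beta> Lpos assms(4)] by auto
  obtain C where C: "C > 0" and bumps: "\<And>S::(real^'d) set. finite S \<Longrightarrow> separated S \<Longrightarrow>
      smooth_bound (Suc l) C UNIV (bumps (Suc l + 2) S)"
    by (rule smooth_bound_bumps[where 'd = 'd and k = "Suc l"]) (rule that)
  define d where "d = real CARD('d)"
  define \<rho> where "\<rho> = d / (2 * (2 * \<beta> + d))"
  \<comment> \<open>This is \<open>info_const C\<close> written out, since the constants must be
    chosen before an experiment is fixed.\<close>
  define B where "B = Cn * real nmax ^ 3 * C\<^sup>2 * (1 + Cc * d ^ CARD('d))"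
  \<comment> \<open>The first term keeps the bumps in the class, the second makes the information
    small enough for the uniform rate; as \<open>\<rho> \<le> 1 / 2\<close> this also covers the
    other two rates. \<open>B + 1\<close> guards against \<open>B = 0\<close>.\<close>
  define c0 where "c0 = min (Min (insert L\<beta> (L ` {..l})) / (2 * C)) (sqrt (\<rho> / (32 * (B + 1))))"
  define k where "k = Min {c1, test_const * (c0\<^sup>2 * 4 powr (- (2 * \<beta>))) / 2, c0\<^sup>2 * 4 powr (- (2 * \<beta>)) / 8,
    test_const * ((3 / 4) ^ ((Suc l + 2) * CARD('d)))\<^sup>2 * (1 / 2) ^ CARD('d) / 2 * (c0\<^sup>2 * 4 powr (- (2 * \<beta>)))}"
  \<comment> \<open>In order: \<open>\<Delta> \<le> 1\<close> and \<open>R \<ge> 1\<close>; the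
    range of the discretisation bound; the logarithmic slack of the uniform rate; the loss from
    adding two lower bounds with factor \<open>k\<close>.\<close>
  define K where "K = Max {1, 1 / \<delta>, exp (16 / \<rho>), 2 / k}"
  have d: "d > 0" by (simp add: d_def)
  have \<rho>: "0 < \<rho>" "\<rho> \<le> 1 / 2" using d assms(1) by (auto simp: \<rho>_def field_simps)
  have B: "B \<ge> 0" using assms C by (simp add: B_def d_def)
  have Min0: "Min (insert L\<beta> (L ` {..l})) > 0" using Lpos assms(4) by (auto simp: Min_gr_iff)
  have c0: "c0 > 0" using Min0 C B \<rho> by (simp add: c0_def)
  have c0_le: "c0 * C \<le> Min (insert L\<beta> (L ` {..l})) / 2"
  proof -
    have "c0 \<le> Min (insert L\<beta> (L ` {..l})) / (2 * C)" by (simp add: c0_def)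
    then show ?thesis using C by (simp add: field_simps)
  qed
  have c0L: "c0 * C \<le> L i / 2" if "i \<le> l" for i
    using c0_le Min_le[of "insert L\<beta> (L ` {..l})" "L i"] that by simp
  have c0\<beta>: "2 * c0 * C \<le> L\<beta>"
    using c0_le Min_le[of "insert L\<beta> (L ` {..l})" L\<beta>] by simp
  have small: "B * c0\<^sup>2 \<le> \<rho> / 32"
  proof -
    have "c0\<^sup>2 \<le> (sqrt (\<rho> / (32 * (B + 1))))\<^sup>2" using c0 by (intro power_mono) (auto simp: c0_def)
    also have "\<dots> = \<rho> / (32 * (B + 1))" using \<rho> B by simp
    finally have "(B + 1) * c0\<^sup>2 \<le> \<rho> / 32" using B by (simp add: field_simps)
    moreover have "B * c0\<^sup>2 \<le> (B + 1) * c0\<^sup>2" by (intro mult_right_mono) auto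
    ultimately show ?thesis by linarith
  qed
  have k: "k > 0" using c1 c0 test_const_pos by (simp add: k_def)
  have kle: "k \<le> c1" "k \<le> test_const * (c0\<^sup>2 * 4 powr (- (2 * \<beta>))) / 2" "k \<le> c0\<^sup>2 * 4 powr (- (2 * \<beta>)) / 8"
    "k \<le> test_const * ((3 / 4) ^ ((Suc l + 2) * CARD('d)))\<^sup>2 * (1 / 2) ^ CARD('d) / 2 * (c0\<^sup>2 * 4 powr (- (2 * \<beta>)))"
    unfolding k_def by (rule Min_le; simp)+
  have K: "1 \<le> K" "1 / \<delta> \<le> K" "exp (16 / \<rho>) \<le> K" "2 / k \<le> K"
    unfolding K_def by (rule Max_ge; simp)+
  show ?thesis
    unfolding Let_def
  proof (intro exI[of _ K] conjI allI impI ballI)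
    show "K > 0" using K(1) by linarith
    fix m n T t and x :: "nat \<Rightarrow> real^'d" and P :: "(real^'d) measure" and \<Delta>
    assume m: "m \<ge> 1" and nm: "Max (n ` {1..m}) = nmax" and ot: "observation_times m n T t"
      and P: "centered_law P" and noise: "noise_condition Cn P" and cover: "cover_condition Cc m x"
      and \<Delta>: "\<Delta> > 0" and eq: "equidistant_times \<Delta> m n t" and \<Delta>K: "\<Delta> \<le> 1 / K"
      and RK: "K \<le> real (\<Sum>j=1..m. n j) * \<Delta>\<^sup>2"
    have \<Delta>1: "\<Delta> \<le> 1" using \<Delta>K K(1) by (meson le_divide_eq_1 less_le_trans order_trans zero_less_one divide_le_eq_1_pos)
    have \<Delta>\<delta>: "\<Delta> \<le> \<delta>"
    proof -
      have "1 \<le> K * \<delta>" using K(2) c1 by (simp add: field_simps)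
      then have "1 / K \<le> \<delta>" using K(1) by (simp add: field_simps)
      then show ?thesis using \<Delta>K by simp
    qed
    interpret bump_design P m n x t \<Delta> Cn Cc nmax l \<beta> L L\<beta> C c0
    proof (intro bump_design.intro design.intro bump_design_axioms.intro)
      show "prob_space P" "sets P = sets borel" using P by (auto simp: centered_law_def)
      show "1 \<le> n j \<and> n j \<le> nmax" if "j \<in> {1..m}" for j
        using that ot nm[symmetric] by (auto simp: observation_times_def)
      show "t j i = real i * \<Delta>" if "j \<in> {1..m}" "i \<le> n j" for j i
        by (rule equidistant_times_eq[OF ot eq that])
    qed (use noise cover m \<Delta> assms \<beta> c0L c0\<beta> Lpos c0 bumps \<Delta>1 in auto)
    have ic: "info_const C = B" by (simp add: info_const_def B_def d_def)
    have R1: "R \<ge> 1" and Re: "R \<ge> exp (16 / \<rho>)" using RK K by auto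
    have tI: "\<forall>(j, i)\<in>I. t j i = real i * \<Delta>" using t_I by auto
    note disc' = disc[THEN spec, of \<Delta>, THEN spec, of P, THEN spec, of I, THEN spec, of x,
        THEN spec, of t, THEN spec, THEN mp, OF \<Delta>, THEN mp, OF \<Delta>\<delta>, THEN mp, OF local.P(1),
        THEN mp, OF local.P(2), THEN mp, OF finite_I, THEN mp, OF tI, THEN mp]
    have small2: "info_const C * c0\<^sup>2 \<le> 1 / 2" using small \<rho> ic by simp
    have k\<Delta>: "ennreal (k * \<Delta> powr (2 * \<beta>)) \<le> S" if "ennreal (c1 * \<Delta> powr (2 * \<beta>)) \<le> S" for S
      using kle(1) by (intro order_trans[OF ennreal_leI that] mult_right_mono) auto
    have disc_pt: "ennreal (k * \<Delta> powr (2 * \<beta>)) \<le> (SUP f\<in>F. E f (sq_err fh f z))"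
      and disc_int: "ennreal (k * \<Delta> powr (2 * \<beta>)) \<le> (SUP f\<in>F. E f (int_sq_err fh f))"
      if "fh \<in> estimators I" for fh z
      using disc'[OF that] by (blast intro: k\<Delta>)+
    \<comment> \<open>The supremum over the cube dominates the pointwise loss at the corner
      0.\<close>
    have disc_sup: "ennreal (k * \<Delta> powr (2 * \<beta>)) \<le> (SUP f\<in>F. E f (\<lambda>y. SUP z\<in>cbox 0 1. sq_err fh f z y))"
      if "fh \<in> estimators I" for fh
    proof -
      have "(SUP f\<in>F. E f (sq_err fh f 0)) \<le> (SUP f\<in>F. E f (\<lambda>y. SUP z\<in>cbox 0 1. sq_err fh f z y))"
        by (intro SUP_mono' obs_expectation_mono SUP_upper) (simp add: in_unit_cube)
      with disc_pt[OF that, of 0] show ?thesis by (rule order_trans)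
    qed
    show "ennreal (R powr (- (2 * \<beta>) / (2 * \<beta> + real CARD('d))) + \<Delta> powr (2 * \<beta>))
      \<le> ennreal K * (INF fh\<in>estimators I. SUP f\<in>F. E f (\<lambda>y. ennreal ((norm (fh y x0 - f x0))\<^sup>2)))"
      if x0: "x0 \<in> cbox 0 1" for x0
    proof (rule add_le_const_mult[OF INF_greatest INF_greatest k _ _ K(4)])
      fix fh :: "(nat \<times> nat \<Rightarrow> real^'d) \<Rightarrow> real^'d \<Rightarrow> real^'d"
      assume fh: "fh \<in> estimators I"
      show "ennreal (k * R powr (- (2 * \<beta>) / (2 * \<beta> + real CARD('d)))) \<le> (SUP f\<in>F. E f (sq_err fh f x0))"
        by (rule pointwise_rate[OF fh x0 R1 small2 kle(2)])
      show "ennreal (k * \<Delta> powr (2 * \<beta>)) \<le> (SUP f\<in>F. E f (sq_err fh f x0))"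
        by (rule disc_pt[OF fh])
    qed auto
    show "ennreal ((R / ln R) powr (- (2 * \<beta>) / (2 * \<beta> + real CARD('d))) + \<Delta> powr (2 * \<beta>))
      \<le> ennreal K * (INF fh\<in>estimators I. SUP f\<in>F. E f (\<lambda>y. SUP z\<in>cbox 0 1. ennreal ((norm (fh y z - f z))\<^sup>2)))"
    proof (rule add_le_const_mult[OF INF_greatest INF_greatest k _ _ K(4)])
      fix fh :: "(nat \<times> nat \<Rightarrow> real^'d) \<Rightarrow> real^'d \<Rightarrow> real^'d"
      assume fh: "fh \<in> estimators I"
      show "ennreal (k * (R / ln R) powr (- (2 * \<beta>) / (2 * \<beta> + real CARD('d))))
          \<le> (SUP f\<in>F. E f (\<lambda>y. SUP z\<in>cbox 0 1. sq_err fh f z y))"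
        by (rule uniform_rate[OF fh Re[unfolded \<rho>_def d_def] small[folded ic, unfolded \<rho>_def d_def] kle(3)])
      show "ennreal (k * \<Delta> powr (2 * \<beta>)) \<le> (SUP f\<in>F. E f (\<lambda>y. SUP z\<in>cbox 0 1. sq_err fh f z y))"
        by (rule disc_sup[OF fh])
    qed auto
    show "ennreal (R powr (- (2 * \<beta>) / (2 * \<beta> + real CARD('d))) + \<Delta> powr (2 * \<beta>))
      \<le> ennreal K * (INF fh\<in>estimators I. SUP f\<in>F. E f (\<lambda>y. \<integral>\<^sup>+z\<in>cbox 0 1. ennreal ((norm (fh y z - f z))\<^sup>2) \<partial>lborel))"
    proof (rule add_le_const_mult[OF INF_greatest INF_greatest k _ _ K(4)])
      fix fh :: "(nat \<times> nat \<Rightarrow> real^'d) \<Rightarrow> real^'d \<Rightarrow> real^'d"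
      assume fh: "fh \<in> estimators I"
      show "ennreal (k * R powr (- (2 * \<beta>) / (2 * \<beta> + real CARD('d)))) \<le> (SUP f\<in>F. E f (int_sq_err fh f))"
        by (rule integrated_rate[OF fh R1 small2 kle(4)])
      show "ennreal (k * \<Delta> powr (2 * \<beta>)) \<le> (SUP f\<in>F. E f (int_sq_err fh f))"
        by (rule disc_int[OF fh])
    qed auto
  qed
qed

end
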